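(* Let $p>2$ be a prime, $\mathbf{F}$ a field of characteristic $p$, and $M\in\mathbf{F}^{2\times4}$ with $\gamma_{1234}(M)=0$, $\gamma_{1235}(M)=0$, $\gamma_{1357}(M)=0$ and $\gamma_{1246}(M)\neq0$. Then, by an admissible change of coordinates (see context), $M$ may be taken to be of the form $$M=\begin{pmatrix}1&0&0&0\\0&c_{22}&c_{23}&c_{24}\end{pmatrix}$$ (still satisfying the same conditions), and for $M$ of this form, with $h_1$, $N_M(y)$, $N_M(z)$ as defined in the context, the set $\mathcal B:=\{x,N_M(y),h_1,N_M(z)\}$ is a SAGBI basis for $\mathbf{F}[V_M]^E$. Furthermore, $\mathbf{F}[V_M]^E$ is a hypersurface with the relation coming from the subduction of the tête-à-tête $(h_1^p,N_M(y)^{p^3+1})$.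
   Context: For $M=(c_{ij})\in\mathbf{F}^{2\times4}$, $E=\langle e_1,e_2,e_3,e_4\rangle\cong(\mathbf{Z}/p)^4$ acts on $\mathbf{F}[V_M]=\mathbf{F}[x,y,z]$ (on the right, by algebra automorphisms) by $x\cdot e_j=x$, $y\cdot e_j=y+c_{1j}x$, $z\cdot e_j=z+2c_{1j}y+(c_{1j}^2+c_{2j})x$; $\mathbf{F}[V_M]^E$ is the ring of invariants. For $f\in\mathbf{F}[V_M]$, $N_M(f)$ is the product of the distinct elements of the $E$-orbit of $f$. Admissible change of coordinates: a change of generators of $E$ (replacing $M$ by $Mg$ with $g\in\mathrm{GL}_4(\mathbf{F}_p)$), and/or a change of basis $(x,y,z)\mapsto(cx,\,y,\,c^{-1}(z+ay))$ of $V_M^*$ with $c\in\mathbf{F}^\times$, $a\in\mathbf{F}$, which replaces each column $(c_{1j},c_{2j})^T$ of $M$ by $(c^{-1}c_{1j},\,c^{-2}(c_{2j}+ac_{1j}))^T$. Minors: $\Gamma(M)$ is the $10\times4$ matrix whose row $2k+1$ is $(c_{11}^{p^k},\dots,c_{14}^{p^k})$ and whose row $2k+2$ is $(c_{21}^{p^k},\dots,c_{24}^{p^k})$, $k=0,\dots,4$; $\gamma_{ijk\ell}(M)$ is its $4\times4$ minor with rows $i,j,k,\ell$, written $\bar\gamma_{ijk\ell}$. Put $\delta:=y^2-xz$ and $$\bar f_{12468}:=-\bar\gamma_{1246}\delta^{p^3}+\bar\gamma_{1248}\delta^{p^2}x^{2p^3-2p^2}-\bar\gamma_{1268}\delta^{p}x^{2p^3-2p}+\bar\gamma_{1468}\delta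 x^{2p^3-2}+\bar\gamma_{2468}yx^{2p^3-1}.$$ For $M$ satisfying the hypotheses and of the displayed form, $N_M(y)=y^p-yx^{p-1}$; define $$\widetilde{h_1}:=\bar f_{12468}+\bar\gamma_{1246}\left(N_M(y)^{2p^2}+2N_M(y)^{p^2+p}x^{p^3-p^2}+2N_M(y)^{p^2+1}x^{p^3-p}\right),\qquad h_1:=-\frac{\widetilde{h_1}}{2\bar\gamma_{1246}x^{p^3-1}}.$$ Then $h_1\in\mathbf{F}[V_M]^E$ has lead term $y^{p^3+1}$. Conventions: graded reverse lexicographic order with $x<y<z$; $\mathrm{LM}$, $\mathrm{LT}$ denote lead monomial and lead term (with coefficient). A finite subset $\mathcal B=\{b_1,\dots,b_m\}$ of a subalgebra $A$ of a polynomial ring is a SAGBI basis for $A$ if the monomials $\mathrm{LM}(b_i)$ generate the algebra spanned by the lead monomials of the elements of $A$. A tête-à-tête is a pair $(b^I,b^J)$ of products of elements of $\mathcal B$ with $\mathrm{LM}(b^I)=\mathrm{LM}(b^J)$. Its subduction: choose a scalar $c$ with $\mathrm{LT}(b^I)=\mathrm{LT}(cb^J)$ and repeatedly cancel the lead term of $b^I-cb^J$ by scalar multiples of products of elements of $\mathcal B$; if this ends at zero, it expresses $b^I-cb^J$ as a polynomial in $\mathcal B$, giving a relation. "Hypersurface with the relation coming from the subduction of" a tête-à-tête means that the kernel of the surjection from the polynomial ring on $m$ variables sending the variables to $b_1,\dots,b_m$ is the principal ideal generated by the relation so obtained. *)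

theory Defs
  imports
    "HOL-Analysis.Analysis"
    "HOL-Library.Poly_Mapping"
    "HOL-Algebra.Elementary_Groups"
    "HOL-Algebra.Product_Groups"
begin

section \<open>Multivariate polynomials\<close>

text \<open>
  Monomials are finitely supported exponent vectors; multiplication of polynomials is the
  convolution product of \<^theory>\<open>HOL-Library.Poly_Mapping\<close>.
\<close>

type_synonym 'v monomial = "'v \<Rightarrow>\<^sub>0 nat"
type_synonym ('v, 'a) mpoly = "('v \<Rightarrow>\<^sub>0 nat) \<Rightarrow>\<^sub>0 'a"

definition Const :: "'a \<Rightarrow> ('v, 'a::comm_ring_1) mpoly" where
  "Const c = Poly_Mapping.single 0 c"

definition Var :: "'v \<Rightarrow> ('v, 'a::comm_ring_1) mpoly" where
  "Var v = Poly_Mapping.single (Poly_Mapping.single v 1) 1"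

definition monom_prod :: "('i \<Rightarrow> ('v, 'a::comm_ring_1) mpoly) \<Rightarrow> 'i monomial \<Rightarrow> ('v, 'a) mpoly" where
  "monom_prod b I = (\<Prod>i\<in>Poly_Mapping.keys I. b i ^ Poly_Mapping.lookup I i)"

text \<open>The algebra homomorphism sending the variable \<open>i\<close> to \<open>b i\<close>.\<close>

definition subst ::
  "('i \<Rightarrow> ('v, 'a::comm_ring_1) mpoly) \<Rightarrow> ('i, 'a) mpoly \<Rightarrow> ('v, 'a) mpoly" where
  "subst b q = (\<Sum>I\<in>Poly_Mapping.keys q. Const (Poly_Mapping.lookup q I) * monom_prod b I)"

lemma Const_add: "Const (c + d) = Const c + Const d"
  by (simp add: Const_def single_add)

lemma Const_mult: "Const (c * d) = Const c * Const d"
  by (simp add: Const_def mult_single)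

lemma Const_1: "Const 1 = 1"
  by (simp add: Const_def)

lemma module_Const: "module (\<lambda>c (f :: ('v, 'a::comm_ring_1) mpoly). Const c * f)"
  by unfold_locales (simp_all add: Const_add Const_mult Const_1 algebra_simps)

lemma subst_Var: "subst b (Var i) = (b i :: ('v, 'a::comm_ring_1) mpoly)"
  by (cases "(1 :: 'a) = 0")
    (simp_all add: subst_def Var_def monom_prod_def Const_1)

definition subalgebra :: "('v, 'a::comm_ring_1) mpoly set \<Rightarrow> bool" where
  "subalgebra A \<longleftrightarrow> range Const \<subseteq> A \<and>
     (\<forall>f\<in>A. \<forall>g\<in>A. f + g \<in> A \<and> f * g \<in> A)"

section \<open>Lead terms, SAGBI bases, subduction\<close>

definition total_deg :: "'v monomial \<Rightarrow> nat" where
  "total_deg m = (\<Sum>v\<in>Poly_Mapping.keys m. Poly_Mapping.lookup m v)"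

text \<open>
  Strict graded reverse lexicographic order: among monomials of equal degree, the one with the
  larger exponent at the smallest variable where they differ is the smaller one.
\<close>

definition grevlex_less :: "('v::linorder) monomial \<Rightarrow> 'v monomial \<Rightarrow> bool" where
  "grevlex_less m m' \<longleftrightarrow> total_deg m < total_deg m' \<or>
     (total_deg m = total_deg m' \<and>
      (\<exists>v. Poly_Mapping.lookup m v > Poly_Mapping.lookup m' v \<and>
           (\<forall>u<v. Poly_Mapping.lookup m u = Poly_Mapping.lookup m' u)))"

text \<open>Lead exponent vector, lead monomial and lead term; only meaningful for nonzero polynomials.\<close>

definition lead_exp :: "('v::linorder, 'a::comm_ring_1) mpoly \<Rightarrow> 'v monomial" where
  "lead_exp f = (THE m. m \<in> Poly_Mapping.keys f \<and>
     (\<forall>m'\<in>Poly_Mapping.keys f. m' \<noteq> m \<longrightarrow> grevlex_less m' m))"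

definition LM :: "('v::linorder, 'a::comm_ring_1) mpoly \<Rightarrow> ('v, 'a) mpoly" where
  "LM f = Poly_Mapping.single (lead_exp f) 1"

definition LT :: "('v::linorder, 'a::comm_ring_1) mpoly \<Rightarrow> ('v, 'a) mpoly" where
  "LT f = Poly_Mapping.single (lead_exp f) (Poly_Mapping.lookup f (lead_exp f))"

definition sagbi_basis ::
  "('v::linorder, 'a::comm_ring_1) mpoly set \<Rightarrow> ('v, 'a) mpoly set \<Rightarrow> bool" where
  "sagbi_basis B A \<longleftrightarrow> subalgebra A \<and> finite B \<and> B \<subseteq> A \<and> 0 \<notin> B \<and>
     subalgebra hull (LM ` B) = module.span (\<lambda>c f. Const c * f) (LM ` (A - {0}))"

text \<open>
  \<open>subduction b f R\<close>: repeatedly cancelling the lead term by a scalar multiple of a product of the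
  elements \<open>b i\<close> brings \<open>f\<close> to zero, and \<open>R\<close> is the sum of the products used, written as a
  polynomial in one variable for each \<open>b i\<close>.  The products need not be uniquely determined.
\<close>

inductive subduction ::
  "('i \<Rightarrow> ('v::linorder, 'a::comm_ring_1) mpoly) \<Rightarrow> ('v, 'a) mpoly \<Rightarrow> ('i, 'a) mpoly \<Rightarrow> bool"
  for b where
  subduction_zero: "subduction b 0 0"
| subduction_step:
    "\<lbrakk> f \<noteq> 0; Const c * monom_prod b K \<noteq> 0; LT f = LT (Const c * monom_prod b K);
       subduction b (f - Const c * monom_prod b K) R \<rbrakk>
     \<Longrightarrow> subduction b f (R + Poly_Mapping.single K c)"

definition tete_a_tete ::
  "('i \<Rightarrow> ('v::linorder, 'a::comm_ring_1) mpoly) \<Rightarrow> 'i monomial \<Rightarrow> 'i monomial \<Rightarrow> bool" where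
  "tete_a_tete b I J \<longleftrightarrow> LM (monom_prod b I) = LM (monom_prod b J)"

definition subduction_relation ::
  "('i \<Rightarrow> ('v::linorder, 'a::comm_ring_1) mpoly) \<Rightarrow> 'i monomial \<Rightarrow> 'i monomial
     \<Rightarrow> ('i, 'a) mpoly \<Rightarrow> bool" where
  "subduction_relation b I J r \<longleftrightarrow>
     (\<exists>c R. LT (monom_prod b I) = LT (Const c * monom_prod b J) \<and>
            subduction b (monom_prod b I - Const c * monom_prod b J) R \<and>
            r = Poly_Mapping.single I 1 - Poly_Mapping.single J c - R)"

text \<open>
  The algebra \<open>A\<close> is generated by the \<open>b i\<close>, and every relation obtained by subducting the
  tete-a-tete (at least one exists) generates the kernel of the presentation.
\<close>

definition hypersurface_from_tete_a_tete ::
  "('i \<Rightarrow> ('v::linorder, 'a::comm_ring_1) mpoly) \<Rightarrow> 'i monomial \<Rightarrow> 'i monomial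
     \<Rightarrow> ('v, 'a) mpoly set \<Rightarrow> bool" where
  "hypersurface_from_tete_a_tete b I J A \<longleftrightarrow>
     range (subst b) = A \<and> tete_a_tete b I J \<and>
     (\<exists>r. subduction_relation b I J r) \<and>
     (\<forall>r. subduction_relation b I J r \<longrightarrow> {q. subst b q = 0} = {r * q | q. True})"

section \<open>The representation and its invariants\<close>

datatype coord = CX | CY | CZ

instantiation coord :: linorder
begin

definition less_eq_coord :: "coord \<Rightarrow> coord \<Rightarrow> bool" where
  "u \<le> v \<longleftrightarrow> u = CX \<or> v = CZ \<or> u = v"

definition less_coord :: "coord \<Rightarrow> coord \<Rightarrow> bool" where
  "u < v \<longleftrightarrow> u \<le> v \<and> u \<noteq> (v::coord)"

instance
  by standard (auto simp: less_eq_coord_def less_coord_def intro: coord.exhaust)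

end

lemma coord_order: "CX < CY" "CY < CZ"
  by (auto simp: less_eq_coord_def less_coord_def)

abbreviation x_poly :: "(coord, 'a::field) mpoly" where "x_poly \<equiv> Var CX"
abbreviation y_poly :: "(coord, 'a::field) mpoly" where "y_poly \<equiv> Var CY"
abbreviation z_poly :: "(coord, 'a::field) mpoly" where "z_poly \<equiv> Var CZ"

definition gen_image :: "'a::field ^ 4 ^ 2 \<Rightarrow> 4 \<Rightarrow> coord \<Rightarrow> (coord, 'a) mpoly" where
  "gen_image M j v = (case v of
       CX \<Rightarrow> x_poly
     | CY \<Rightarrow> y_poly + Const (M $ 1 $ j) * x_poly
     | CZ \<Rightarrow> z_poly + Const (2 * M $ 1 $ j) * y_poly + Const ((M $ 1 $ j)\<^sup>2 + M $ 2 $ j) * x_poly)"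

definition gen_act :: "'a::field ^ 4 ^ 2 \<Rightarrow> 4 \<Rightarrow> (coord, 'a) mpoly \<Rightarrow> (coord, 'a) mpoly" where
  "gen_act M j = subst (gen_image M j)"

text \<open>
  The group \<open>(Z/p)\<^sup>4\<close>, written additively, with standard generators \<open>e\<^sub>1,\<dots>,e\<^sub>4\<close>.  An element
  \<open>a\<close> acts as the product of the \<open>a j\<close>-th powers of the generators \<open>e\<^sub>j\<close>; the generators act by
  commuting automorphisms of order dividing \<open>p\<close> when the field has characteristic \<open>p\<close>.
\<close>

definition E_group :: "nat \<Rightarrow> (4 \<Rightarrow> int) monoid" where
  "E_group p = product_group UNIV (\<lambda>_. integer_mod_group p)"

definition E_act ::
  "'a::field ^ 4 ^ 2 \<Rightarrow> (4 \<Rightarrow> int) \<Rightarrow> (coord, 'a) mpoly \<Rightarrow> (coord, 'a) mpoly" where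
  "E_act M a = (gen_act M 1 ^^ nat (a 1)) \<circ> (gen_act M 2 ^^ nat (a 2)) \<circ>
               (gen_act M 3 ^^ nat (a 3)) \<circ> (gen_act M 4 ^^ nat (a 4))"

definition invariants :: "nat \<Rightarrow> 'a::field ^ 4 ^ 2 \<Rightarrow> (coord, 'a) mpoly set" where
  "invariants p M = {f. \<forall>a\<in>carrier (E_group p). E_act M a f = f}"

definition orbit :: "nat \<Rightarrow> 'a::field ^ 4 ^ 2 \<Rightarrow> (coord, 'a) mpoly \<Rightarrow> (coord, 'a) mpoly set" where
  "orbit p M f = (\<lambda>a. E_act M a f) ` carrier (E_group p)"

definition orbit_prod :: "nat \<Rightarrow> 'a::field ^ 4 ^ 2 \<Rightarrow> (coord, 'a) mpoly \<Rightarrow> (coord, 'a) mpoly" where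
  "orbit_prod p M f = \<Prod>(orbit p M f)"

section \<open>Admissible changes of coordinates and the normal form\<close>

text \<open>In characteristic \<open>p\<close> the set \<open>range of_int\<close> is the prime field with \<open>p\<close> elements.\<close>

definition GL4_prime_field :: "('a::field ^ 4 ^ 4) set" where
  "GL4_prime_field = {g. (\<forall>i j. g $ i $ j \<in> range of_int) \<and>
     (\<exists>g'. (\<forall>i j. g' $ i $ j \<in> range of_int) \<and> g ** g' = mat 1 \<and> g' ** g = mat 1)}"

text \<open>
  Effect on \<open>M\<close> of passing to the basis \<open>(c x, y, c\<^sup>-\<^sup>1 (z + a y))\<close> of the dual representation.
\<close>

definition basis_change :: "'a::field \<Rightarrow> 'a \<Rightarrow> 'a ^ 4 ^ 2 \<Rightarrow> 'a ^ 4 ^ 2" where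
  "basis_change c a M = vector [\<chi> j. inverse c * M $ 1 $ j,
                                \<chi> j. (inverse c)\<^sup>2 * (M $ 2 $ j + a * M $ 1 $ j)]"

text \<open>
  The two kinds of change commute and each kind is closed under composition, so one of each
  (possibly trivial) suffices.
\<close>

definition admissible_change :: "'a::field ^ 4 ^ 2 \<Rightarrow> 'a ^ 4 ^ 2 \<Rightarrow> bool" where
  "admissible_change M M' \<longleftrightarrow>
     (\<exists>g\<in>GL4_prime_field. \<exists>c a. c \<noteq> 0 \<and> M' = basis_change c a (M ** g))"

definition normal_form :: "'a::field ^ 4 ^ 2 \<Rightarrow> bool" where
  "normal_form M \<longleftrightarrow>
     (\<exists>c22 c23 c24. M = vector [vector [1, 0, 0, 0], vector [0, c22, c23, c24]])"

section \<open>Minors and the invariant of lead term \<open>y^(p^3+1)\<close>\<close>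

text \<open>Rows of \<open>\<Gamma>(M)\<close> are numbered \<open>1,\<dots>,10\<close>.\<close>

definition Gamma_row :: "nat \<Rightarrow> 'a::field ^ 4 ^ 2 \<Rightarrow> nat \<Rightarrow> 'a ^ 4" where
  "Gamma_row p M i = (if odd i then \<chi> j. (M $ 1 $ j) ^ (p ^ ((i - 1) div 2))
                      else \<chi> j. (M $ 2 $ j) ^ (p ^ ((i - 2) div 2)))"

definition gamma :: "nat \<Rightarrow> 'a::field ^ 4 ^ 2 \<Rightarrow> nat \<Rightarrow> nat \<Rightarrow> nat \<Rightarrow> nat \<Rightarrow> 'a" where
  "gamma p M i j k l =
     det (vector [Gamma_row p M i, Gamma_row p M j, Gamma_row p M k, Gamma_row p M l] :: 'a ^ 4 ^ 4)"

definition minor_conditions :: "nat \<Rightarrow> 'a::field ^ 4 ^ 2 \<Rightarrow> bool" where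
  "minor_conditions p M \<longleftrightarrow> gamma p M 1 2 3 4 = 0 \<and> gamma p M 1 2 3 5 = 0 \<and>
     gamma p M 1 3 5 7 = 0 \<and> gamma p M 1 2 4 6 \<noteq> 0"

definition delta :: "(coord, 'a::field) mpoly" where
  "delta = y_poly ^ 2 - x_poly * z_poly"

definition f12468 :: "nat \<Rightarrow> 'a::field ^ 4 ^ 2 \<Rightarrow> (coord, 'a) mpoly" where
  "f12468 p M =
     - Const (gamma p M 1 2 4 6) * delta ^ (p ^ 3)
     + Const (gamma p M 1 2 4 8) * delta ^ (p ^ 2) * x_poly ^ (2 * p ^ 3 - 2 * p ^ 2)
     - Const (gamma p M 1 2 6 8) * delta ^ p * x_poly ^ (2 * p ^ 3 - 2 * p)
     + Const (gamma p M 1 4 6 8) * delta * x_poly ^ (2 * p ^ 3 - 2)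
     + Const (gamma p M 2 4 6 8) * y_poly * x_poly ^ (2 * p ^ 3 - 1)"

definition h1_tilde :: "nat \<Rightarrow> 'a::field ^ 4 ^ 2 \<Rightarrow> (coord, 'a) mpoly" where
  "h1_tilde p M = (let N = orbit_prod p M y_poly in
     f12468 p M + Const (gamma p M 1 2 4 6) *
       (N ^ (2 * p ^ 2) + 2 * N ^ (p ^ 2 + p) * x_poly ^ (p ^ 3 - p ^ 2)
        + 2 * N ^ (p ^ 2 + 1) * x_poly ^ (p ^ 3 - p)))"

text \<open>
  Exact quotient in the polynomial ring, which is a domain; the quotient exists for the matrices
  in normal form with \<open>minor_conditions\<close>.
\<close>

definition h1 :: "nat \<Rightarrow> 'a::field ^ 4 ^ 2 \<Rightarrow> (coord, 'a) mpoly" where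
  "h1 p M = (THE h. Const (2 * gamma p M 1 2 4 6) * x_poly ^ (p ^ 3 - 1) * h = - h1_tilde p M)"

lemma h1_eqI:
  assumes "(2 :: 'a::field) \<noteq> 0" and "gamma p M 1 2 4 6 \<noteq> (0 :: 'a)"
    and h: "Const (2 * gamma p M 1 2 4 6) * x_poly ^ (p ^ 3 - 1) * h = - h1_tilde p M"
  shows "h1 p M = h"
proof -
  have "Const (2 * gamma p M 1 2 4 6) \<noteq> (0 :: (coord, 'a) mpoly)"
    using assms(1,2) by (auto simp: Const_def dest: arg_cong[where f = "\<lambda>q. Poly_Mapping.lookup q 0"])
  moreover have "x_poly \<noteq> (0 :: (coord, 'a) mpoly)"
    by (auto simp: Var_def dest: arg_cong[where f = "\<lambda>q. Poly_Mapping.lookup q (Poly_Mapping.single CX 1)"])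
  ultimately have nz: "Const (2 * gamma p M 1 2 4 6) * x_poly ^ (p ^ 3 - 1) \<noteq> (0 :: (coord, 'a) mpoly)"
    by simp
  show ?thesis
    unfolding h1_def
  proof (rule the_equality)
    fix h' :: "(coord, 'a) mpoly"
    assume "Const (2 * gamma p M 1 2 4 6) * x_poly ^ (p ^ 3 - 1) * h' = - h1_tilde p M"
    with h nz show "h' = h"
      using mult_left_cancel by metis
  qed (fact h)
qed

end

theory Submission
  imports Defs
begin

text \<open>
  Let \<open>M\<close> be in normal form and let \<open>W\<close> be the span of the entries \<open>c22, c23, c24\<close> over the prime
  field \<open>P\<close>.  The group then acts through pairs \<open>(a, b)\<close> in \<open>P \<times> W\<close>, the pair sending \<open>y\<close> to
  \<open>y + a x\<close> and \<open>z\<close> to \<open>z + 2 a y + (a\<^sup>2 + b) x\<close>.  The minor \<open>\<gamma>\<^sub>1\<^sub>2\<^sub>4\<^sub>6\<close> is a Moore determinant in the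
  three entries, so that its not vanishing means that \<open>W\<close> has \<open>p^3\<close> elements
  (\<open>act_vector_eq_0\<close>, \<open>W_props\<close>).

  The heart of the matter is that every invariant is a polynomial in \<open>x\<close>, \<open>N(y)\<close>, \<open>h1\<close>, \<open>N(z)\<close>
  in which \<open>h1\<close> occurs with exponent less than \<open>p\<close>.  The ring is graded, so it suffices to consider
  a homogeneous invariant and to put \<open>x = 1\<close>, which turns it into a polynomial in \<open>Z\<close> over
  the polynomials in \<open>Y\<close>.  Now \<open>W\<close> translates \<open>Z\<close>, and a polynomial that is invariant under a finite
  group of translations is a polynomial in the product of the corresponding linear factors
  (\<open>translation_invariant_poly\<close>).  Used for \<open>W\<close> this shows that the degree in \<open>Z\<close> is a multiple of
  \<open>p^3\<close>; used for the shifts of \<open>Y\<close> it shows that the leading coefficient in \<open>Z\<close> is a polynomial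
  in \<open>Y^p - Y\<close>, which is \<open>N(y)\<close> at \<open>x = 1\<close>.  As \<open>h1\<close> and \<open>N(z)\<close> have degrees \<open>p^3\<close> and \<open>p^4\<close> in
  \<open>Z\<close> and constant leading coefficients, a product \<open>r(N(y)) h1^j N(z)^k\<close> with \<open>j < p\<close> cancels the
  leading term, and induction on the degree applies (\<open>poly_invariant_representable\<close>).

  Going back to homogeneous polynomials costs a power of \<open>x\<close>: some \<open>x^m f\<close> has the required form.
  The power is removed by looking at lead monomials.  Those of
  \<open>x\<close>, \<open>N(y)\<close>, \<open>h1\<close>, \<open>N(z)\<close> are \<open>x\<close>, \<open>y^p\<close>, \<open>y^(p^3+1)\<close>, \<open>z^(p^4)\<close>, and the products with exponent less
  than \<open>p\<close> at \<open>h1\<close> have pairwise different lead monomials, because this exponent is the residue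
  modulo \<open>p\<close> of the exponent of \<open>y\<close> (\<open>inj_lead\<close>).  Hence the products without a factor \<open>x\<close> cannot
  add up to a multiple of \<open>x\<close>, and a common factor \<open>x\<close> can be cancelled (\<open>saturated\<close>).

  Everything else is formal.  The lead monomial of an invariant is the largest
  lead monomial of its products, which gives the SAGBI property, and cancelling the products one
  after the other, largest first, subducts any invariant to zero.  In particular the
  tete-a-tete subducts to zero although no subduction is ever written down.  Each relation that
  arises is monic of degree \<open>p\<close> in the variable of \<open>h1\<close>; division by it leaves a remainder that is a
  combination of products with different lead monomials, hence vanishes if it is a
  relation (\<open>relations_principal\<close>).

  The normal form is reached by counting.  The rows of \<open>M\<close> give additive maps \<open>L\<close> and \<open>K\<close> from the
  vectors over \<open>P\<close> to the field, jointly injective as \<open>\<gamma>\<^sub>1\<^sub>2\<^sub>4\<^sub>6\<close> does not vanish.  A vanishing minor is a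
  linear relation between Frobenius powers of \<open>L\<close> and \<open>K\<close>; where only one of the two maps enters, its
  values are roots of an additive polynomial, and the degree bounds their number.  In this way the three
  vanishing minors restrict the image of \<open>L\<close> to at most \<open>p^3\<close>, then \<open>p^2\<close>, then \<open>p\<close> elements
  (\<open>first_row_rank_one\<close>).  Thus
  the first row consists of multiples by elements of \<open>P\<close> of a single entry and can be reduced
  to \<open>(1, 0, 0, 0)\<close>.
\<close>

abbreviation keys :: "('b \<Rightarrow>\<^sub>0 'c::zero) \<Rightarrow> 'b set" where "keys \<equiv> Poly_Mapping.keys"
abbreviation lookup :: "('b \<Rightarrow>\<^sub>0 'c::zero) \<Rightarrow> 'b \<Rightarrow> 'c" where "lookup \<equiv> Poly_Mapping.lookup"
abbreviation single :: "'b \<Rightarrow> 'c \<Rightarrow> 'b \<Rightarrow>\<^sub>0 'c::zero" where "single \<equiv> Poly_Mapping.single"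

section \<open>Evaluation homomorphisms\<close>

definition ring_map :: "('a::comm_ring_1 \<Rightarrow> 's::comm_ring_1) \<Rightarrow> bool" where
  "ring_map h \<longleftrightarrow> h 1 = 1 \<and> (\<forall>a b. h (a + b) = h a + h b) \<and> (\<forall>a b. h (a * b) = h a * h b)"

lemma ring_mapD:
  assumes "ring_map h"
  shows "h 1 = 1" "h (a + b) = h a + h b" "h (a * b) = h a * h b" "h 0 = 0" "h (- a) = - h a"
    "h (a - b) = h a - h b" "h (a ^ n) = h a ^ n"
proof -
  show *: "h 1 = 1" "h (a * b) = h a * h b" and add: "h (a + b) = h a + h b" for a b
    using assms by (auto simp: ring_map_def)
  show z: "h 0 = 0" using add[of 0 0] by simp
  show m: "h (- a) = - h a" for a using add[of a "- a"] z by (simp add: eq_neg_iff_add_eq_0 add.commute)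
  show "h (a - b) = h a - h b" using add[of a "- b"] m by simp
  show "h (a ^ n) = h a ^ n" by (induction n) (auto simp: *)
qed

lemma ring_map_sum: "ring_map h \<Longrightarrow> h (sum f A) = (\<Sum>i\<in>A. h (f i))"
  by (induction A rule: infinite_finite_induct) (auto simp: ring_mapD)

lemma ring_map_prod: "ring_map h \<Longrightarrow> h (prod f A) = (\<Prod>i\<in>A. h (f i))"
  by (induction A rule: infinite_finite_induct) (auto simp: ring_mapD)

lemma ring_map_comp: "ring_map h \<Longrightarrow> ring_map k \<Longrightarrow> ring_map (h \<circ> k)"
  by (auto simp: ring_map_def)

lemma ring_map_Const: "ring_map (Const :: 'a::comm_ring_1 \<Rightarrow> ('v, 'a) mpoly)"
  by (auto simp: ring_map_def Const_add Const_mult Const_1)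

lemma ring_map_of_nat: "ring_map h \<Longrightarrow> h (of_nat n) = of_nat n"
  by (induction n) (auto simp: ring_mapD)

definition power_prod :: "('i \<Rightarrow> 's::comm_ring_1) \<Rightarrow> 'i monomial \<Rightarrow> 's" where
  "power_prod b I = (\<Prod>i\<in>keys I. b i ^ lookup I i)"

text \<open>
  With \<open>Const\<close> for \<open>\<kappa>\<close> this is substitution of polynomials; other targets are needed to put \<open>x = 1\<close>.
\<close>

definition mpoly_eval ::
  "('a::comm_ring_1 \<Rightarrow> 's::comm_ring_1) \<Rightarrow> ('i \<Rightarrow> 's) \<Rightarrow> ('i, 'a) mpoly \<Rightarrow> 's" where
  "mpoly_eval \<kappa> b q = (\<Sum>I\<in>keys q. \<kappa> (lookup q I) * power_prod b I)"

lemma monom_prod_eq: "monom_prod b = power_prod b"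
  by (simp add: fun_eq_iff monom_prod_def power_prod_def)

lemma subst_eq_eval: "subst b = mpoly_eval Const b"
  by (simp add: fun_eq_iff subst_def mpoly_eval_def monom_prod_eq)

lemma power_prod_superset:
  assumes "finite S" "keys I \<subseteq> S"
  shows "power_prod b I = (\<Prod>i\<in>S. b i ^ lookup I i)"
  unfolding power_prod_def using assms
  by (intro prod.mono_neutral_left) (auto simp: in_keys_iff)

lemma power_prod_zero [simp]: "power_prod b 0 = 1"
  by (simp add: power_prod_def)

lemma power_prod_single [simp]: "power_prod b (single i n) = b i ^ n"
  by (simp add: power_prod_def)

lemma power_prod_add: "power_prod b (I + J) = power_prod b I * power_prod b J"
proof -
  let ?S = "keys I \<union> keys J"
  have "power_prod b (I + J) = (\<Prod>i\<in>?S. b i ^ lookup (I + J) i)"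
    using keys_add[of I J] by (intro power_prod_superset) auto
  also have "\<dots> = power_prod b I * power_prod b J"
    by (simp add: lookup_add power_add prod.distrib power_prod_superset[of ?S I] power_prod_superset[of ?S J])
  finally show ?thesis .
qed

lemma ring_map_power_prod: "ring_map h \<Longrightarrow> h (power_prod b I) = power_prod (h \<circ> b) I"
  by (simp add: power_prod_def ring_map_prod ring_mapD)

lemma mpoly_sum_single: "(\<Sum>I\<in>keys q. single I (lookup q I)) = q"
proof (rule poly_mapping_eqI)
  fix k
  show "lookup (\<Sum>I\<in>keys q. single I (lookup q I)) k = lookup q k"
    by (cases "k \<in> keys q")
      (auto simp: lookup_sum lookup_single when_def in_keys_iff)
qed

lemma mpoly_induct [case_names zero single add]:
  assumes "P 0" "\<And>I c. P (single I c)" "\<And>f g. P f \<Longrightarrow> P g \<Longrightarrow> P (f + g)"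
  shows "P (q :: ('v, 'a::comm_ring_1) mpoly)"
proof -
  have "P (\<Sum>I\<in>A. single I (lookup q I))" if "finite A" for A
    using that by (induction A) (auto intro: assms)
  from this[of "keys q"] show ?thesis by (simp add: mpoly_sum_single)
qed

lemma mpoly_eval_superset:
  assumes "ring_map \<kappa>" "finite S" "keys q \<subseteq> S"
  shows "mpoly_eval \<kappa> b q = (\<Sum>I\<in>S. \<kappa> (lookup q I) * power_prod b I)"
  unfolding mpoly_eval_def using assms
  by (intro sum.mono_neutral_left) (auto simp: in_keys_iff ring_mapD)

lemma mpoly_eval_single: "ring_map \<kappa> \<Longrightarrow> mpoly_eval \<kappa> b (single I c) = \<kappa> c * power_prod b I"
  by (subst mpoly_eval_superset[of _ "{I}"]) auto

lemma mpoly_eval_add: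
  assumes "ring_map \<kappa>"
  shows "mpoly_eval \<kappa> b (f + g) = mpoly_eval \<kappa> b f + mpoly_eval \<kappa> b g"
proof -
  let ?S = "keys f \<union> keys g"
  have "mpoly_eval \<kappa> b (f + g) = (\<Sum>I\<in>?S. \<kappa> (lookup (f + g) I) * power_prod b I)"
    using keys_add[of f g] by (intro mpoly_eval_superset assms) auto
  also have "\<dots> = mpoly_eval \<kappa> b f + mpoly_eval \<kappa> b g"
    using assms
    by (simp add: lookup_add ring_mapD sum.distrib distrib_right
        mpoly_eval_superset[of \<kappa> ?S f] mpoly_eval_superset[of \<kappa> ?S g])
  finally show ?thesis .
qed

lemma mpoly_eval_0 [simp]: "mpoly_eval \<kappa> b 0 = 0"
  by (simp add: mpoly_eval_def)

lemma mpoly_eval_mult: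
  assumes "ring_map \<kappa>"
  shows "mpoly_eval \<kappa> b (f * g) = mpoly_eval \<kappa> b f * mpoly_eval \<kappa> b g"
proof (induction f rule: mpoly_induct)
  case (single I c)
  show ?case
    by (induction g rule: mpoly_induct)
      (simp_all add: mult_single mpoly_eval_single assms ring_mapD power_prod_add mpoly_eval_add
        algebra_simps)
qed (simp_all add: mpoly_eval_add assms distrib_right)

lemma mpoly_eval_1: "ring_map \<kappa> \<Longrightarrow> mpoly_eval \<kappa> b 1 = 1"
  using mpoly_eval_single[of \<kappa> b 0 1] by (simp add: ring_mapD)

lemma ring_map_mpoly_eval: "ring_map \<kappa> \<Longrightarrow> ring_map (mpoly_eval \<kappa> b)"
  by (simp add: ring_map_def[of "mpoly_eval \<kappa> b"] mpoly_eval_add mpoly_eval_mult mpoly_eval_1)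

lemma ring_map_subst: "ring_map (subst b)"
  unfolding subst_eq_eval by (intro ring_map_mpoly_eval ring_map_Const)

lemmas subst_hom = ring_mapD[OF ring_map_subst]

lemma subst_single: "subst b (single I c) = Const c * power_prod b I"
  by (simp add: subst_eq_eval mpoly_eval_single ring_map_Const)

lemma subst_Const: "subst b (Const c) = Const c"
  using subst_single[of b 0 c] by (simp add: Const_def)

lemma ring_map_eval:
  assumes "ring_map h"
  shows "h (mpoly_eval \<kappa> b q) = mpoly_eval (h \<circ> \<kappa>) (h \<circ> b) q"
  by (simp add: mpoly_eval_def ring_map_sum ring_mapD ring_map_power_prod assms)

lemma mpoly_eval_Var: "ring_map \<kappa> \<Longrightarrow> mpoly_eval \<kappa> b (Var i) = b i"
  by (simp add: Var_def mpoly_eval_single ring_mapD)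

lemma mpoly_eval_Const: "ring_map \<kappa> \<Longrightarrow> mpoly_eval \<kappa> b (Const c) = \<kappa> c"
  by (simp add: Const_def mpoly_eval_single ring_mapD)

lemma power_prod_Var: "power_prod Var I = single I (1 :: 'a::comm_ring_1)"
proof -
  have pow: "(Var i :: ('v, 'a) mpoly) ^ n = single (single i n) 1" for i :: 'v and n
    by (induction n) (auto simp: Var_def mult_single single_add[symmetric])
  have "(\<Prod>i\<in>A. Var i ^ lookup I i) = single (\<Sum>i\<in>A. single i (lookup I i)) (1 :: 'a)"
    if "finite A" for A
    using that by (induction A) (auto simp: pow mult_single)
  then have "power_prod Var I = single (\<Sum>i\<in>keys I. single i (lookup I i)) (1 :: 'a)"
    by (simp add: power_prod_def)
  also have "(\<Sum>i\<in>keys I. single i (lookup I i)) = I"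
  proof (rule poly_mapping_eqI)
    fix k
    show "lookup (\<Sum>i\<in>keys I. single i (lookup I i)) k = lookup I k"
      by (cases "k \<in> keys I") (auto simp: lookup_sum lookup_single when_def in_keys_iff)
  qed
  finally show ?thesis .
qed

lemma subst_Vars: "subst Var f = f"
proof -
  have "subst Var f = (\<Sum>I\<in>keys f. single I (lookup f I))"
    by (simp add: subst_eq_eval mpoly_eval_def power_prod_Var Const_def mult_single)
  then show ?thesis by (simp add: mpoly_sum_single)
qed

text \<open>
  Evaluating at the variables is the identity, so every ring homomorphism on polynomials is an evaluation,
  determined by its values on constants and variables.
\<close>

lemma ring_map_eq_eval:
  assumes "ring_map h"
  shows "h f = mpoly_eval (h \<circ> Const) (h \<circ> Var) f"
  using ring_map_eval[OF assms, of Const Var f] by (simp add: subst_Vars flip: subst_eq_eval)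

lemma ring_map_ext:
  assumes "ring_map h" "ring_map k" "\<And>c. h (Const c) = k (Const c)" "\<And>v. h (Var v) = k (Var v)"
  shows "h f = k f"
proof -
  have "h \<circ> Const = k \<circ> Const" "h \<circ> Var = k \<circ> Var" using assms by auto
  then show ?thesis using ring_map_eq_eval assms by metis
qed

section \<open>Homogeneous polynomials\<close>

lemma total_deg_superset:
  "finite S \<Longrightarrow> keys m \<subseteq> S \<Longrightarrow> total_deg m = (\<Sum>v\<in>S. lookup m v)"
  unfolding total_deg_def by (intro sum.mono_neutral_left) (auto simp: in_keys_iff)

lemma total_deg_add: "total_deg (m + n) = total_deg m + total_deg n"
proof -
  let ?S = "keys m \<union> keys n"
  have "total_deg (m + n) = (\<Sum>v\<in>?S. lookup (m + n) v)"
    using keys_add[of m n] by (intro total_deg_superset) auto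
  then show ?thesis
    by (simp add: lookup_add sum.distrib total_deg_superset[of ?S m] total_deg_superset[of ?S n])
qed

lemma total_deg_0 [simp]: "total_deg 0 = 0"
  by (simp add: total_deg_def)

lemma total_deg_single [simp]: "total_deg (single v n) = n"
  by (simp add: total_deg_def)

definition homogeneous :: "nat \<Rightarrow> ('v, 'a::comm_ring_1) mpoly \<Rightarrow> bool" where
  "homogeneous d f \<longleftrightarrow> (\<forall>m\<in>keys f. total_deg m = d)"

lemma homogeneous_0 [simp]: "homogeneous d 0"
  by (simp add: homogeneous_def)

lemma homogeneous_add: "homogeneous d f \<Longrightarrow> homogeneous d g \<Longrightarrow> homogeneous d (f + g)"
  using keys_add[of f g] by (auto simp: homogeneous_def)

lemma homogeneous_uminus: "homogeneous d f \<Longrightarrow> homogeneous d (- f)"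
  unfolding homogeneous_def by simp

lemma homogeneous_diff: "homogeneous d f \<Longrightarrow> homogeneous d g \<Longrightarrow> homogeneous d (f - g)"
  using homogeneous_add[of d f "- g"] homogeneous_uminus by force

lemma homogeneous_sum: "(\<And>i. i \<in> A \<Longrightarrow> homogeneous d (f i)) \<Longrightarrow> homogeneous d (sum f A)"
  by (induction A rule: infinite_finite_induct) (auto intro: homogeneous_add)

lemma homogeneous_mult:
  assumes "homogeneous d f" "homogeneous e g"
  shows "homogeneous (d + e) (f * g)"
  unfolding homogeneous_def
proof
  fix m assume "m \<in> keys (f * g)"
  then obtain a b where "m = a + b" "a \<in> keys f" "b \<in> keys g" using keys_mult[of f g] by blast
  then show "total_deg m = d + e" using assms by (auto simp: homogeneous_def total_deg_add)
qed

lemma homogeneous_single: "homogeneous (total_deg m) (single m c)"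
  by (simp add: homogeneous_def)

lemma homogeneous_Const: "homogeneous 0 (Const c)"
  using homogeneous_single[of 0 c] by (simp add: Const_def)

lemma homogeneous_1: "homogeneous 0 1"
  using homogeneous_Const[of 1] by (simp add: Const_1)

lemma homogeneous_Var: "homogeneous 1 (Var v)"
  using homogeneous_single[of "single v 1" 1] by (simp add: Var_def)

lemma homogeneous_power: "homogeneous d f \<Longrightarrow> homogeneous (d * n) (f ^ n)"
  by (induction n) (auto simp: homogeneous_1 intro: homogeneous_mult)

lemma homogeneous_mult_eq:
  "homogeneous d f \<Longrightarrow> homogeneous e g \<Longrightarrow> d + e = n \<Longrightarrow> homogeneous n (f * g)"
  using homogeneous_mult by blast

lemma homogeneous_Var_power: "homogeneous n (Var v ^ n)"
  using homogeneous_power[OF homogeneous_Var[of v], of n] by simp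

lemma homogeneous_prod:
  "(\<And>i. i \<in> A \<Longrightarrow> homogeneous (d i) (f i)) \<Longrightarrow> homogeneous (sum d A) (prod f A)"
  by (induction A rule: infinite_finite_induct) (auto simp: homogeneous_1 intro: homogeneous_mult)

lemma homogeneous_Const_mult: "homogeneous d f \<Longrightarrow> homogeneous d (Const c * f)"
  using homogeneous_mult[OF homogeneous_Const, of d f c] by simp

lemma homogeneous_power_prod:
  assumes "\<And>i. homogeneous (w i) (b i)"
  shows "homogeneous (\<Sum>i\<in>keys I. w i * lookup I i) (power_prod b I)"
  unfolding power_prod_def by (intro homogeneous_prod homogeneous_power assms)

definition hom_part :: "nat \<Rightarrow> ('v, 'a::comm_ring_1) mpoly \<Rightarrow> ('v, 'a) mpoly" where
  "hom_part d f = (\<Sum>m\<in>{m\<in>keys f. total_deg m = d}. single m (lookup f m))"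

lemma lookup_hom_part: "lookup (hom_part d f) m = (if total_deg m = d then lookup f m else 0)"
  by (auto simp: hom_part_def lookup_sum lookup_single when_def in_keys_iff)

lemma homogeneous_hom_part: "homogeneous d (hom_part d f)"
  by (auto simp: homogeneous_def in_keys_iff lookup_hom_part split: if_splits)

lemma hom_part_add: "hom_part d (f + g) = hom_part d f + hom_part d g"
  by (rule poly_mapping_eqI) (auto simp: lookup_hom_part lookup_add)

lemma hom_part_homogeneous: "homogeneous e f \<Longrightarrow> hom_part d f = (if d = e then f else 0)"
  by (rule poly_mapping_eqI) (auto simp: lookup_hom_part homogeneous_def in_keys_iff)

lemma sum_hom_parts: "(\<Sum>d\<in>total_deg ` keys f. hom_part d f) = f"
  by (rule poly_mapping_eqI) (auto simp: lookup_sum lookup_hom_part in_keys_iff)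

text \<open>
  Linear substitutions respect the grading, so the homogeneous components of an invariant of a linear
  action are invariant.
\<close>

lemma hom_part_subst:
  assumes "\<And>v. homogeneous 1 (b v)"
  shows "hom_part d (subst b f) = subst b (hom_part d f)"
proof (induction f rule: mpoly_induct)
  case zero
  show ?case by (simp add: hom_part_def subst_hom)
next
  case (single m c)
  have "homogeneous (total_deg m) (subst b (single m c))"
    unfolding subst_single total_deg_def
    using homogeneous_Const_mult[OF homogeneous_power_prod[of "\<lambda>_. 1" b m]] assms by simp
  then show ?case
    using homogeneous_single[of m c]
    by (simp add: hom_part_homogeneous subst_hom)
next
  case (add f g)
  then show ?case by (simp add: hom_part_add subst_hom)
qed

section \<open>Lead exponents for the graded reverse lexicographic order\<close>

lemma grevlex_irrefl: "\<not> grevlex_less m m"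
  by (auto simp: grevlex_less_def)

lemma grevlex_trans:
  assumes "grevlex_less k m" "grevlex_less m n"
  shows "grevlex_less k n"
proof (cases "total_deg k = total_deg m \<and> total_deg m = total_deg n")
  case True
  then obtain v w where v: "lookup k v > lookup m v" "\<forall>u<v. lookup k u = lookup m u"
    and w: "lookup m w > lookup n w" "\<forall>u<w. lookup m u = lookup n u"
    using assms by (auto simp: grevlex_less_def)
  have "lookup k (min v w) > lookup n (min v w)"
    using v w by (cases v w rule: linorder_cases) (auto simp: min_def)
  moreover have "\<forall>u<min v w. lookup k u = lookup n u" using v w by auto
  ultimately show ?thesis using True by (auto simp: grevlex_less_def)
next
  case False
  then show ?thesis using assms by (auto simp: grevlex_less_def)
qed

lemma grevlex_total:
  assumes "m \<noteq> n"
  shows "grevlex_less m n \<or> grevlex_less n m"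
proof -
  let ?D = "{v. lookup m v \<noteq> lookup n v}"
  have fin: "finite ?D"
    by (rule finite_subset[of _ "keys m \<union> keys n"]) (auto simp: in_keys_iff)
  have ne: "?D \<noteq> {}" using assms by (auto simp: poly_mapping_eq_iff fun_eq_iff)
  define v where "v = Min ?D"
  have "lookup m v \<noteq> lookup n v" using Min_in[OF fin ne] by (simp add: v_def)
  moreover have "\<forall>u<v. lookup m u = lookup n u"
    using Min_le[OF fin] by (fastforce simp: v_def)
  ultimately show ?thesis
    unfolding grevlex_less_def by (metis linorder_less_linear)
qed

lemma grevlex_add_right: "grevlex_less m n \<Longrightarrow> grevlex_less (m + k) (n + k)"
  by (auto simp: grevlex_less_def total_deg_add lookup_add)

lemma grevlex_add_left: "grevlex_less m n \<Longrightarrow> grevlex_less (k + m) (k + n)"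
  using grevlex_add_right[of m n k] by (simp add: add.commute)

lemma grevlex_total_deg: "grevlex_less m n \<Longrightarrow> total_deg m \<le> total_deg n"
  by (auto simp: grevlex_less_def)

lemma finite_grevlex_max:
  assumes "finite A" "A \<noteq> {}"
  obtains m where "m \<in> A" "\<And>n. n \<in> A \<Longrightarrow> n \<noteq> m \<Longrightarrow> grevlex_less n m"
proof -
  have "\<exists>m\<in>A. \<forall>n\<in>A. n \<noteq> m \<longrightarrow> grevlex_less n m"
    using assms
  proof (induction A rule: finite_ne_induct)
    case (insert a A)
    then obtain m where m: "m \<in> A" "\<forall>n\<in>A. n \<noteq> m \<longrightarrow> grevlex_less n m" by blast
    with insert have "a \<noteq> m" by auto
    then consider "grevlex_less a m" | "grevlex_less m a" using grevlex_total by blast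
    then show ?case
    proof cases
      case 1
      then show ?thesis using m by auto
    next
      case 2
      then show ?thesis using m grevlex_trans by (metis insert_iff)
    qed
  qed simp
  then show ?thesis using that by blast
qed

lemma lead_exp_eqI:
  assumes "m \<in> keys f" "\<And>n. n \<in> keys f \<Longrightarrow> n \<noteq> m \<Longrightarrow> grevlex_less n m"
  shows "lead_exp f = m"
  unfolding lead_exp_def
proof (rule the_equality)
  fix k assume "k \<in> keys f \<and> (\<forall>m'\<in>keys f. m' \<noteq> k \<longrightarrow> grevlex_less m' k)"
  then show "k = m" using assms grevlex_trans grevlex_irrefl by metis
qed (use assms in auto)

lemma
  assumes "f \<noteq> 0"
  shows lead_exp_in_keys: "lead_exp f \<in> keys f"
    and grevlex_less_lead_exp: "n \<in> keys f \<Longrightarrow> n \<noteq> lead_exp f \<Longrightarrow> grevlex_less n (lead_exp f)"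
proof -
  have "keys f \<noteq> {}" using assms by simp
  from finite_grevlex_max[OF finite_keys this] obtain m
    where "m \<in> keys f" "\<And>n. n \<in> keys f \<Longrightarrow> n \<noteq> m \<Longrightarrow> grevlex_less n m" by metis
  moreover from this have "lead_exp f = m" by (rule lead_exp_eqI)
  ultimately show "lead_exp f \<in> keys f"
    "n \<in> keys f \<Longrightarrow> n \<noteq> lead_exp f \<Longrightarrow> grevlex_less n (lead_exp f)" by auto
qed

lemma lead_coeff_neq_0: "f \<noteq> 0 \<Longrightarrow> lookup f (lead_exp f) \<noteq> 0"
  using lead_exp_in_keys[of f] by (simp add: in_keys_iff)

lemma lead_exp_single: "c \<noteq> 0 \<Longrightarrow> lead_exp (single m c) = m"
  by (rule lead_exp_eqI) auto

lemma mult_as_sum: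
  fixes f g :: "('v, 'a::comm_ring_1) mpoly"
  shows "f * g = (\<Sum>a\<in>keys f. \<Sum>b\<in>keys g. single (a + b) (lookup f a * lookup g b))"
proof -
  have "f * g = (\<Sum>a\<in>keys f. single a (lookup f a)) * (\<Sum>b\<in>keys g. single b (lookup g b))"
    by (simp add: mpoly_sum_single)
  then show ?thesis by (simp add: sum_product mult_single)
qed

text \<open>
  The order is compatible with addition, so of all pairs of exponents only the pair of the lead exponents
  contributes to the exponent \<open>lead_exp f + lead_exp g\<close>, and no cancellation occurs in a domain.
\<close>

lemma lead_exp_mult:
  fixes f g :: "('v::linorder, 'a::idom) mpoly"
  assumes "f \<noteq> 0" "g \<noteq> 0"
  shows "lead_exp (f * g) = lead_exp f + lead_exp g"
proof -
  let ?l = "lead_exp f" and ?k = "lead_exp g"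
  have less: "grevlex_less (a + b) (?l + ?k)"
    if "a \<in> keys f" "b \<in> keys g" "\<not> (a = ?l \<and> b = ?k)" for a b
    using that assms grevlex_less_lead_exp[of f a] grevlex_less_lead_exp[of g b]
    by (metis grevlex_add_left grevlex_add_right grevlex_trans)
  have neq: "a + b = ?l + ?k \<longleftrightarrow> a = ?l \<and> b = ?k" if "a \<in> keys f" "b \<in> keys g" for a b
    using less[OF that] grevlex_irrefl by metis
  have "lookup (f * g) (?l + ?k) =
      (\<Sum>a\<in>keys f. \<Sum>b\<in>keys g. if a = ?l \<and> b = ?k then lookup f a * lookup g b else 0)"
    by (auto simp: mult_as_sum[of f g] lookup_sum lookup_single when_def neq intro!: sum.cong)
  also have "\<dots> = (\<Sum>a\<in>keys f. if a = ?l then \<Sum>b\<in>keys g. if b = ?k then lookup f a * lookup g b else 0 else 0)"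
    by (intro sum.cong refl) auto
  also have "\<dots> = lookup f ?l * lookup g ?k"
    using assms by (simp add: lead_exp_in_keys)
  finally have *: "lookup (f * g) (?l + ?k) = lookup f ?l * lookup g ?k" .
  show "lead_exp (f * g) = ?l + ?k"
  proof (rule lead_exp_eqI)
    show "?l + ?k \<in> keys (f * g)" using * assms by (simp add: in_keys_iff lead_coeff_neq_0)
    fix n assume "n \<in> keys (f * g)" "n \<noteq> ?l + ?k"
    then show "grevlex_less n (?l + ?k)" using keys_mult[of f g] less by blast
  qed
qed

lemma lead_exp_1: "lead_exp (1 :: ('v::linorder, 'a::idom) mpoly) = 0"
  using lead_exp_single[of "1 :: 'a" 0] by simp

lemma lead_exp_prod:
  fixes f :: "'i \<Rightarrow> ('v::linorder, 'a::idom) mpoly"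
  assumes "\<And>i. i \<in> A \<Longrightarrow> f i \<noteq> 0"
  shows "lead_exp (prod f A) = (\<Sum>i\<in>A. lead_exp (f i))"
  using assms
  by (induction A rule: infinite_finite_induct) (auto simp: lead_exp_1 lead_exp_mult)

lemma lookup_lead_exp_power:
  fixes f :: "('v::linorder, 'a::idom) mpoly"
  assumes "f \<noteq> 0"
  shows "lookup (lead_exp (f ^ n)) v = n * lookup (lead_exp f) v"
  by (induction n) (auto simp: lead_exp_1 lead_exp_mult assms lookup_add)

lemma power_prod_nonzero:
  fixes b :: "'i \<Rightarrow> ('v::linorder, 'a::idom) mpoly"
  shows "(\<And>i. b i \<noteq> 0) \<Longrightarrow> power_prod b I \<noteq> 0"
  by (simp add: power_prod_def)

lemma lookup_lead_exp_power_prod: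
  fixes b :: "'i::finite \<Rightarrow> ('v::linorder, 'a::idom) mpoly"
  assumes "\<And>i. b i \<noteq> 0"
  shows "lookup (lead_exp (power_prod b I)) v = (\<Sum>i\<in>UNIV. lookup I i * lookup (lead_exp (b i)) v)"
  by (subst power_prod_superset[of UNIV])
    (simp_all add: lead_exp_prod assms lookup_sum lookup_lead_exp_power)

lemma lookup_Const_mult: "lookup (Const c * f) m = c * lookup f m"
  by (induction f rule: mpoly_induct)
    (auto simp: Const_def mult_single lookup_single when_def distrib_left lookup_add)

lemma Const_eq_0_iff [simp]: "Const c = 0 \<longleftrightarrow> c = 0"
  by (metis Const_def lookup_single_eq lookup_zero single_zero)

lemma lead_exp_Const_mult:
  fixes f :: "('v::linorder, 'a::idom) mpoly"
  shows "c \<noteq> 0 \<Longrightarrow> lead_exp (Const c * f) = lead_exp f"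
  using lead_exp_mult[of "Const c" f] lead_exp_single[of c 0]
  by (cases "f = 0") (auto simp flip: Const_def)

lemma LT_eqD:
  assumes "f \<noteq> 0" "g \<noteq> 0" "LT f = LT g"
  shows "lead_exp f = lead_exp g" "lookup f (lead_exp f) = lookup g (lead_exp g)"
proof -
  have "{lead_exp f} = {lead_exp g}"
    using arg_cong[OF assms(3), of keys] lead_coeff_neq_0[OF assms(1)] lead_coeff_neq_0[OF assms(2)]
    by (simp add: LT_def)
  then show eq: "lead_exp f = lead_exp g" by simp
  show "lookup f (lead_exp f) = lookup g (lead_exp g)"
    using arg_cong[OF assms(3), of "\<lambda>h. lookup h (lead_exp f)"] eq by (simp add: LT_def)
qed

lemma lead_exp_cancel:
  assumes "f \<noteq> 0" "g \<noteq> 0" "LT f = LT g" "f - g \<noteq> 0"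
  shows "grevlex_less (lead_exp (f - g)) (lead_exp f)"
proof -
  note eq = LT_eqD[OF assms(1-3)]
  let ?m = "lead_exp (f - g)"
  have m: "?m \<in> keys (f - g)" by (rule lead_exp_in_keys[OF assms(4)])
  then have "?m \<noteq> lead_exp f" using eq by (auto simp: in_keys_iff lookup_minus)
  moreover from m have "?m \<in> keys f \<or> ?m \<in> keys g" by (auto simp: in_keys_iff lookup_minus)
  ultimately show ?thesis using grevlex_less_lead_exp assms(1,2) eq(1) by metis
qed

section \<open>Polynomials in elements whose lead monomials are independent\<close>

text \<open>
  If the products with exponents in \<open>S\<close> have different lead monomials, the largest of those that occur
  survives in every combination.  The independence, the SAGBI property and the existence of subductions
  all rest on this.
\<close>

lemma lead_subst_standard:
  fixes b :: "'i \<Rightarrow> ('v::linorder, 'a::idom) mpoly"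
  assumes b: "\<And>i. b i \<noteq> 0" and inj: "inj_on (\<lambda>K. lead_exp (power_prod b K)) S"
    and q: "keys q \<subseteq> S" "q \<noteq> 0"
  obtains K where "K \<in> keys q" "subst b q \<noteq> 0" "lead_exp (subst b q) = lead_exp (power_prod b K)"
    "LT (subst b q) = LT (Const (lookup q K) * power_prod b K)"
proof -
  let ?l = "\<lambda>K. lead_exp (power_prod b K)"
  have "?l ` keys q \<noteq> {}" using q by simp
  from finite_grevlex_max[OF finite_imageI[OF finite_keys] this] obtain m
    where m: "m \<in> ?l ` keys q" "\<And>n. n \<in> ?l ` keys q \<Longrightarrow> n \<noteq> m \<Longrightarrow> grevlex_less n m" by metis
  then obtain K where K: "K \<in> keys q" "m = ?l K" by auto
  have less: "grevlex_less (?l I) m" if "I \<in> keys q" "I \<noteq> K" for I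
    using that m(2) K inj q(1) by (metis imageI inj_on_contraD subsetD)
  have zero: "lookup (power_prod b I) m = 0" if "I \<in> keys q" "I \<noteq> K" for I
  proof (rule ccontr)
    assume "lookup (power_prod b I) m \<noteq> 0"
    then have "m = ?l I \<or> grevlex_less m (?l I)"
      using grevlex_less_lead_exp[OF power_prod_nonzero[of b, OF b], of m I] by (auto simp: in_keys_iff)
    then show False using less[OF that] grevlex_trans grevlex_irrefl by metis
  qed
  have "lookup (subst b q) m = (\<Sum>I\<in>keys q. lookup q I * lookup (power_prod b I) m)"
    by (simp add: subst_eq_eval mpoly_eval_def lookup_sum lookup_Const_mult)
  also have "\<dots> = (\<Sum>I\<in>{K}. lookup q I * lookup (power_prod b I) m)"
    using K zero by (intro sum.mono_neutral_right) auto
  finally have lk: "lookup (subst b q) m = lookup q K * lookup (power_prod b K) m" by simp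
  have nz: "lookup (subst b q) m \<noteq> 0"
    using lk K lead_coeff_neq_0[OF power_prod_nonzero[of b, OF b], of K] by (auto simp: in_keys_iff)
  have lead: "lead_exp (subst b q) = m"
  proof (rule lead_exp_eqI)
    show "m \<in> keys (subst b q)" using nz by (simp add: in_keys_iff)
    fix n assume n: "n \<in> keys (subst b q)" "n \<noteq> m"
    then have "(\<Sum>I\<in>keys q. lookup q I * lookup (power_prod b I) n) \<noteq> 0"
      by (simp add: subst_eq_eval mpoly_eval_def lookup_sum lookup_Const_mult in_keys_iff)
    then obtain I where I: "I \<in> keys q" "n \<in> keys (power_prod b I)"
      by (metis (no_types, lifting) in_keys_iff mult_zero_right sum.neutral)
    then have "n = ?l I \<or> grevlex_less n (?l I)"
      using grevlex_less_lead_exp[OF power_prod_nonzero[of b, OF b], of n I] by auto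
    then show "grevlex_less n m"
      using less[of I] I n K grevlex_trans by metis
  qed
  have "lookup q K \<noteq> 0" using K by (simp add: in_keys_iff)
  then have "LT (subst b q) = LT (Const (lookup q K) * power_prod b K)"
    using lk K by (simp add: LT_def lead lead_exp_Const_mult lookup_Const_mult)
  moreover have "subst b q \<noteq> 0" using nz by auto
  ultimately show ?thesis using that K lead by metis
qed

lemma subst_standard_eq_0:
  fixes b :: "'i \<Rightarrow> ('v::linorder, 'a::idom) mpoly"
  assumes "\<And>i. b i \<noteq> 0" "inj_on (\<lambda>K. lead_exp (power_prod b K)) S" "keys q \<subseteq> S" "subst b q = 0"
  shows "q = 0"
  using lead_subst_standard[of b, OF assms(1-3)] assms(4) by metis

text \<open>
  Cancelling the lead term removes exactly the term of \<open>q\<close> that produces it, so the number of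
  terms of \<open>q\<close> decreases.
\<close>

lemma subduction_standard:
  fixes b :: "'i \<Rightarrow> ('v::linorder, 'a::idom) mpoly"
  assumes b: "\<And>i. b i \<noteq> 0" and inj: "inj_on (\<lambda>K. lead_exp (power_prod b K)) S"
  shows "keys q \<subseteq> S \<Longrightarrow> subduction b (subst b q) q"
proof (induction "card (keys q)" arbitrary: q rule: less_induct)
  case less
  show ?case
  proof (cases "q = 0")
    case True
    then show ?thesis using subduction_zero[of b] by (simp add: subst_hom)
  next
    case False
    from lead_subst_standard[of b, OF b inj less(2) False] obtain K where K: "K \<in> keys q"
      "subst b q \<noteq> 0" "LT (subst b q) = LT (Const (lookup q K) * power_prod b K)" by metis
    define r where "r = q - single K (lookup q K)"
    have keys: "keys r = keys q - {K}"
      using K(1) by (auto simp: r_def in_keys_iff lookup_minus lookup_single when_def split: if_splits)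
    have "subduction b (subst b r) r"
      using less(2) K(1) keys card_gt_0_iff[of "keys q"] by (intro less(1)) auto
    moreover have "subst b r = subst b q - Const (lookup q K) * monom_prod b K"
      by (simp add: r_def subst_hom subst_single monom_prod_eq)
    moreover have "Const (lookup q K) * power_prod b K \<noteq> 0"
      using K(1) power_prod_nonzero[of b, OF b] by (auto simp: in_keys_iff)
    ultimately have "subduction b (subst b q) (r + single K (lookup q K))"
      using K by (intro subduction_step) (auto simp: monom_prod_eq)
    then show ?thesis by (simp add: r_def)
  qed
qed

lemma subduction_subst: "subduction b f R \<Longrightarrow> subst b R = f"
  by (induction rule: subduction.induct)
    (simp_all add: subst_hom subst_single monom_prod_eq)

text \<open>
  Lead exponents decrease along a subduction.  Whatever choices were made, this bounds the products that
  can occur in the resulting relation.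
\<close>

lemma subduction_keys:
  fixes b :: "'i \<Rightarrow> ('v::linorder, 'a::idom) mpoly"
  assumes b: "\<And>i. b i \<noteq> 0"
  shows "subduction b f R \<Longrightarrow> K \<in> keys R \<Longrightarrow>
    f \<noteq> 0 \<and> (lead_exp (power_prod b K) = lead_exp f \<or> grevlex_less (lead_exp (power_prod b K)) (lead_exp f))"
proof (induction arbitrary: K rule: subduction.induct)
  case (subduction_step f c I R)
  let ?g = "Const c * monom_prod b I"
  have c: "c \<noteq> 0" using subduction_step by auto
  have l: "lead_exp f = lead_exp (power_prod b I)"
    using LT_eqD(1)[of f ?g] subduction_step c by (simp add: lead_exp_Const_mult monom_prod_eq)
  from subduction_step.prems have "K \<in> keys R \<or> K = I"
    using keys_add[of R "single I c"] by (auto split: if_splits)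
  then show ?case
  proof
    assume "K \<in> keys R"
    from subduction_step.IH[OF this] lead_exp_cancel[of f ?g] subduction_step.hyps
    show ?thesis using grevlex_trans by metis
  qed (use l subduction_step.hyps in auto)
qed simp

text \<open>
  Division with remainder by a polynomial that is monic in one variable \<open>j\<close>: the power \<open>n\<close> of this
  variable is replaced by terms of lower degree in it.
\<close>

lemma division_monic_variable:
  fixes s :: "('i, 'a::comm_ring_1) mpoly"
  assumes r: "r = single (single j n) 1 - s" and s: "\<And>K. K \<in> keys s \<Longrightarrow> lookup K j < n"
  shows "\<exists>h t. q = r * h + t \<and> (\<forall>K\<in>keys t. lookup K j < n)"
proof (induction q rule: mpoly_induct)
  case zero
  show ?case by (rule exI[of _ 0], rule exI[of _ 0]) auto
next
  case (add f g)
  then obtain h t h' t' where "f = r * h + t" "\<forall>K\<in>keys t. lookup K j < n"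
    "g = r * h' + t'" "\<forall>K\<in>keys t'. lookup K j < n" by blast
  then have "f + g = r * (h + h') + (t + t')" "\<forall>K\<in>keys (t + t'). lookup K j < n"
    using keys_add[of t t'] by (auto simp: algebra_simps)
  then show ?case by blast
next
  case (single K c)
  define P where "P q \<longleftrightarrow> (\<exists>h t. q = r * h + t \<and> (\<forall>K\<in>keys t. lookup K j < n))" for q
  have P0: "P 0" unfolding P_def by (rule exI[of _ 0], rule exI[of _ 0]) auto
  have Padd: "P (f + g)" if "P f" "P g" for f g
  proof -
    from that obtain h t h' t' where "f = r * h + t" "\<forall>K\<in>keys t. lookup K j < n"
      "g = r * h' + t'" "\<forall>K\<in>keys t'. lookup K j < n" by (auto simp: P_def)
    then have "f + g = r * (h + h') + (t + t')" "\<forall>K\<in>keys (t + t'). lookup K j < n"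
      using keys_add[of t t'] by (auto simp: algebra_simps)
    then show ?thesis by (auto simp: P_def)
  qed
  have Psum: "P (sum f A)" if "\<And>i. i \<in> A \<Longrightarrow> P (f i)" for f and A :: "'i monomial set"
    using that by (induction A rule: infinite_finite_induct) (auto intro: Padd P0)
  have Pr: "P (r * h)" for h unfolding P_def by (rule exI[of _ h], rule exI[of _ 0]) auto
  have "P (single K c)"
  proof (induction "lookup K j" arbitrary: K c rule: less_induct)
    case less
    show ?case
    proof (cases "lookup K j < n")
      case True
      then have "single K c = r * 0 + single K c" "\<forall>I\<in>keys (single K c). lookup I j < n" by auto
      then show ?thesis unfolding P_def by blast
    next
      case False
      define L where "L = K - single j n"
      have K: "K = single j n + L"
        using False by (intro poly_mapping_eqI) (auto simp: L_def lookup_add lookup_minus lookup_single when_def)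
      have "single K c = r * single L c + s * single L c"
        by (simp add: r algebra_simps mult_single K)
      also have "s * single L c = (\<Sum>I\<in>keys s. single (I + L) (lookup s I * c))"
      proof -
        have "s * single L c = (\<Sum>I\<in>keys s. single I (lookup s I)) * single L c"
          by (simp only: mpoly_sum_single)
        then show ?thesis by (simp add: sum_distrib_right mult_single)
      qed
      finally show ?thesis
        using s False by (auto intro!: Padd Pr Psum less simp: lookup_add K)
    qed
  qed
  then show ?case by (simp add: P_def)
qed

text \<open>
  The remainder of a relation is a relation between products with different lead monomials, hence zero.
\<close>

lemma relations_principal:
  fixes b :: "'i \<Rightarrow> ('v::linorder, 'a::idom) mpoly"
  assumes b: "\<And>i. b i \<noteq> 0" and inj: "inj_on (\<lambda>K. lead_exp (power_prod b K)) {K. lookup K j < n}"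
    and r: "r = single (single j n) 1 - s" and s: "\<And>K. K \<in> keys s \<Longrightarrow> lookup K j < n"
    and rel: "subst b r = 0"
  shows "{q. subst b q = 0} = {r * h | h. True}"
proof (intro Set.set_eqI iffI)
  fix q assume "q \<in> {q. subst b q = 0}"
  moreover obtain h t where q: "q = r * h + t" "\<forall>K\<in>keys t. lookup K j < n"
    using division_monic_variable[OF r s] by blast
  ultimately have "subst b t = 0" by (simp add: subst_hom rel)
  then have "t = 0" using subst_standard_eq_0[of b, OF b inj] q by auto
  then show "q \<in> {r * h | h. True}" using q by auto
next
  fix q assume "q \<in> {r * h | h. True}"
  then show "q \<in> {q. subst b q = 0}" by (auto simp: subst_hom rel)
qed

lemma subalgebra_power_prod:
  assumes "subalgebra A" "\<And>i. b i \<in> A"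
  shows "power_prod b I \<in> A"
proof -
  have one: "1 \<in> A" using assms(1) Const_1 unfolding subalgebra_def by (metis range_subsetD)
  have pow: "b i ^ n \<in> A" for i n
    using assms one by (induction n) (auto simp: subalgebra_def)
  have "(\<Prod>i\<in>S. b i ^ lookup I i) \<in> A" for S
    using assms pow one by (induction S rule: infinite_finite_induct) (auto simp: subalgebra_def)
  then show ?thesis by (simp add: power_prod_def)
qed

lemma subalgebra_sum:
  assumes "subalgebra A" "\<And>i. i \<in> S \<Longrightarrow> f i \<in> A"
  shows "sum f S \<in> A"
proof -
  have "0 \<in> A" using assms(1) unfolding subalgebra_def
    by (metis Const_eq_0_iff range_subsetD)
  then show ?thesis
    using assms by (induction S rule: infinite_finite_induct) (auto simp: subalgebra_def)
qed

lemma subalgebra_subst: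
  assumes "subalgebra A" "\<And>i. b i \<in> A"
  shows "subst b q \<in> A"
  unfolding subst_eq_eval mpoly_eval_def
  using assms(1) subalgebra_power_prod[of A b, OF assms]
  by (intro subalgebra_sum) (auto simp: subalgebra_def)

text \<open>
  The span of the lead monomials of \<open>A\<close> is an algebra because lead monomials multiply.  Conversely, the
  lead monomial of an element of \<open>A\<close> is that of one of its products.
\<close>

lemma sagbi_basis_standard:
  fixes b :: "'i::finite \<Rightarrow> ('v::linorder, 'a::idom) mpoly"
  assumes A: "subalgebra A" "\<And>i. b i \<in> A" and b: "\<And>i. b i \<noteq> 0"
    and inj: "inj_on (\<lambda>K. lead_exp (power_prod b K)) S"
    and gen: "\<And>f. f \<in> A \<Longrightarrow> \<exists>q. keys q \<subseteq> S \<and> subst b q = f"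
  shows "sagbi_basis (range b) A"
proof -
  interpret module "\<lambda>c (f :: ('v, 'a) mpoly). Const c * f" by (rule module_Const)
  let ?LA = "LM ` (A - {0})"
  have LM_mult: "LM (f * g) = LM f * LM g" if "f \<noteq> 0" "g \<noteq> 0" for f g :: "('v, 'a) mpoly"
    using that by (simp add: LM_def lead_exp_mult mult_single)
  have one: "1 \<in> A" using A(1) Const_1 unfolding subalgebra_def by (metis range_subsetD)
  have LM1: "LM (1 :: ('v, 'a) mpoly) = 1" by (simp add: LM_def lead_exp_1)
  have mul1: "f * g \<in> span ?LA" if f: "f \<in> span ?LA" and g: "g \<in> ?LA" for f g
    using f
  proof (induction rule: span_induct_alt)
    case (step c h k)
    obtain u v where uv: "h = LM u" "g = LM v" "u \<in> A" "v \<in> A" "u \<noteq> 0" "v \<noteq> 0"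
      using step(1) g by auto
    then have "h * g = LM (u * v)" "u * v \<in> A - {0}" using A(1) by (auto simp: LM_mult subalgebra_def)
    then have "h * g \<in> ?LA" by auto
    from span_add[OF span_scale[OF span_base[OF this], of c] step(2)] show ?case
      by (simp add: distrib_right mult.assoc)
  qed (simp add: span_zero)
  have mul: "f * g \<in> span ?LA" if f: "f \<in> span ?LA" and g: "g \<in> span ?LA" for f g
    using g
  proof (induction rule: span_induct_alt)
    case (step c h k)
    from span_add[OF span_scale[OF mul1[OF f step(1)], of c] step(2)] show ?case
      by (simp add: distrib_left mult.left_commute[of f])
  qed (simp add: span_zero)
  have "1 \<in> ?LA" using one LM1 by (intro image_eqI[of _ _ 1]) auto
  then have "Const c \<in> span ?LA" for c
    using span_scale[OF span_base, of 1 ?LA c] by simp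
  then have "subalgebra (span ?LA)"
    using mul by (auto simp: subalgebra_def intro: span_add)
  moreover have "LM ` range b \<subseteq> span ?LA"
    using A(2) b by (auto intro!: span_base)
  ultimately have 1: "subalgebra hull (LM ` range b) \<subseteq> span ?LA"
    by (intro hull_minimal)
  have sub: "subalgebra (subalgebra hull (LM ` range b))"
    unfolding hull_def by (auto simp: subalgebra_def)
  have LMpp: "LM (power_prod b K) = power_prod (LM \<circ> b) K" for K
  proof -
    have LMpow: "LM (b i ^ n) = LM (b i) ^ n" for i n
      by (induction n) (simp_all add: LM1 LM_mult b)
    have "LM (\<Prod>i\<in>T. b i ^ lookup K i) = (\<Prod>i\<in>T. LM (b i) ^ lookup K i)" for T
      by (induction T rule: infinite_finite_induct) (simp_all add: LM1 LM_mult LMpow b)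
    then show ?thesis by (simp add: power_prod_def)
  qed
  have "LM f \<in> subalgebra hull (LM ` range b)" if "f \<in> A" "f \<noteq> 0" for f
  proof -
    obtain q where q: "keys q \<subseteq> S" "subst b q = f" using gen \<open>f \<in> A\<close> by blast
    then have "q \<noteq> 0" using \<open>f \<noteq> 0\<close> by (auto simp: subst_hom)
    from lead_subst_standard[of b, OF b inj q(1) this] q(2) obtain K
      where "lead_exp f = lead_exp (power_prod b K)" by metis
    then have "LM f = power_prod (LM \<circ> b) K" by (simp add: LM_def flip: LMpp)
    moreover have "power_prod (LM \<circ> b) K \<in> subalgebra hull (LM ` range b)"
      by (rule subalgebra_power_prod[OF sub]) (auto intro: hull_inc)
    ultimately show ?thesis by simp
  qed
  moreover have "subspace (subalgebra hull (LM ` range b))"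
    unfolding subspace_def
  proof (intro conjI ballI allI)
    have C: "Const c \<in> subalgebra hull (LM ` range b)" for c
      using sub by (auto simp: subalgebra_def)
    show "0 \<in> subalgebra hull (LM ` range b)" using C[of 0] by (simp add: Const_def)
    show "f + g \<in> subalgebra hull (LM ` range b)" "Const c * f \<in> subalgebra hull (LM ` range b)"
      if "f \<in> subalgebra hull (LM ` range b)" "g \<in> subalgebra hull (LM ` range b)" for f g c
      using sub that C[of c] by (auto simp: subalgebra_def)
  qed
  ultimately have 2: "span ?LA \<subseteq> subalgebra hull (LM ` range b)"
    by (intro span_minimal) auto
  show ?thesis
    unfolding sagbi_basis_def using A b 1 2 by auto
qed

section \<open>Polynomials invariant under a finite group of translations\<close>

lemma prod_linear_factors_dvd:
  fixes g :: "'b::idom poly"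
  assumes "finite V" "\<And>v. v \<in> V \<Longrightarrow> poly g v = 0"
  shows "(\<Prod>v\<in>V. [:- v, 1:]) dvd g"
  using assms
proof (induction V rule: finite_induct)
  case (insert a V)
  then obtain q where q: "g = (\<Prod>v\<in>V. [:- v, 1:]) * q" by (auto simp: dvd_def)
  have "poly g a = 0" using insert by auto
  then have "(\<Prod>v\<in>V. a - v) * poly q a = 0" by (simp add: q poly_prod)
  then have "poly q a = 0" using insert by auto
  then have "[:- a, 1:] dvd q" by (simp add: poly_eq_0_iff_dvd)
  then have "(\<Prod>v\<in>V. [:- v, 1:]) * [:- a, 1:] dvd g" unfolding q by (rule mult_dvd_mono[OF dvd_refl])
  then show ?case unfolding prod.insert[OF insert.hyps(1,2)] by (subst mult.commute)
qed simp

lemma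
  fixes V :: "'b::idom set"
  shows degree_prod_linear_factors: "degree (\<Prod>v\<in>V. [:- v, 1:]) = card V"
    and lead_coeff_prod_linear_factors: "lead_coeff (\<Prod>v\<in>V. [:- v, 1:]) = 1"
proof -
  show "degree (\<Prod>v\<in>V. [:- v, 1:]) = card V" by (simp add: degree_prod_sum_eq)
  show "lead_coeff (\<Prod>v\<in>V. [:- v, 1:]) = 1" by (subst lead_coeff_prod) simp
qed

lemma monic_eq_prod_linear_factors:
  fixes g :: "'b::idom poly"
  assumes "finite V" "\<And>v. v \<in> V \<Longrightarrow> poly g v = 0" "degree g = card V" "lead_coeff g = 1"
  shows "g = (\<Prod>v\<in>V. [:- v, 1:])"
proof -
  obtain q where q: "g = (\<Prod>v\<in>V. [:- v, 1:]) * q"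
    using prod_linear_factors_dvd[OF assms(1,2)] by (auto simp: dvd_def)
  have "q \<noteq> 0" using assms q by auto
  moreover have "(\<Prod>v\<in>V. [:- v, 1:]) \<noteq> (0 :: 'b poly)"
    using lead_coeff_prod_linear_factors[of V] by force
  ultimately have "degree q = 0"
    using assms(3) degree_mult_eq[of "\<Prod>v\<in>V. [:- v, 1:]" q] q degree_prod_linear_factors[of V] by simp
  moreover have "lead_coeff q = 1"
    using assms(4) lead_coeff_mult[of "\<Prod>v\<in>V. [:- v, 1:]" q] q lead_coeff_prod_linear_factors[of V] by simp
  ultimately have "q = 1" by (metis degree_eq_zeroE lead_coeff_pCons(2) one_pCons coeff_pCons_0 degree_pCons_0)
  then show ?thesis using q by simp
qed

lemma translation_bij:
  fixes V :: "'b::ab_group_add set"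
  assumes "finite V" "\<And>u v. u \<in> V \<Longrightarrow> v \<in> V \<Longrightarrow> u - v \<in> V" "w \<in> V"
  shows "bij_betw (\<lambda>v. v - w) V V"
proof (rule bij_betw_imageI)
  show inj: "inj_on (\<lambda>v. v - w) V" by (auto intro: inj_onI)
  show "(\<lambda>v. v - w) ` V = V" using assms by (intro endo_inj_surj inj) auto
qed

text \<open>
  \<open>g - g(0)\<close> vanishes on \<open>V\<close>, hence is divisible by the product of the linear factors.  That
  product is itself invariant, so the quotient is an invariant of smaller degree.
\<close>

lemma translation_invariant_poly:
  fixes V :: "'b::idom set"
  assumes V: "finite V" "0 \<in> V" "\<And>u v. u \<in> V \<Longrightarrow> v \<in> V \<Longrightarrow> u - v \<in> V"
    and g: "\<And>v. v \<in> V \<Longrightarrow> pcompose g [:v, 1:] = g"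
  shows "\<exists>q. g = pcompose q (\<Prod>v\<in>V. [:- v, 1:])"
  using g
proof (induction "degree g" arbitrary: g rule: less_induct)
  case less
  let ?\<Phi> = "\<Prod>v\<in>V. [:- v, 1:]"
  let ?c = "poly g 0"
  have \<Phi>: "pcompose ?\<Phi> [:w, 1:] = ?\<Phi>" if "w \<in> V" for w
  proof -
    have "pcompose ?\<Phi> [:w, 1:] = (\<Prod>v\<in>V. [:- (v - w), 1:])"
      by (simp add: pcompose_prod pcompose_pCons)
    also have "\<dots> = ?\<Phi>"
      by (rule prod.reindex_bij_betw[OF translation_bij[OF V(1,3) that]])
    finally show ?thesis .
  qed
  have \<Phi>0: "?\<Phi> \<noteq> 0" using lead_coeff_prod_linear_factors[of V] by force
  have root: "poly (g - [:?c:]) v = 0" if "v \<in> V" for v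
    using arg_cong[OF less(2)[OF that], of "\<lambda>h. poly h 0"] by (simp add: poly_pcompose)
  obtain h where h: "g - [:?c:] = ?\<Phi> * h"
    using prod_linear_factors_dvd[OF V(1) root] by (auto simp: dvd_def)
  show ?case
  proof (cases "h = 0")
    case True
    then have "g = pcompose [:?c:] ?\<Phi>" using h by (simp only: pcompose_const) simp
    then show ?thesis by blast
  next
    case False
    have "degree (g - [:?c:]) = card V + degree h"
      unfolding h using False \<Phi>0 by (simp add: degree_mult_eq degree_prod_linear_factors)
    moreover have "degree (g - [:?c:]) \<le> degree g" by (rule degree_diff_le) auto
    moreover have "card V > 0" using V(1,2) by (auto simp: card_gt_0_iff)
    ultimately have "degree h < degree g" by simp
    moreover have "pcompose h [:v, 1:] = h" if "v \<in> V" for v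
    proof -
      have "?\<Phi> * pcompose h [:v, 1:] = pcompose (?\<Phi> * h) [:v, 1:]"
        by (simp add: pcompose_mult \<Phi>[OF that])
      also have "\<dots> = ?\<Phi> * h" by (simp add: less(2)[OF that] pcompose_diff flip: h)
      finally show ?thesis using \<Phi>0 by simp
    qed
    ultimately obtain q where "h = pcompose q ?\<Phi>" using less(1) by blast
    then have "g = pcompose (pCons ?c q) ?\<Phi>" using h by (simp add: pcompose_pCons algebra_simps)
    then show ?thesis by blast
  qed
qed

lemma card_dvd_degree_translation_invariant:
  fixes V :: "'b::idom set"
  assumes "finite V" "0 \<in> V" "\<And>u v. u \<in> V \<Longrightarrow> v \<in> V \<Longrightarrow> u - v \<in> V"
    and "\<And>v. v \<in> V \<Longrightarrow> pcompose g [:v, 1:] = g"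
  shows "card V dvd degree g"
  using translation_invariant_poly[OF assms] by (auto simp: degree_pcompose degree_prod_linear_factors)

section \<open>The prime field\<close>

definition prime_field :: "'a::field set" where "prime_field = range of_int"

lemma prime_field_closed:
  "0 \<in> prime_field" "1 \<in> prime_field"
  "a \<in> prime_field \<Longrightarrow> b \<in> prime_field \<Longrightarrow> a + b \<in> prime_field"
  "a \<in> prime_field \<Longrightarrow> b \<in> prime_field \<Longrightarrow> a - b \<in> prime_field"
  "a \<in> prime_field \<Longrightarrow> - a \<in> prime_field"
  "a \<in> prime_field \<Longrightarrow> b \<in> prime_field \<Longrightarrow> a * b \<in> prime_field"
  unfolding prime_field_def
  by (auto simp flip: of_int_add of_int_diff of_int_mult of_int_minus intro: range_eqI[of _ _ 0] range_eqI[of _ _ 1])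

lemma prime_field_eq:
  assumes "CHAR('a::field) > 0"
  shows "(prime_field :: 'a set) = of_nat ` {..<CHAR('a)}"
proof
  show "of_nat ` {..<CHAR('a)} \<subseteq> (prime_field :: 'a set)"
    unfolding prime_field_def by (metis image_subsetI of_int_of_nat_eq rangeI)
  show "(prime_field :: 'a set) \<subseteq> of_nat ` {..<CHAR('a)}"
  proof
    fix a :: 'a assume "a \<in> prime_field"
    then obtain k where k: "a = of_int k" by (auto simp: prime_field_def)
    let ?r = "k mod int CHAR('a)"
    have "k = int CHAR('a) * (k div int CHAR('a)) + ?r" by simp
    then have "a = of_int (int CHAR('a) * (k div int CHAR('a)) + ?r)" using k by simp
    also have "\<dots> = of_int ?r" by (simp only: of_int_add of_int_mult of_int_of_nat_eq of_nat_CHAR) simp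
    also have "\<dots> = of_nat (nat ?r)" using assms by (simp add: of_nat_nat)
    finally have "a = of_nat (nat ?r)" .
    moreover have "nat ?r < CHAR('a)" using assms by (simp add: nat_less_iff)
    ultimately show "a \<in> of_nat ` {..<CHAR('a)}" by blast
  qed
qed

lemma inj_on_of_nat_CHAR: "inj_on (of_nat :: nat \<Rightarrow> 'a::field) {..<CHAR('a)}"
proof (rule linorder_inj_onI)
  fix i j assume "i < j" "j \<in> {..<CHAR('a)}"
  then have "\<not> CHAR('a) dvd (j - i)" by (auto dest: dvd_imp_le)
  then show "(of_nat i :: 'a) \<noteq> of_nat j" using of_nat_eq_iff_char_dvd[OF \<open>i < j\<close>, where ?'a = 'a] by blast
qed auto

lemma finite_prime_field: "CHAR('a::field) > 0 \<Longrightarrow> finite (prime_field :: 'a set)"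
  by (simp add: prime_field_eq)

lemma card_prime_field: "CHAR('a::field) > 0 \<Longrightarrow> card (prime_field :: 'a set) = CHAR('a)"
  by (simp add: prime_field_eq card_image inj_on_of_nat_CHAR)

lemma prime_field_power_CHAR:
  assumes "prime CHAR('a::field)" "(a :: 'a) \<in> prime_field"
  shows "a ^ (CHAR('a) ^ k) = a"
proof -
  have pos: "CHAR('a) > 0" using assms(1) prime_gt_0_nat by blast
  have "(of_nat n :: 'a) ^ CHAR('a) = of_nat n" for n
    by (induction n) (use assms(1) pos in \<open>auto simp: freshmans_dream power_0_left\<close>)
  moreover obtain n where "a = of_nat n" using assms(2) prime_field_eq[OF pos] by blast
  ultimately have *: "a ^ CHAR('a) = a" by simp
  show ?thesis by (induction k) (simp_all add: power_mult *)
qed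

abbreviation prime_vectors :: "('a::field ^ 'n) set" where
  "prime_vectors \<equiv> {c. \<forall>j. c $ j \<in> prime_field}"

lemma
  assumes "CHAR('a::field) > 0"
  shows card_prime_vectors: "card (prime_vectors :: ('a ^ 'n::finite) set) = CHAR('a) ^ CARD('n)"
    and finite_prime_vectors: "finite (prime_vectors :: ('a ^ 'n::finite) set)"
proof -
  have bij: "bij_betw vec_nth (prime_vectors :: ('a ^ 'n) set) (UNIV \<rightarrow>\<^sub>E prime_field)"
    by (rule bij_betwI[of _ _ _ vec_lambda]) auto
  from bij_betw_same_card[OF this]
  show "card (prime_vectors :: ('a ^ 'n) set) = CHAR('a) ^ CARD('n)"
    using assms by (simp add: card_PiE card_prime_field)
  show "finite (prime_vectors :: ('a ^ 'n) set)"
    using bij_betw_finite[OF bij] finite_prime_field[OF assms] by (simp add: finite_PiE)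
qed

lemma CHAR_mpoly: "CHAR(('v, 'a::comm_ring_1) mpoly) = CHAR('a)"
proof -
  have "of_nat n = (0 :: ('v, 'a) mpoly) \<longleftrightarrow> of_nat n = (0 :: 'a)" for n
  proof -
    have "(of_nat n :: ('v, 'a) mpoly) = Const (of_nat n)"
      by (simp add: ring_map_of_nat[OF ring_map_Const])
    then show ?thesis by simp
  qed
  then show ?thesis
    by (intro CHAR_eqI) (auto simp: of_nat_eq_0_iff_char_dvd)
qed

text \<open>
  The elements \<open>- h a * s\<close> are \<open>p\<close> different roots of the monic polynomial \<open>T^p - s^(p-1) T\<close>, since
  \<open>a^p = a\<close> in the prime field.
\<close>

lemma prod_prime_field:
  fixes h :: "'a::field \<Rightarrow> 'b::idom"
  assumes p: "prime CHAR('a)" and h: "ring_map h" and s: "s \<noteq> 0"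
  shows "(\<Prod>a\<in>prime_field. t + h a * s) = t ^ CHAR('a) - t * s ^ (CHAR('a) - 1)"
proof -
  let ?p = "CHAR('a)"
  let ?V = "(\<lambda>a. - (h a * s)) ` prime_field"
  let ?g = "monom 1 ?p - monom (s ^ (?p - 1)) 1 :: 'b poly"
  have p1: "?p > 1" and p0: "?p > 0" using p prime_gt_1_nat prime_gt_0_nat by blast+
  have hnz: "h a \<noteq> 0" if "a \<noteq> 0" for a
    using ring_mapD(3)[OF h, of a "inverse a"] ring_mapD(1)[OF h] that by auto
  have inj: "inj_on (\<lambda>a. - (h a * s)) prime_field"
  proof (rule inj_onI)
    fix a b :: 'a assume "- (h a * s) = - (h b * s)"
    then have "h (a - b) = 0" using s by (simp add: ring_mapD[OF h])
    then show "a = b" using hnz[of "a - b"] by auto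
  qed
  have fin: "finite ?V" using finite_prime_field p0 by auto
  have card: "card ?V = ?p" using card_image[OF inj] card_prime_field p0 by auto
  have deg: "degree ?g = ?p"
    using p1 degree_add_eq_left[of "- monom (s ^ (?p - 1)) 1" "monom 1 ?p"]
    by (simp add: degree_monom_eq s)
  have "?g = (\<Prod>v\<in>?V. [:- v, 1:])"
  proof (rule monic_eq_prod_linear_factors[OF fin])
    show "degree ?g = card ?V" using deg card by simp
    show "lead_coeff ?g = 1" using deg p1 by simp
    fix v assume "v \<in> ?V"
    then obtain a where a: "a \<in> prime_field" "v = h (- a) * s" by (auto simp: ring_mapD[OF h])
    have "(- a) ^ ?p = - a" using prime_field_power_CHAR[OF p prime_field_closed(5)[OF a(1)], of 1] by simp
    then have "v ^ ?p = h (- a) * s ^ ?p"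
      unfolding a(2) power_mult_distrib by (simp flip: ring_mapD(7)[OF h])
    then show "poly ?g v = 0"
      using p0 a(2) by (simp add: poly_monom power_eq_if[of s ?p] mult_ac)
  qed
  then have "poly ?g t = (\<Prod>v\<in>?V. t - v)" by (simp add: poly_prod)
  also have "\<dots> = (\<Prod>a\<in>prime_field. t + h a * s)" by (simp add: prod.reindex[OF inj])
  finally show ?thesis by (simp add: poly_monom mult.commute)
qed

section \<open>The group action\<close>

text \<open>
  The pair \<open>u = (a, b)\<close> acts as a column \<open>(a, b)\<close> of the matrix would; in this form the action is
  additive in \<open>u\<close>, so that the group only matters through the vectors \<open>M *v c\<close> with \<open>c\<close> over the prime
  field.
\<close>

definition act :: "'a::field ^ 2 \<Rightarrow> (coord, 'a) mpoly \<Rightarrow> (coord, 'a) mpoly" where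
  "act u = subst (\<lambda>v. case v of
       CX \<Rightarrow> x_poly
     | CY \<Rightarrow> y_poly + Const (u $ 1) * x_poly
     | CZ \<Rightarrow> z_poly + Const (2 * u $ 1) * y_poly + Const ((u $ 1)\<^sup>2 + u $ 2) * x_poly)"

lemma ring_map_act: "ring_map (act u)"
  unfolding act_def by (rule ring_map_subst)

lemmas act_hom = ring_mapD[OF ring_map_act]

lemma act_simps:
  "act u (Const c) = Const c"
  "act u x_poly = x_poly"
  "act u y_poly = y_poly + Const (u $ 1) * x_poly"
  "act u z_poly = z_poly + Const (2 * u $ 1) * y_poly + Const ((u $ 1)\<^sup>2 + u $ 2) * x_poly"
  by (simp_all add: act_def subst_Const subst_Var)

lemma act_zero: "act 0 f = f"
proof (rule ring_map_ext[of "act 0" "\<lambda>f. f"])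
  show "act 0 (Var v) = Var v" for v
    by (cases v) (simp_all add: act_simps Const_def)
qed (simp_all add: ring_map_act act_simps ring_map_def[of "\<lambda>f. f"])

lemma act_act: "act u (act w f) = act (u + w) f"
proof -
  have "(act u \<circ> act w) (Var v) = act (u + w) (Var v)" for v
    by (cases v)
      (simp_all add: act_simps act_hom Const_add Const_mult power2_eq_square algebra_simps flip: Const_1)
  then show ?thesis
    using ring_map_ext[OF ring_map_comp[OF ring_map_act ring_map_act] ring_map_act, of u w "u + w" f]
    by (simp add: act_simps)
qed

lemma act_funpow: "(act u ^^ n) f = act (of_nat n *s u) f"
proof (induction n)
  case (Suc n)
  have "u + of_nat n *s u = of_nat (Suc n) *s u" by (simp add: vec_eq_iff algebra_simps)
  then show ?case using Suc by (simp add: act_act)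
qed (simp add: act_zero)

lemma gen_act_eq: "gen_act M j = act (column j M)"
  unfolding gen_act_def act_def gen_image_def by (simp add: column_def)

lemma E_act_eq: "E_act M n f = act (M *v (\<chi> j. of_nat (nat (n j)))) f"
proof -
  have "M *v (\<chi> j. of_nat (nat (n j))) = of_nat (nat (n 1)) *s column 1 M +
    (of_nat (nat (n 2)) *s column 2 M + (of_nat (nat (n 3)) *s column 3 M + of_nat (nat (n 4)) *s column 4 M))"
    by (simp add: vec_eq_iff matrix_vector_mult_def sum_4 column_def algebra_simps)
  then show ?thesis by (simp add: E_act_def gen_act_eq act_funpow act_act)
qed

lemma carrier_E_group: "p > 0 \<Longrightarrow> carrier (E_group p) = {n. \<forall>j. n j \<in> {0..<int p}}"
  by (auto simp: E_group_def carrier_product_group carrier_integer_mod_group PiE_def Pi_def)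

definition act_group :: "'a::field ^ 4 ^ 2 \<Rightarrow> ('a ^ 2) set" where
  "act_group M = (\<lambda>c. M *v c) ` prime_vectors"

lemma
  fixes M :: "'a::field ^ 4 ^ 2"
  assumes "p = CHAR('a)" "p > 0"
  shows E_act_image: "(\<lambda>n. E_act M n f) ` carrier (E_group p) = (\<lambda>u. act u f) ` act_group M"
    and E_act_ball: "(\<forall>n\<in>carrier (E_group p). E_act M n f = f) \<longleftrightarrow> (\<forall>u\<in>act_group M. act u f = f)"
proof -
  have *: "(\<lambda>n. \<chi> j. of_nat (nat (n j))) ` carrier (E_group p) = (prime_vectors :: ('a ^ 4) set)"
  proof (intro equalityI subsetI)
    fix c :: "'a ^ 4" assume "c \<in> (\<lambda>n. \<chi> j. of_nat (nat (n j))) ` carrier (E_group p)"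
    then show "c \<in> prime_vectors"
      using assms by (auto simp: carrier_E_group prime_field_def)
  next
    fix c :: "'a ^ 4" assume "c \<in> prime_vectors"
    then have "\<forall>j. \<exists>k<p. c $ j = of_nat k" using assms by (auto simp: prime_field_eq)
    then obtain k where k: "\<And>j. k j < p" "\<And>j. c $ j = of_nat (k j)" by metis
    then have "c = (\<chi> j. of_nat (nat (int (k j))))" by (simp add: vec_eq_iff)
    moreover have "(\<lambda>j. int (k j)) \<in> carrier (E_group p)" using k assms by (simp add: carrier_E_group)
    ultimately show "c \<in> (\<lambda>n. \<chi> j. of_nat (nat (n j))) ` carrier (E_group p)" by (rule image_eqI)
  qed
  show "(\<lambda>n. E_act M n f) ` carrier (E_group p) = (\<lambda>u. act u f) ` act_group M"
    unfolding act_group_def *[symmetric] image_image E_act_eq ..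
  show "(\<forall>n\<in>carrier (E_group p). E_act M n f = f) \<longleftrightarrow> (\<forall>u\<in>act_group M. act u f = f)"
    unfolding act_group_def *[symmetric] E_act_eq by simp
qed

lemma invariants_eq:
  "p = CHAR('a::field) \<Longrightarrow> p > 0 \<Longrightarrow> invariants p M = {f. \<forall>u\<in>act_group (M :: 'a ^ 4 ^ 2). act u f = f}"
  unfolding invariants_def by (simp add: E_act_ball)

lemma orbit_eq:
  "p = CHAR('a::field) \<Longrightarrow> p > 0 \<Longrightarrow> orbit p M f = (\<lambda>u. act u f) ` act_group (M :: 'a ^ 4 ^ 2)"
  unfolding orbit_def by (simp add: E_act_image)

lemma act_group_diff:
  assumes "u \<in> act_group M" "w \<in> act_group M"
  shows "u - w \<in> act_group M"
proof -
  from assms obtain c d where "u = M *v c" "w = M *v d" "\<forall>j. c $ j \<in> prime_field" "\<forall>j. d $ j \<in> prime_field"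
    by (auto simp: act_group_def)
  then show ?thesis unfolding act_group_def
    by (intro image_eqI[of _ _ "c - d"])
      (auto simp: matrix_vector_mult_diff_distrib prime_field_closed(4))
qed

lemma finite_act_group: "CHAR('a::field) > 0 \<Longrightarrow> finite (act_group (M :: 'a ^ 4 ^ 2))"
  by (simp add: act_group_def finite_prime_vectors)

text \<open>
  Every group element permutes the finite orbit.
\<close>

lemma orbit_prod_invariant:
  fixes M :: "'a::field ^ 4 ^ 2"
  assumes p: "p = CHAR('a)" "p > 0"
  shows "orbit_prod p M f \<in> invariants p M"
proof -
  let ?O = "orbit p M f"
  have fin: "finite ?O" using p finite_act_group[of M] by (simp add: orbit_eq)
  have "act u (\<Prod>?O) = \<Prod>?O" if u: "u \<in> act_group M" for u
  proof -
    have mu: "0 - u \<in> act_group M" "0 \<in> act_group M"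
      using act_group_diff[OF u u] act_group_diff[OF _ u, of 0] by auto
    have inj: "inj_on (act u) ?O"
      by (rule inj_on_inverseI[of _ "act (- u)"]) (simp add: act_act act_zero)
    have "act u ` ?O \<subseteq> ?O"
    proof safe
      fix g assume "g \<in> ?O"
      then obtain w where w: "w \<in> act_group M" "g = act w f" using p by (auto simp: orbit_eq)
      have "w - (0 - u) \<in> act_group M" using w mu act_group_diff by blast
      then show "act u g \<in> ?O" using p w by (auto simp: orbit_eq act_act add.commute)
    qed
    then have "act u ` ?O = ?O" using fin inj by (intro endo_inj_surj)
    then have "\<Prod>?O = \<Prod>(act u ` ?O)" by simp
    also have "\<dots> = (\<Prod>g\<in>?O. act u g)" using inj by (simp add: prod.reindex)
    also have "\<dots> = act u (\<Prod>?O)" by (simp add: ring_map_prod[OF ring_map_act])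
    finally show ?thesis ..
  qed
  then show ?thesis using p by (simp add: invariants_eq orbit_prod_def)
qed

lemma hom_part_act: "hom_part d (act u f) = act u (hom_part d f)"
  unfolding act_def
proof (rule hom_part_subst)
  fix v show "homogeneous 1 (case v of CX \<Rightarrow> x_poly | CY \<Rightarrow> y_poly + Const (u $ 1) * x_poly
     | CZ \<Rightarrow> z_poly + Const (2 * u $ 1) * y_poly + Const ((u $ 1)\<^sup>2 + u $ 2) * x_poly)"
    using homogeneous_Var[where ?'b = 'a]
    by (cases v) (auto intro!: homogeneous_add homogeneous_Const_mult)
qed

section \<open>Dehomogenization\<close>

text \<open>
  Setting \<open>x = 1\<close>.  The outer variable of the iterated polynomials is \<open>Z\<close>, so that \<open>degree\<close> and
  \<open>lead_coeff\<close> refer to \<open>Z\<close> and the coefficients are polynomials in \<open>Y\<close>.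
\<close>

definition dehom :: "(coord, 'a::field) mpoly \<Rightarrow> 'a poly poly" where
  "dehom = mpoly_eval (\<lambda>c. [:[:c:]:]) (\<lambda>v. case v of CX \<Rightarrow> 1 | CY \<Rightarrow> [:[:0, 1:]:] | CZ \<Rightarrow> [:0, 1:])"

lemma ring_map_const_poly: "ring_map (\<lambda>c :: 'a::comm_ring_1. [:c:])"
  by (simp add: ring_map_def one_pCons)

lemma ring_map_const_poly2: "ring_map (\<lambda>c :: 'a::comm_ring_1. [:[:c:]:])"
  using ring_map_comp[OF ring_map_const_poly ring_map_const_poly] by (simp add: comp_def)

lemma ring_map_dehom: "ring_map dehom"
  unfolding dehom_def by (intro ring_map_mpoly_eval ring_map_const_poly2)

lemmas dehom_hom = ring_mapD[OF ring_map_dehom]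

lemma dehom_simps:
  "dehom (Const c) = [:[:c:]:]" "dehom x_poly = 1" "dehom y_poly = [:[:0, 1:]:]" "dehom z_poly = [:0, 1:]"
  by (simp_all add: dehom_def mpoly_eval_Const mpoly_eval_Var ring_map_const_poly2)

lemma UNIV_coord: "UNIV = {CX, CY, CZ}"
  using coord.exhaust by auto

instance coord :: finite
  by standard (simp add: UNIV_coord)

lemma coeff_dehom_single:
  "coeff (coeff (dehom (single m c)) j) i = (if i = lookup m CY \<and> j = lookup m CZ then c else 0)"
proof -
  have "dehom (single m c) = [:[:c:]:] * ([:[:0, 1:]:] ^ lookup m CY * [:0, 1:] ^ lookup m CZ)"
    unfolding dehom_def mpoly_eval_single[OF ring_map_const_poly2]
    by (subst power_prod_superset[of "{CX, CY, CZ}"]) (auto intro: coord.exhaust)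
  also have "\<dots> = [:[:c:] * [:0, 1:] ^ lookup m CY:] * [:0, 1:] ^ lookup m CZ"
    by (simp add: poly_const_pow)
  also have "\<dots> = monom (monom c (lookup m CY)) (lookup m CZ)"
    by (simp add: monom_altdef)
  finally show ?thesis by auto
qed

lemma coeff_dehom:
  "coeff (coeff (dehom f) j) i = (\<Sum>m\<in>keys f. if i = lookup m CY \<and> j = lookup m CZ then lookup f m else 0)"
proof -
  have "dehom f = (\<Sum>m\<in>keys f. dehom (single m (lookup f m)))"
    by (simp add: mpoly_sum_single flip: ring_map_sum[OF ring_map_dehom])
  then show ?thesis by (simp add: coeff_sum coeff_dehom_single)
qed

text \<open>
  The exponent of \<open>x\<close> in a monomial can be recovered from the degree and the other two exponents.
\<close>

lemma dehom_inj_homogeneous: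
  assumes "homogeneous d f" "homogeneous d g" "dehom f = dehom g"
  shows "f = g"
proof -
  define h where "h = f - g"
  have h: "homogeneous d h" "dehom h = 0"
    using assms by (auto simp: h_def dehom_hom intro: homogeneous_diff)
  have "lookup h m = 0" if m: "m \<in> keys h" for m
  proof -
    have tot: "total_deg k = lookup k CX + lookup k CY + lookup k CZ" for k :: "coord monomial"
      by (subst total_deg_superset[of "{CX, CY, CZ}"]) (auto intro: coord.exhaust)
    have "n = m" if "n \<in> keys h" "lookup m CY = lookup n CY" "lookup m CZ = lookup n CZ" for n
    proof (rule poly_mapping_eqI)
      have "total_deg n = total_deg m" using that(1) m h(1) by (auto simp: homogeneous_def)
      then show "lookup n v = lookup m v" for v
        using that by (cases v) (auto simp: tot)
    qed
    then have "coeff (coeff (dehom h) (lookup m CZ)) (lookup m CY) = (\<Sum>n\<in>keys h. if n = m then lookup h n else 0)"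
      unfolding coeff_dehom by (intro sum.cong refl) auto
    then show ?thesis using h(2) by (simp add: m split: if_splits)
  qed
  then have "h = 0" by (metis in_keys_iff keys_eq_empty equals0I)
  then show ?thesis by (simp add: h_def)
qed

definition y_shift :: "'a::field \<Rightarrow> 'a poly poly \<Rightarrow> 'a poly poly" where
  "y_shift a = map_poly (\<lambda>r. pcompose r [:a, 1:])"

lemma ring_map_pcompose: "ring_map (\<lambda>g. pcompose g h)"
  by (simp add: ring_map_def pcompose_add pcompose_mult pcompose_1)

lemma ring_map_map_poly:
  assumes "ring_map h"
  shows "ring_map (map_poly h)"
proof -
  note [simp] = ring_mapD[OF assms]
  show ?thesis unfolding ring_map_def
    by (auto intro!: poly_eqI simp: coeff_map_poly coeff_mult ring_map_sum[OF assms])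
qed

lemma ring_map_y_shift: "ring_map (y_shift a)"
  unfolding y_shift_def by (intro ring_map_map_poly ring_map_pcompose)

text \<open>
  After setting \<open>x = 1\<close> the element \<open>(a, b)\<close> shifts \<open>Y\<close> by \<open>a\<close> and \<open>Z\<close> by \<open>a\<^sup>2 + b + 2 a Y\<close>.  In
  particular it keeps the degree in \<open>Z\<close> and acts on the leading coefficient by the shift of \<open>Y\<close> alone.
\<close>

lemma dehom_act:
  "dehom (act u f) = pcompose (y_shift (u $ 1) (dehom f)) [:[:(u $ 1)\<^sup>2 + u $ 2, 2 * u $ 1:], 1:]"
proof -
  let ?q = "[:[:(u $ 1)\<^sup>2 + u $ 2, 2 * u $ 1:], 1:]"
  have "(dehom \<circ> act u) f = ((\<lambda>g. pcompose g ?q) \<circ> (y_shift (u $ 1) \<circ> dehom)) f"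
  proof (rule ring_map_ext)
    show "ring_map (dehom \<circ> act u)" "ring_map ((\<lambda>g. pcompose g ?q) \<circ> (y_shift (u $ 1) \<circ> dehom))"
      by (intro ring_map_comp ring_map_dehom ring_map_act ring_map_pcompose ring_map_y_shift)+
    show "(dehom \<circ> act u) (Const c) = ((\<lambda>g. pcompose g ?q) \<circ> (y_shift (u $ 1) \<circ> dehom)) (Const c)" for c
      by (simp add: act_simps dehom_simps y_shift_def map_poly_pCons)
    show "(dehom \<circ> act u) (Var v) = ((\<lambda>g. pcompose g ?q) \<circ> (y_shift (u $ 1) \<circ> dehom)) (Var v)" for v
      by (cases v) (simp_all add: act_simps dehom_simps dehom_hom y_shift_def map_poly_pCons pcompose_pCons one_pCons)
  qed
  then show ?thesis by simp
qed

section \<open>The invariant ring of a product group\<close>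

text \<open>
  The group that belongs to a matrix in normal form; there \<open>W\<close> is the span of the second row over the
  prime field.
\<close>

locale product_translations =
  fixes p :: nat and W :: "'a::field set"
  assumes p: "prime p" "CHAR('a) = p"
    and W: "finite W" "0 \<in> W" "\<And>u v. u \<in> W \<Longrightarrow> v \<in> W \<Longrightarrow> u - v \<in> W" "card W = p ^ 3"
begin

definition G :: "('a ^ 2) set" where
  "G = {u. u $ 1 \<in> prime_field \<and> u $ 2 \<in> W}"

text \<open>
  The action on polynomials in \<open>Z\<close> over the polynomials in \<open>Y\<close>, compatible with setting \<open>x = 1\<close> by
  \<open>dehom_act\<close>.
\<close>

definition poly_act :: "'a ^ 2 \<Rightarrow> 'a poly poly \<Rightarrow> 'a poly poly" where
  "poly_act u g = pcompose (y_shift (u $ 1) g) [:[:(u $ 1)\<^sup>2 + u $ 2, 2 * u $ 1:], 1:]"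

definition poly_invariant :: "'a poly poly \<Rightarrow> bool" where
  "poly_invariant g \<longleftrightarrow> (\<forall>u\<in>G. poly_act u g = g)"

lemma ring_map_poly_act: "ring_map (poly_act u)"
proof -
  have "poly_act u = (\<lambda>g. pcompose g [:[:(u $ 1)\<^sup>2 + u $ 2, 2 * u $ 1:], 1:]) \<circ> y_shift (u $ 1)"
    by (auto simp: poly_act_def)
  then show ?thesis by (metis ring_map_comp ring_map_pcompose ring_map_y_shift)
qed

lemmas poly_act_hom = ring_mapD[OF ring_map_poly_act]

lemma poly_invariant_ops:
  "poly_invariant f \<Longrightarrow> poly_invariant g \<Longrightarrow> poly_invariant (f - g)"
  "poly_invariant f \<Longrightarrow> poly_invariant g \<Longrightarrow> poly_invariant (f * g)"
  "poly_invariant f \<Longrightarrow> poly_invariant (f ^ n)"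
  by (simp_all add: poly_invariant_def poly_act_hom)

lemma poly_invariant_const:
  "(\<And>a. a \<in> prime_field \<Longrightarrow> pcompose r [:a, 1:] = r) \<Longrightarrow> poly_invariant [:r:]"
  by (auto simp: poly_invariant_def poly_act_def y_shift_def map_poly_pCons G_def)

lemma poly_invariant_dehom: "(\<And>u. u \<in> G \<Longrightarrow> act u f = f) \<Longrightarrow> poly_invariant (dehom f)"
  unfolding poly_invariant_def poly_act_def by (metis dehom_act)

lemma degree_poly_invariant:
  assumes "poly_invariant g"
  shows "p ^ 3 dvd degree g"
proof -
  let ?V = "(\<lambda>b. [:b:]) ` W"
  have "card ?V dvd degree g"
  proof (rule card_dvd_degree_translation_invariant)
    fix v assume "v \<in> ?V"
    then obtain b where b: "b \<in> W" "v = [:b:]" by auto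
    have "y_shift 0 g = g" by (simp add: y_shift_def)
    moreover have "vector [0, b] \<in> G" using b by (simp add: G_def prime_field_closed)
    then have "poly_act (vector [0, b]) g = g" using assms by (simp add: poly_invariant_def)
    ultimately show "pcompose g [:v, 1:] = g" by (simp add: poly_act_def b)
  qed (use W in auto)
  moreover have "card ?V = p ^ 3" using W by (subst card_image) (auto intro: inj_onI)
  ultimately show ?thesis by simp
qed

text \<open>
  This is the Artin-Schreier polynomial \<open>Y^p - Y\<close>.
\<close>

definition artin_schreier :: "'a poly" where "artin_schreier = (\<Prod>v\<in>prime_field. [:- v, 1:])"

lemma lead_coeff_poly_invariant:
  assumes "poly_invariant g"
  shows "\<And>a. a \<in> prime_field \<Longrightarrow> pcompose (lead_coeff g) [:a, 1:] = lead_coeff g"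
    and "\<exists>r. lead_coeff g = pcompose r artin_schreier"
proof -
  show *: "pcompose (lead_coeff g) [:a, 1:] = lead_coeff g" if a: "a \<in> prime_field" for a
  proof (cases "g = 0")
    case False
    have "pcompose (lead_coeff g) [:a, 1:] \<noteq> 0" using False by (simp add: pcompose_eq_0_iff)
    then have lc: "lead_coeff (y_shift a g) = pcompose (lead_coeff g) [:a, 1:]"
      unfolding y_shift_def by (intro lead_coeff_map_poly_nz) auto
    \<comment> \<open>the shift of \<open>Z\<close> by \<open>a\<^sup>2 + 2 a Y\<close> does not affect the leading coefficient\<close>
    have "vector [a, 0] \<in> G" using a W by (simp add: G_def)
    then have "poly_act (vector [a, 0]) g = g" using assms by (simp add: poly_invariant_def)
    then have "lead_coeff (pcompose (y_shift a g) [:[:a\<^sup>2, 2 * a:], 1:]) = lead_coeff g"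
      by (simp add: poly_act_def)
    then show ?thesis using lc by (simp add: lead_coeff_comp)
  qed simp
  have "CHAR('a) > 0" using p prime_gt_0_nat by blast
  then show "\<exists>r. lead_coeff g = pcompose r artin_schreier"
    unfolding artin_schreier_def
    by (intro translation_invariant_poly *) (auto simp: finite_prime_field prime_field_closed)
qed

end

text \<open>
  The properties of the generators that determine the invariant ring: their lead monomials, and their
  degrees and leading coefficients in \<open>Z\<close> after setting \<open>x = 1\<close>.
\<close>

locale product_translations_generators = product_translations +
  fixes h N :: "(coord, 'a) mpoly" and b :: "4 \<Rightarrow> (coord, 'a) mpoly" and c :: 'a
  assumes b: "b 1 = x_poly" "b 2 = y_poly ^ p - y_poly * x_poly ^ (p - 1)" "b 3 = h" "b 4 = N"
    and inv: "\<And>i u. u \<in> G \<Longrightarrow> act u (b i) = b i"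
    and hom: "homogeneous (p ^ 3 + 1) h" "homogeneous (p ^ 4) N"
    and lead: "h \<noteq> 0" "lead_exp h = single CY (p ^ 3 + 1)" "N \<noteq> 0" "lead_exp N = single CZ (p ^ 4)"
    and deg: "degree (dehom h) = p ^ 3" "lead_coeff (dehom h) = [:c:]" "c \<noteq> 0"
      "degree (dehom N) = p ^ 4" "lead_coeff (dehom N) = 1"
begin

text \<open>
  The exponents of the products that form a basis of the invariant ring.
\<close>

definition std :: "4 monomial set" where "std = {K. lookup K 3 < p}"

lemma p_gt: "p > 1" "p > 0"
  using p prime_gt_1_nat prime_gt_0_nat by blast+

lemma std_add: "keys f \<subseteq> std \<Longrightarrow> keys g \<subseteq> std \<Longrightarrow> keys (f + g) \<subseteq> std"
  using keys_add[of f g] by auto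

lemma std_sum: "(\<And>i. i \<in> A \<Longrightarrow> keys (f i) \<subseteq> std) \<Longrightarrow> keys (sum f A) \<subseteq> std"
  using keys_sum[of f A] by blast

lemma dehom_NY: "dehom (b 2) = [:artin_schreier:]"
proof -
  have "artin_schreier = (\<Prod>a\<in>prime_field. [:0, 1:] + [:- a:] * 1)"
    by (simp add: artin_schreier_def)
  also have "\<dots> = (\<Prod>a\<in>prime_field. [:0, 1:] + [:a:] * 1)"
    by (rule prod.reindex_bij_witness[of _ uminus uminus]) (auto intro: prime_field_closed)
  also have "\<dots> = [:0, 1:] ^ p - [:0, 1:]"
    using prod_prime_field[of "\<lambda>a. [:a:]" 1 "[:0, 1 :: 'a:]"] p by (simp add: ring_map_const_poly)
  finally have "artin_schreier = [:0, 1:] ^ p - [:0, 1:]" .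
  then show ?thesis by (simp add: b dehom_hom dehom_simps poly_const_pow)
qed

definition representable :: "'a poly poly \<Rightarrow> bool" where
  "representable g \<longleftrightarrow> (\<exists>q. keys q \<subseteq> std \<and> dehom (subst b q) = g)"

lemma representable_add: "representable f \<Longrightarrow> representable g \<Longrightarrow> representable (f + g)"
  unfolding representable_def by (metis dehom_hom(2) std_add subst_hom(2))

lemma representable_0: "representable 0"
  unfolding representable_def by (rule exI[of _ 0]) (simp add: subst_hom dehom_hom)

lemma representable_sum: "(\<And>i. i \<in> A \<Longrightarrow> representable (f i)) \<Longrightarrow> representable (sum f A)"
  by (induction A rule: infinite_finite_induct) (auto intro!: representable_add representable_0)

lemma representable_term:
  assumes "j < p"
  shows "representable ([:[:a:]:] * [:artin_schreier:] ^ i * dehom h ^ j * dehom N ^ k)"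
proof -
  let ?K = "single 2 i + single 3 j + single 4 k :: 4 monomial"
  have "dehom (subst b (single ?K a)) = [:[:a:]:] * [:artin_schreier:] ^ i * dehom h ^ j * dehom N ^ k"
    using dehom_NY by (simp add: subst_single power_prod_add dehom_hom dehom_simps b mult.assoc del: pCons_eq_iff)
  moreover have "keys (single ?K a) \<subseteq> std"
    using assms by (auto simp: std_def lookup_add lookup_single)
  ultimately show ?thesis unfolding representable_def by blast
qed

text \<open>
  The leading term in \<open>Z\<close> of an invariant is that of a suitable product of generators.
\<close>

lemma poly_invariant_representable: "poly_invariant g \<Longrightarrow> representable g"
proof (induction "degree g" arbitrary: g rule: less_induct)
  case less
  show ?case
  proof (cases "g = 0")
    case False
    obtain l where l: "degree g = p ^ 3 * l"
      using degree_poly_invariant[OF less(2)] by (auto simp: dvd_def)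
    obtain r where r: "lead_coeff g = pcompose r artin_schreier"
      using lead_coeff_poly_invariant[OF less(2)] by blast
    \<comment> \<open>\<open>h^j N^k\<close> has degree \<open>p^3 (j + p k) = p^3 l\<close> in \<open>Z\<close>; the remaining factors adjust the
      leading coefficient.\<close>
    define j k where "j = l mod p" and "k = l div p"
    define t where "t = [:lead_coeff g:] * [:[:inverse (c ^ j):]:] * dehom h ^ j * dehom N ^ k"
    have "[:lead_coeff g:] = (\<Sum>i\<le>degree r. [:[:coeff r i:]:] * [:artin_schreier:] ^ i)"
    proof -
      have "lead_coeff g = (\<Sum>i\<le>degree r. [:coeff r i:] * artin_schreier ^ i)"
        unfolding r pcompose_altdef poly_altdef by (simp add: coeff_map_poly degree_map_poly)
      then have "[:lead_coeff g:] = (\<lambda>r. [:r:]) (\<Sum>i\<le>degree r. [:coeff r i:] * artin_schreier ^ i)" by simp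
      also have "\<dots> = (\<Sum>i\<le>degree r. [:[:coeff r i:] * artin_schreier ^ i:])"
        by (rule ring_map_sum[OF ring_map_const_poly])
      finally show ?thesis by (simp add: poly_const_pow)
    qed
    then have "t = (\<Sum>i\<le>degree r. [:[:coeff r i:]:] * [:artin_schreier:] ^ i * [:[:inverse (c ^ j):]:] * dehom h ^ j * dehom N ^ k)"
      unfolding t_def by (simp only: sum_distrib_right)
    also have "\<dots> = (\<Sum>i\<le>degree r. [:[:coeff r i * inverse (c ^ j):]:] * [:artin_schreier:] ^ i * dehom h ^ j * dehom N ^ k)"
      by (intro sum.cong refl) (simp add: mult_ac)
    finally have "t = \<dots>" .
    moreover have "j < p" using p_gt by (simp add: j_def)
    ultimately have representable_t: "representable t" by (simp only: representable_sum representable_term)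
    have nz: "dehom h \<noteq> 0" "dehom N \<noteq> 0" using deg by auto
    have "degree t = j * p ^ 3 + k * p ^ 4"
      unfolding t_def using nz False deg by (simp add: degree_mult_eq degree_power_eq)
    also have "\<dots> = p ^ 3 * (j + p * k)" by (simp add: algebra_simps power_numeral_reduce)
    also have "\<dots> = degree g" by (simp add: l j_def k_def)
    finally have deg_t: "degree t = degree g" .
    have "lead_coeff t = lead_coeff g * [:inverse (c ^ j):] * [:c:] ^ j"
      unfolding t_def by (simp only: lead_coeff_mult lead_coeff_power deg(2) deg(5)) simp
    then have lc: "lead_coeff t = lead_coeff g"
      using deg(3) by (simp add: poly_const_pow)
    have "poly_invariant [:lead_coeff g:]"
      using lead_coeff_poly_invariant(1)[OF less(2)] by (rule poly_invariant_const)
    moreover have "poly_invariant [:[:d:]:]" for d by (rule poly_invariant_const) simp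
    moreover have "poly_invariant (dehom h)" "poly_invariant (dehom N)"
      using inv[of _ 3] inv[of _ 4] b by (auto intro: poly_invariant_dehom)
    ultimately have inv': "poly_invariant (g - t)"
      unfolding t_def by (intro poly_invariant_ops less(2)) auto
    have "g - t = 0 \<or> degree (g - t) < degree g"
      by (rule eq_zero_or_degree_less) (use deg_t lc in \<open>auto intro: degree_diff_le\<close>)
    then have "representable (g - t)" using less(1)[OF _ inv'] representable_0 by auto
    from representable_add[OF this representable_t] show ?thesis by simp
  qed (simp add: representable_0)
qed

lemma lead_NY: "b 2 \<noteq> 0" "lead_exp (b 2) = single CY p" "homogeneous p (b 2)"
proof -
  have Vp: "Var v ^ n = single (single v n) (1 :: 'a)" for v :: coord and n
    using power_prod_Var[of "single v n", where 'a = 'a] by simp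
  have eq: "b 2 = single (single CY p) 1 - single (single CY 1 + single CX (p - 1)) 1"
  proof -
    have "b 2 = Var CY ^ p - Var CY ^ 1 * Var CX ^ (p - 1)" by (simp add: b)
    then show ?thesis by (simp only: Vp mult_single mult_1)
  qed
  have neq: "single CY p \<noteq> single CY 1 + single CX (p - 1)"
    using p_gt by (auto dest!: arg_cong[of _ _ "\<lambda>m. lookup m CX"] simp: lookup_add lookup_single)
  have "grevlex_less (single CY 1 + single CX (p - 1)) (single CY p)"
    unfolding grevlex_less_def using p_gt
    by (intro disjI2 conjI exI[of _ CX])
      (auto simp: total_deg_add lookup_add lookup_single less_coord_def less_eq_coord_def)
  then have keys: "keys (b 2) = {single CY p, single CY 1 + single CX (p - 1)}"
    unfolding eq using neq by (auto simp: in_keys_iff lookup_minus lookup_single when_def split: if_splits)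
  then show "b 2 \<noteq> 0" by auto
  show "lead_exp (b 2) = single CY p"
    by (rule lead_exp_eqI) (use keys \<open>grevlex_less _ _\<close> in auto)
  show "homogeneous p (b 2)" using keys p_gt by (auto simp: homogeneous_def total_deg_add)
qed

lemma lead_x: "x_poly \<noteq> (0 :: (coord, 'a) mpoly)" "lead_exp (x_poly :: (coord, 'a) mpoly) = single CX 1"
proof -
  have "single (single CX 1) (1 :: 'a) \<noteq> 0" by (metis lookup_single_eq lookup_zero one_neq_zero)
  then show "x_poly \<noteq> (0 :: (coord, 'a) mpoly)" by (simp add: Var_def del: One_nat_def)
  show "lead_exp (x_poly :: (coord, 'a) mpoly) = single CX 1" by (simp add: Var_def lead_exp_single)
qed

lemma b_nonzero: "b i \<noteq> 0"
  using exhaust_4[of i] lead_NY lead_x lead b by auto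

lemma lookup_lead_power_prod:
  "lookup (lead_exp (power_prod b K)) CX = lookup K 1"
  "lookup (lead_exp (power_prod b K)) CY = p * lookup K 2 + (p ^ 3 + 1) * lookup K 3"
  "lookup (lead_exp (power_prod b K)) CZ = p ^ 4 * lookup K 4"
  by (simp_all add: lookup_lead_exp_power_prod b_nonzero sum_4 b(1,3,4) lead lead_NY lead_x lookup_single)

text \<open>
  The exponent of \<open>h\<close> is the residue modulo \<open>p\<close> of the exponent of \<open>y\<close>, as \<open>p^3 + 1\<close> is \<open>1\<close> modulo \<open>p\<close>.
  The other exponents can then be read off one by one.
\<close>

lemma inj_lead: "inj_on (\<lambda>K. lead_exp (power_prod b K)) std"
proof (rule inj_onI, rule poly_mapping_eqI)
  fix K L i assume KL: "K \<in> std" "L \<in> std" "lead_exp (power_prod b K) = lead_exp (power_prod b L)"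
  note eq = arg_cong[OF KL(3), of "\<lambda>m. lookup m CX"] arg_cong[OF KL(3), of "\<lambda>m. lookup m CY"]
    arg_cong[OF KL(3), of "\<lambda>m. lookup m CZ"]
  note eq = eq[unfolded lookup_lead_power_prod]
  have "(p * lookup K 2 + (p ^ 3 + 1) * lookup K 3) mod p = lookup K 3" if "K \<in> std" for K
  proof -
    have "p * lookup K 2 + (p ^ 3 + 1) * lookup K 3 = lookup K 3 + p * (lookup K 2 + p\<^sup>2 * lookup K 3)"
      by (simp add: algebra_simps power_numeral_reduce)
    then show ?thesis using that by (simp only: std_def mem_Collect_eq mod_mult_self2 mod_less)
  qed
  then have 3: "lookup K 3 = lookup L 3" using eq(2) KL by metis
  then show "lookup K i = lookup L i" using eq p_gt exhaust_4[of i] by auto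
qed

definition deg_b :: "4 \<Rightarrow> nat" where
  "deg_b i = (if i = 1 then 1 else if i = 2 then p else if i = 3 then p ^ 3 + 1 else p ^ 4)"

lemma homogeneous_b: "homogeneous (deg_b i) (b i)"
  using exhaust_4[of i] lead_NY(3) hom homogeneous_Var[of CX, where ?'b = 'a] by (auto simp: b deg_b_def)

definition weight :: "4 monomial \<Rightarrow> nat" where
  "weight K = (\<Sum>i\<in>keys K. deg_b i * lookup K i)"

lemma homogeneous_power_prod_b: "homogeneous (weight K) (power_prod b K)"
  unfolding weight_def by (intro homogeneous_power_prod homogeneous_b)

lemma weight_add: "weight (K + single 1 n) = weight K + n"
proof -
  have "weight I = (\<Sum>i\<in>UNIV. deg_b i * lookup I i)" for I
    unfolding weight_def by (intro sum.mono_neutral_left) (auto simp: in_keys_iff)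
  then show ?thesis by (simp add: sum_4 lookup_add lookup_single deg_b_def)
qed

text \<open>
  A representation after setting \<open>x = 1\<close> becomes one of homogeneous polynomials if each product is
  filled up with a power of \<open>x\<close> to a common degree.  This degree may have to exceed that of \<open>f\<close>, whence
  the power of \<open>x\<close> at \<open>f\<close>.
\<close>

lemma x_power_times_invariant:
  assumes f: "homogeneous d f" "\<And>u. u \<in> G \<Longrightarrow> act u f = f"
  shows "\<exists>m q. keys q \<subseteq> std \<and> subst b q = x_poly ^ m * f"
proof -
  obtain q where q: "keys q \<subseteq> std" "dehom (subst b q) = dehom f"
    using poly_invariant_representable[OF poly_invariant_dehom[OF f(2)]] by (auto simp: representable_def)
  \<comment> \<open>any bound for the weights will do; it keeps the subtraction below from being truncated\<close>
  define m where "m = (\<Sum>K\<in>keys q. weight K)"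
  have m: "weight K \<le> m" if "K \<in> keys q" for K
    unfolding m_def using that by (intro member_le_sum) auto
  define q' where "q' = (\<Sum>K\<in>keys q. single (K + single 1 (m + d - weight K)) (lookup q K))"
  have q': "keys q' \<subseteq> std"
    unfolding q'_def using q(1) by (intro std_sum) (auto simp: std_def lookup_add lookup_single)
  have "homogeneous (m + d) (subst b q')"
    unfolding q'_def ring_map_sum[OF ring_map_subst] subst_single
  proof (intro homogeneous_sum homogeneous_Const_mult)
    fix K assume "K \<in> keys q"
    then have "weight (K + single 1 (m + d - weight K)) = m + d" using m[of K] by (simp add: weight_add)
    then show "homogeneous (m + d) (power_prod b (K + single 1 (m + d - weight K)))"
      using homogeneous_power_prod_b by metis
  qed
  moreover have "homogeneous (m + d) (x_poly ^ m * f)"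
    using homogeneous_mult[OF homogeneous_power[OF homogeneous_Var] f(1), of m CX] by simp
  moreover have "dehom (subst b q') = dehom (x_poly ^ m * f)"
  proof -
    have "dehom (subst b q') = (\<Sum>K\<in>keys q. dehom (subst b (single K (lookup q K))))"
      unfolding q'_def ring_map_sum[OF ring_map_subst] ring_map_sum[OF ring_map_dehom]
      by (intro sum.cong refl) (simp add: subst_single power_prod_add dehom_hom dehom_simps b)
    also have "\<dots> = dehom (subst b q)"
      by (simp add: mpoly_sum_single flip: ring_map_sum[OF ring_map_dehom] ring_map_sum[OF ring_map_subst])
    finally show ?thesis by (simp add: q(2) dehom_hom dehom_simps)
  qed
  ultimately have "subst b q' = x_poly ^ m * f" by (rule dehom_inj_homogeneous)
  then show ?thesis using q' by blast
qed

text \<open>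
  The products without a factor \<open>x\<close> would have, if any occurred, a lead monomial without \<open>x\<close>, whereas
  every lead monomial of a multiple of \<open>x\<close> contains \<open>x\<close>.
\<close>

lemma saturated:
  assumes q: "keys q \<subseteq> std" "subst b q = x_poly * f"
  shows "\<exists>q'. keys q' \<subseteq> std \<and> subst b q' = f"
proof -
  \<comment> \<open>\<open>u\<close> collects the products without \<open>x\<close>, the others are \<open>x\<close> times those in \<open>v\<close>\<close>
  define u where "u = (\<Sum>K\<in>{K\<in>keys q. lookup K 1 = 0}. single K (lookup q K))"
  define v where "v = (\<Sum>K\<in>{K\<in>keys q. lookup K 1 \<noteq> 0}. single (K - single 1 1) (lookup q K))"
  have K: "single 1 1 + (K - single 1 1) = K" if "lookup K 1 \<noteq> 0" for K :: "4 monomial"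
    using that by (intro poly_mapping_eqI) (auto simp: lookup_add lookup_minus lookup_single when_def)
  have "q = (\<Sum>K\<in>keys q. single K (lookup q K))" by (simp add: mpoly_sum_single)
  also have "\<dots> = (\<Sum>K\<in>{K\<in>keys q. lookup K 1 \<noteq> 0}. single K (lookup q K)) + u"
    unfolding u_def by (subst sum.union_disjoint[symmetric]) (auto intro!: sum.cong)
  also have "(\<Sum>K\<in>{K\<in>keys q. lookup K 1 \<noteq> 0}. single K (lookup q K)) = Var 1 * v"
    unfolding v_def sum_distrib_left by (intro sum.cong refl) (simp add: Var_def mult_single K del: One_nat_def)
  finally have quv: "q = Var 1 * v + u" .
  have v: "keys v \<subseteq> std"
    unfolding v_def using q(1)
    by (intro std_sum) (auto simp: std_def lookup_minus lookup_single)
  have keys_u: "keys u \<subseteq> {K\<in>keys q. lookup K 1 = 0}"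
    unfolding u_def by (rule order_trans[OF keys_sum]) auto
  have "subst b q = x_poly * subst b v + subst b u"
    unfolding quv by (simp add: subst_hom subst_Var b)
  then have xu: "subst b u = x_poly * (f - subst b v)" using q(2) by (simp add: algebra_simps)
  have "u = 0"
  proof (rule ccontr)
    assume "u \<noteq> 0"
    have "keys u \<subseteq> std" using keys_u q(1) by auto
    from lead_subst_standard[of b, OF b_nonzero inj_lead this \<open>u \<noteq> 0\<close>]
    obtain K where K: "K \<in> keys u" "subst b u \<noteq> 0" "lead_exp (subst b u) = lead_exp (power_prod b K)" by metis
    then have "lookup (lead_exp (subst b u)) CX = 0"
      using keys_u lookup_lead_power_prod(1)[of K] by auto
    moreover have "f - subst b v \<noteq> 0" using K(2) xu by auto
    then have "lookup (lead_exp (subst b u)) CX \<ge> 1"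
      unfolding xu using lead_x by (simp add: lead_exp_mult lookup_add lookup_single)
    ultimately show False by simp
  qed
  then have "x_poly * (f - subst b v) = 0" using xu by (simp add: subst_hom)
  then have "subst b v = f" using lead_x(1) by auto
  then show ?thesis using v by blast
qed

lemma saturated_power:
  "keys q \<subseteq> std \<Longrightarrow> subst b q = x_poly ^ m * f \<Longrightarrow> \<exists>q'. keys q' \<subseteq> std \<and> subst b q' = f"
proof (induction m arbitrary: q)
  case (Suc m)
  then obtain q' where "keys q' \<subseteq> std" "subst b q' = x_poly ^ m * f"
    using saturated[of q "x_poly ^ m * f"] by (auto simp: mult.assoc)
  then show ?case by (rule Suc.IH)
qed auto

lemma invariant_standard:
  assumes f: "\<And>u. u \<in> G \<Longrightarrow> act u f = f"
  shows "\<exists>q. keys q \<subseteq> std \<and> subst b q = f"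
proof -
  have "\<exists>q. keys q \<subseteq> std \<and> subst b q = hom_part d f" for d
  proof -
    have "act u (hom_part d f) = hom_part d f" if "u \<in> G" for u
      using f[OF that] by (simp flip: hom_part_act)
    then obtain m q where "keys q \<subseteq> std" "subst b q = x_poly ^ m * hom_part d f"
      using x_power_times_invariant[OF homogeneous_hom_part[of d f]] by blast
    then show ?thesis by (rule saturated_power)
  qed
  then obtain q where q: "\<And>d. keys (q d) \<subseteq> std" "\<And>d. subst b (q d) = hom_part d f" by metis
  have "subst b (\<Sum>d\<in>total_deg ` keys f. q d) = f"
    by (simp add: ring_map_sum[OF ring_map_subst] q sum_hom_parts)
  moreover have "keys (\<Sum>d\<in>total_deg ` keys f. q d) \<subseteq> std" by (intro std_sum q(1))
  ultimately show ?thesis by blast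
qed

definition ring :: "(coord, 'a) mpoly set" where "ring = {f. \<forall>u\<in>G. act u f = f}"

lemma subalgebra_ring: "subalgebra ring"
  by (auto simp: subalgebra_def ring_def act_simps act_hom)

lemma sagbi: "sagbi_basis (range b) ring"
proof (rule sagbi_basis_standard[of ring b std, OF subalgebra_ring _ b_nonzero inj_lead])
  show "b i \<in> ring" for i using inv by (auto simp: ring_def)
  show "\<exists>q. keys q \<subseteq> std \<and> subst b q = f" if "f \<in> ring" for f
    using that by (intro invariant_standard) (auto simp: ring_def)
qed

text \<open>
  All products in a subduction of the tete-a-tete have smaller lead monomials than \<open>h^p\<close>, whose degree is
  \<open>p (p^3 + 1)\<close>.
  A product with at least \<open>p\<close> factors \<open>h\<close> has at least this degree, and it has exactly this degree only
  if it equals \<open>h^p\<close>.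
\<close>

lemma subduction_relation_standard:
  assumes "subduction_relation b (single 3 p) (single 2 (p ^ 3 + 1)) r"
  obtains s where "r = single (single 3 p) 1 - s" "keys s \<subseteq> std" "subst b r = 0"
proof -
  let ?I = "single 3 p :: 4 monomial" and ?J = "single 2 (p ^ 3 + 1) :: 4 monomial"
  obtain a R where LT: "LT (power_prod b ?I) = LT (Const a * power_prod b ?J)"
    and R: "subduction b (power_prod b ?I - Const a * power_prod b ?J) R"
    and r: "r = single ?I 1 - single ?J a - R"
    using assms unfolding subduction_relation_def monom_prod_eq by blast
  have nz: "power_prod b K \<noteq> 0" for K by (rule power_prod_nonzero[of b, OF b_nonzero])
  have a: "a \<noteq> 0"
  proof
    assume "a = 0"
    then have "LT (power_prod b ?I) = 0" using LT by (simp add: LT_def Const_def)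
    then have "lookup (LT (power_prod b ?I)) (lead_exp (power_prod b ?I)) = 0" by (simp only: lookup_zero)
    then show False using lead_coeff_neq_0[OF nz[of ?I]] by (simp add: LT_def)
  qed
  have "keys R \<subseteq> std"
  proof
    fix K assume K: "K \<in> keys R"
    let ?f = "power_prod b ?I - Const a * power_prod b ?J"
    have "?f \<noteq> 0" and le: "lead_exp (power_prod b K) = lead_exp ?f \<or>
        grevlex_less (lead_exp (power_prod b K)) (lead_exp ?f)"
      using subduction_keys[of b, OF b_nonzero R K] by auto
    moreover have "Const a * power_prod b ?J \<noteq> 0" using nz[of ?J] a by (simp del: power_prod_single)
    from lead_exp_cancel[OF nz this LT \<open>?f \<noteq> 0\<close>]
    have "grevlex_less (lead_exp ?f) (lead_exp (power_prod b ?I))" .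
    ultimately have less: "grevlex_less (lead_exp (power_prod b K)) (lead_exp (power_prod b ?I))"
      using grevlex_trans[of "lead_exp (power_prod b K)" "lead_exp ?f"] le by auto
    have tot: "total_deg (lead_exp (power_prod b L)) = weight L" for L
      using homogeneous_power_prod_b[of L] lead_exp_in_keys[OF nz[of L]] by (auto simp: homogeneous_def)
    have wsum: "weight L = (\<Sum>i\<in>UNIV. deg_b i * lookup L i)" for L
      unfolding weight_def by (intro sum.mono_neutral_left) (auto simp: in_keys_iff)
    have "weight K \<le> weight ?I" using grevlex_total_deg[OF less] by (simp only: tot)
    then have w: "lookup K 1 + p * lookup K 2 + (p ^ 3 + 1) * lookup K 3 + p ^ 4 * lookup K 4 \<le> (p ^ 3 + 1) * p"
      by (simp add: wsum sum_4 deg_b_def lookup_single)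
    show "K \<in> std"
    proof (rule ccontr)
      assume "K \<notin> std"
      then have "p \<le> lookup K 3" by (simp add: std_def)
      then have "(p ^ 3 + 1) * p \<le> (p ^ 3 + 1) * lookup K 3" by (intro mult_le_mono2)
      with w have "lookup K 1 = 0" "p * lookup K 2 = 0" "(p ^ 3 + 1) * lookup K 3 = (p ^ 3 + 1) * p" "p ^ 4 * lookup K 4 = 0"
        by linarith+
      moreover from this(3) have "lookup K 3 = p" by (subst (asm) mult_left_cancel) auto
      ultimately have "lookup K 1 = 0" "lookup K 2 = 0" "lookup K 3 = p" "lookup K 4 = 0"
        using p_gt by auto
      then have "K = ?I"
      proof (intro poly_mapping_eqI)
        fix i show "lookup K i = lookup ?I i"
          using \<open>lookup K 1 = 0\<close> \<open>lookup K 2 = 0\<close> \<open>lookup K 3 = p\<close> \<open>lookup K 4 = 0\<close> exhaust_4[of i]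
          by (auto simp: lookup_single)
      qed
      then show False using less grevlex_irrefl by blast
    qed
  qed
  then have "keys (single ?J a + R) \<subseteq> std"
    using p_gt by (intro std_add) (auto simp: std_def lookup_single)
  moreover have "r = single ?I 1 - (single ?J a + R)" by (simp add: r)
  moreover have "subst b r = 0"
    using subduction_subst[OF R] by (simp add: r subst_hom subst_single Const_1)
  ultimately show ?thesis using that by blast
qed

text \<open>
  The difference of the two products of the tete-a-tete is an invariant, hence a combination of standard
  products and as such subducts to zero.
\<close>

lemma hypersurface:
  "hypersurface_from_tete_a_tete b (single 3 p) (single 2 (p ^ 3 + 1)) ring"
  unfolding hypersurface_from_tete_a_tete_def
proof (intro conjI allI impI)
  let ?I = "single 3 p :: 4 monomial" and ?J = "single 2 (p ^ 3 + 1) :: 4 monomial"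
  have "b i \<in> ring" for i using inv by (auto simp: ring_def)
  then show "range (subst b) = ring"
    using subalgebra_subst[of ring b, OF subalgebra_ring] invariant_standard by (fastforce simp: ring_def)
  have eq: "lead_exp (power_prod b ?I) = lead_exp (power_prod b ?J)"
  proof (rule poly_mapping_eqI)
    fix v show "lookup (lead_exp (power_prod b ?I)) v = lookup (lead_exp (power_prod b ?J)) v"
      by (cases v) (simp_all only: lookup_lead_power_prod, simp_all add: lookup_single)
  qed
  then show "tete_a_tete b ?I ?J" by (simp add: tete_a_tete_def LM_def monom_prod_eq)
  have nz: "power_prod b K \<noteq> 0" for K by (rule power_prod_nonzero[of b, OF b_nonzero])
  define a where "a = lookup (power_prod b ?I) (lead_exp (power_prod b ?I)) / lookup (power_prod b ?J) (lead_exp (power_prod b ?J))"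
  have a: "a \<noteq> 0" unfolding a_def using lead_coeff_neq_0[OF nz[of ?I]] lead_coeff_neq_0[OF nz[of ?J]] by simp
  have LT: "LT (power_prod b ?I) = LT (Const a * power_prod b ?J)"
    using a lead_coeff_neq_0[OF nz[of ?J]] by (simp add: LT_def lead_exp_Const_mult lookup_Const_mult eq a_def del: power_prod_single)
  let ?f = "power_prod b ?I - Const a * power_prod b ?J"
  have "?f = subst b (single ?I 1 - single ?J a)" by (simp add: subst_hom subst_single Const_1)
  then have "?f \<in> ring" using subalgebra_subst[of ring b, OF subalgebra_ring] inv by (auto simp: ring_def)
  then have "act u ?f = ?f" if "u \<in> G" for u using that unfolding ring_def by blast
  from invariant_standard[of ?f, OF this] obtain q where "keys q \<subseteq> std" "subst b q = ?f" by blast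
  then have "subduction b ?f q" using subduction_standard[of b, OF b_nonzero inj_lead] by metis
  then show "\<exists>r. subduction_relation b ?I ?J r"
    unfolding subduction_relation_def monom_prod_eq using LT by blast
  fix r assume "subduction_relation b ?I ?J r"
  then obtain s where s: "r = single ?I 1 - s" "keys s \<subseteq> std" "subst b r = 0"
    by (rule subduction_relation_standard)
  have "{q. subst b q = 0} = {r * h |h. True}"
    by (rule relations_principal[of b 3 p r s, OF b_nonzero inj_lead[unfolded std_def] s(1) _ s(3)])
      (use s(2) in \<open>auto simp: std_def\<close>)
  then show "{q. subst b q = 0} = {r * q |q. True}" .
qed

end

section \<open>Minors\<close>

lemma vector_4 [simp]:
  "(vector [a, b, c, d] :: 'x::zero ^ 4) $ 1 = a" "(vector [a, b, c, d] :: 'x ^ 4) $ 2 = b"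
  "(vector [a, b, c, d] :: 'x ^ 4) $ 3 = c" "(vector [a, b, c, d] :: 'x ^ 4) $ 4 = d"
  unfolding vector_def by simp_all
lemma det_4:
  "det (A :: 'a::comm_ring_1 ^ 4 ^ 4) =
    A$1$1 * A$2$2 * A$3$3 * A$4$4 + A$1$1 * A$2$3 * A$3$4 * A$4$2 + A$1$1 * A$2$4 * A$3$2 * A$4$3
     + A$1$2 * A$2$1 * A$3$4 * A$4$3 + A$1$2 * A$2$3 * A$3$1 * A$4$4 + A$1$2 * A$2$4 * A$3$3 * A$4$1
     + A$1$3 * A$2$1 * A$3$2 * A$4$4 + A$1$3 * A$2$2 * A$3$4 * A$4$1 + A$1$3 * A$2$4 * A$3$1 * A$4$2
     + A$1$4 * A$2$1 * A$3$3 * A$4$2 + A$1$4 * A$2$2 * A$3$1 * A$4$3 + A$1$4 * A$2$3 * A$3$2 * A$4$1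
     - A$1$1 * A$2$2 * A$3$4 * A$4$3 - A$1$1 * A$2$3 * A$3$2 * A$4$4 - A$1$1 * A$2$4 * A$3$3 * A$4$2
     - A$1$2 * A$2$1 * A$3$3 * A$4$4 - A$1$2 * A$2$3 * A$3$4 * A$4$1 - A$1$2 * A$2$4 * A$3$1 * A$4$3
     - A$1$3 * A$2$1 * A$3$4 * A$4$2 - A$1$3 * A$2$2 * A$3$1 * A$4$4 - A$1$3 * A$2$4 * A$3$2 * A$4$1
     - A$1$4 * A$2$1 * A$3$2 * A$4$3 - A$1$4 * A$2$2 * A$3$3 * A$4$1 - A$1$4 * A$2$3 * A$3$1 * A$4$2"
proof -
  have f: "finite {2::4, 3, 4}" "1 \<notin> {2::4, 3, 4}" "finite {3::4, 4}" "2 \<notin> {3::4, 4}" "finite {4::4}" "3 \<notin> {4::4}"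
    by auto
  show ?thesis
    unfolding det_def UNIV_4
    unfolding sum_over_permutations_insert[OF f(1,2)]
    unfolding sum_over_permutations_insert[OF f(3,4)]
    unfolding sum_over_permutations_insert[OF f(5,6)]
    unfolding permutes_sing
    by (simp add: sign_swap_id permutation_swap_id permutation_compose sign_compose sign_id swap_id_eq)
qed
text \<open>
  Cramer's rule: the linear relation between five vectors in four-dimensional space.
\<close>

lemma minors_relation:
  fixes a b c d e :: "'a::comm_ring_1 ^ 4"
  shows "det (vector [b, c, d, e] :: 'a ^ 4 ^ 4) * a $ j - det (vector [a, c, d, e] :: 'a ^ 4 ^ 4) * b $ j
    + det (vector [a, b, d, e] :: 'a ^ 4 ^ 4) * c $ j - det (vector [a, b, c, e] :: 'a ^ 4 ^ 4) * d $ j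
    + det (vector [a, b, c, d] :: 'a ^ 4 ^ 4) * e $ j = 0"
  unfolding det_4 vector_4 using exhaust_4[of j] by (elim disjE) (simp_all add: algebra_simps)

text \<open>
  Row \<open>i\<close> of the matrix of minors is the Frobenius power number \<open>row_frob i\<close> of a row of \<open>M\<close>.
\<close>

definition row_frob :: "nat \<Rightarrow> nat" where "row_frob i = (i - (if odd i then 1 else 2)) div 2"

text \<open>
  Frobenius powers are additive and fix the prime field, hence commute with combinations over it.
\<close>

lemma Gamma_row_dot:
  fixes M :: "'a::field ^ 4 ^ 2"
  assumes p: "prime p" "CHAR('a) = p" and c: "c \<in> prime_vectors"
  shows "(\<Sum>j\<in>UNIV. Gamma_row p M i $ j * c $ j) = ((M *v c) $ (if odd i then 1 else 2)) ^ (p ^ row_frob i)"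
proof -
  have "c $ j ^ (p ^ k) = c $ j" for j k
    using prime_field_power_CHAR[of "c $ j" k] p c by auto
  then show ?thesis
    using p by (auto simp: Gamma_row_def row_frob_def matrix_vector_mult_def freshmans_dream_sum'[OF _ refl] power_mult_distrib)
qed

text \<open>
  If \<open>M *v c\<close> vanishes, so do the products of \<open>c\<close> with all four rows of the invertible matrix whose
  determinant is \<open>gamma p M 1 2 4 6\<close>.
\<close>

lemma act_vector_eq_0:
  fixes M :: "'a::field ^ 4 ^ 2"
  assumes p: "prime p" "CHAR('a) = p" and c: "c \<in> prime_vectors"
    and g: "gamma p M 1 2 4 6 \<noteq> 0" and 0: "M *v c = 0"
  shows "c = 0"
proof -
  let ?A = "vector [Gamma_row p M 1, Gamma_row p M 2, Gamma_row p M 4, Gamma_row p M 6] :: 'a ^ 4 ^ 4"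
  have p0: "p > 0" using p prime_gt_0_nat by blast
  have "(\<Sum>j\<in>UNIV. Gamma_row p M i $ j * c $ j) = 0" for i
    unfolding Gamma_row_dot[OF p c] using 0 p0 by simp
  then have "?A *v c = 0"
    by (simp add: vec_eq_iff matrix_vector_mult_def forall_4)
  moreover have "invertible ?A" using g by (simp add: invertible_det_nz gamma_def)
  ultimately show ?thesis
    by (metis invertible_def matrix_left_invertible_ker)
qed

text \<open>
  The minors in \<open>f12468\<close> are the coefficients of a linear relation between the rows, hence of an additive
  relation for the vectors by which the group acts; this is why \<open>f12468\<close> is invariant.
\<close>

lemma minors_additive:
  fixes M :: "'a::field ^ 4 ^ 2"
  assumes p: "prime p" "CHAR('a) = p" and u: "u \<in> act_group M"
  shows "gamma p M 2 4 6 8 * u $ 1 - gamma p M 1 4 6 8 * u $ 2 + gamma p M 1 2 6 8 * u $ 2 ^ p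
    - gamma p M 1 2 4 8 * u $ 2 ^ p\<^sup>2 + gamma p M 1 2 4 6 * u $ 2 ^ p ^ 3 = 0"
proof -
  obtain c where c: "u = M *v c" "c \<in> prime_vectors" using u by (auto simp: act_group_def)
  let ?r = "Gamma_row p M"
  have dot: "u $ (if odd i then 1 else 2) ^ (p ^ row_frob i) = (\<Sum>j\<in>UNIV. ?r i $ j * c $ j)" for i
    unfolding c(1) by (rule Gamma_row_dot[OF p c(2), symmetric])
  have "gamma p M 2 4 6 8 * u $ 1 - gamma p M 1 4 6 8 * u $ 2 + gamma p M 1 2 6 8 * u $ 2 ^ p
      - gamma p M 1 2 4 8 * u $ 2 ^ p\<^sup>2 + gamma p M 1 2 4 6 * u $ 2 ^ p ^ 3 =
    (\<Sum>j\<in>UNIV. (gamma p M 2 4 6 8 * ?r 1 $ j - gamma p M 1 4 6 8 * ?r 2 $ j + gamma p M 1 2 6 8 * ?r 4 $ j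
      - gamma p M 1 2 4 8 * ?r 6 $ j + gamma p M 1 2 4 6 * ?r 8 $ j) * c $ j)"
    using dot[of 1] dot[of 2] dot[of 4] dot[of 6] dot[of 8]
    by (simp add: row_frob_def sum.distrib sum_subtractf sum_distrib_left distrib_right left_diff_distrib mult.assoc)
  also have "\<dots> = 0"
    unfolding gamma_def minors_relation by simp
  finally show ?thesis .
qed

section \<open>The generators for a matrix in normal form\<close>

locale normal_matrix =
  fixes p :: nat and M :: "'a::field ^ 4 ^ 2"
  assumes p: "prime p" "CHAR('a) = p" "p > 2"
    and M: "normal_form M" and gamma: "gamma p M 1 2 4 6 \<noteq> 0"
begin

lemma p_pos: "p > 0" "CHAR('a) > 0"
  using p by auto

lemma two_neq_0: "(2 :: 'a) \<noteq> 0"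
  using of_nat_eq_0_iff_char_dvd[of 2, where 'a = 'a] p by (auto dest: dvd_imp_le)

definition W :: "'a set" where "W = (\<lambda>u. u $ 2) ` act_group M"

lemma act_vector: "(M *v c) $ 1 = c $ 1" "(M *v c) $ 2 = M $ 2 $ 2 * c $ 2 + M $ 2 $ 3 * c $ 3 + M $ 2 $ 4 * c $ 4"
  using M by (auto simp: normal_form_def matrix_vector_mult_def sum_4)

lemma act_group_eq: "act_group M = {u. u $ 1 \<in> prime_field \<and> u $ 2 \<in> W}"
proof (intro equalityI subsetI)
  fix u assume "u \<in> act_group M"
  then show "u \<in> {u. u $ 1 \<in> prime_field \<and> u $ 2 \<in> W}" by (auto simp: W_def act_group_def act_vector)
next
  fix u :: "'a ^ 2" assume "u \<in> {u. u $ 1 \<in> prime_field \<and> u $ 2 \<in> W}"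
  then obtain c where c: "u $ 1 \<in> prime_field" "\<forall>j. c $ j \<in> prime_field" "u $ 2 = (M *v c) $ 2"
    by (auto simp: W_def act_group_def)
  let ?d = "\<chi> j. if j = 1 then u $ 1 else c $ j"
  have "u = M *v ?d" by (simp add: vec_eq_iff forall_2 act_vector c(3))
  moreover have "\<forall>j. ?d $ j \<in> prime_field" using c by auto
  ultimately show "u \<in> act_group M" unfolding act_group_def by blast
qed

lemma card_act_group: "card (act_group M) = p ^ 4"
proof -
  have "inj_on (\<lambda>c. M *v c) prime_vectors"
  proof (rule inj_onI)
    fix c d assume cd: "c \<in> prime_vectors" "d \<in> prime_vectors" "M *v c = M *v d"
    then have "c - d = 0"
      using p gamma by (intro act_vector_eq_0[of p "c - d" M])
        (auto simp: matrix_vector_mult_diff_distrib intro: prime_field_closed)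
    then show "c = d" by simp
  qed
  then show ?thesis using card_prime_vectors[OF p_pos(2), where 'n = 4] p by (simp add: act_group_def card_image)
qed

text \<open>
  The group has \<open>p^4\<close> elements and is the product of the prime field and \<open>W\<close>.
\<close>

lemma W_props: "finite W" "0 \<in> W" "\<And>u v. u \<in> W \<Longrightarrow> v \<in> W \<Longrightarrow> u - v \<in> W" "card W = p ^ 3"
proof -
  show fin: "finite W" using finite_act_group[of M] p_pos by (simp add: W_def)
  have "0 \<in> act_group M" unfolding act_group_def by (rule image_eqI[of _ _ 0]) (auto simp: prime_field_closed)
  then show "0 \<in> W" unfolding W_def by (rule rev_image_eqI) simp
  show "u - v \<in> W" if "u \<in> W" "v \<in> W" for u v
    using that act_group_diff[of _ M] unfolding W_def by (metis (no_types, lifting) image_iff vector_minus_component)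
  have "bij_betw (\<lambda>u. (u $ 1, u $ 2)) (act_group M) (prime_field \<times> W)"
    by (rule bij_betwI[of _ _ _ "\<lambda>(a, b). vector [a, b]"]) (auto simp: act_group_eq vec_eq_iff forall_2)
  from bij_betw_same_card[OF this] have "p ^ 4 = p * card W"
    using p p_pos by (simp add: card_act_group card_prime_field card_cartesian_product)
  then show "card W = p ^ 3" using p_pos by (simp add: power_numeral_reduce)
qed

sublocale product_translations p W
  using p W_props by unfold_locales auto

lemma G_eq: "G = act_group M"
  by (simp add: G_def act_group_eq)

lemma invariants_normal: "invariants p M = {f. \<forall>u\<in>G. act u f = f}"
  using p p_pos by (simp add: invariants_eq G_eq)

text \<open>
  The explicit form of the orbit product of \<open>y\<close>.
\<close>

definition NY :: "(coord, 'a) mpoly" where "NY = y_poly ^ p - y_poly * x_poly ^ (p - 1)"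

lemma orbit_prod_y: "orbit_prod p M y_poly = NY"
proof -
  have "orbit p M y_poly = (\<lambda>a. y_poly + Const a * x_poly) ` prime_field"
  proof -
    have "(\<lambda>u. u $ 1) ` G = prime_field"
    proof (intro equalityI subsetI)
      fix a :: 'a assume "a \<in> prime_field"
      then show "a \<in> (\<lambda>u. u $ 1) ` G"
        using W_props(2) by (intro image_eqI[of _ _ "vector [a, 0]"]) (auto simp: G_def)
    qed (auto simp: G_def)
    moreover have "orbit p M y_poly = (\<lambda>a. y_poly + Const a * x_poly) ` ((\<lambda>u. u $ 1) ` G)"
      using p p_pos by (simp add: orbit_eq G_eq[symmetric] act_simps image_image)
    ultimately show ?thesis by simp
  qed
  moreover have "inj_on (\<lambda>a. y_poly + Const a * x_poly) (prime_field :: 'a set)"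
    by (rule inj_onI, drule arg_cong[of _ _ dehom]) (simp add: dehom_hom dehom_simps)
  ultimately have "orbit_prod p M y_poly = (\<Prod>a\<in>prime_field. y_poly + Const a * x_poly)"
    unfolding orbit_prod_def by (simp only: prod.reindex comp_def)
  also have "\<dots> = NY"
  proof -
    have "dehom x_poly \<noteq> (dehom 0 :: 'a poly poly)" by (simp add: dehom_simps dehom_hom)
    then have "x_poly \<noteq> (0 :: (coord, 'a) mpoly)" by metis
    moreover have "prime CHAR('a)" using p by simp
    ultimately show ?thesis
      using prod_prime_field[of "Const :: 'a \<Rightarrow> (coord, 'a) mpoly" x_poly y_poly] ring_map_Const p(2) by (simp add: NY_def)
  qed
  finally show ?thesis .
qed

definition NZ :: "(coord, 'a) mpoly" where
  "NZ = (\<Prod>u\<in>G. act u z_poly)"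

lemma orbit_prod_z: "orbit_prod p M z_poly = NZ"
proof -
  have "inj_on (\<lambda>u. act u z_poly) G"
  proof (rule inj_onI)
    fix u w :: "'a ^ 2" assume "act u z_poly = act w z_poly"
    then have "dehom (act u z_poly) = dehom (act w z_poly)" by simp
    then have "2 * u $ 1 = 2 * w $ 1" "(u $ 1)\<^sup>2 + u $ 2 = (w $ 1)\<^sup>2 + w $ 2"
      by (simp_all add: act_simps dehom_hom dehom_simps)
    then show "u = w" using two_neq_0 by (simp add: vec_eq_iff forall_2)
  qed
  then show ?thesis
    using p p_pos by (simp add: orbit_prod_def orbit_eq G_eq[symmetric] NZ_def prod.reindex)
qed

lemma homogeneous_act_z:
  fixes u :: "'a ^ 2"
  shows "homogeneous 1 (act u z_poly)"
  unfolding act_simps by (intro homogeneous_add homogeneous_Const_mult homogeneous_Var)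

lemma lead_act_z:
  fixes u :: "'a ^ 2"
  shows "act u z_poly \<noteq> 0" "lead_exp (act u z_poly) = single CZ 1"
proof -
  let ?f = "act u (z_poly :: (coord, 'a) mpoly)"
  have eq: "?f = single (single CZ 1) 1 + single (single CY 1) (2 * u $ 1) + single (single CX 1) ((u $ 1)\<^sup>2 + u $ 2)"
    unfolding act_simps by (simp add: Var_def Const_def mult_single)
  have neq: "single CZ (Suc 0) \<noteq> single CY (Suc 0)" "single CZ (Suc 0) \<noteq> single CX (Suc 0)"
    by (auto dest: arg_cong[of _ _ "\<lambda>m. lookup m CZ"] simp: lookup_single)
  then have in_keys: "single CZ 1 \<in> keys ?f"
    by (simp add: eq in_keys_iff lookup_add lookup_single when_def)
  have sub: "keys ?f \<subseteq> {single CZ 1, single CY 1, single CX 1}"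
    by (auto simp: eq in_keys_iff lookup_add lookup_single when_def split: if_splits)
  have "grevlex_less (single CY 1) (single CZ 1)" "grevlex_less (single CX 1) (single CZ 1)"
    unfolding grevlex_less_def
    by (auto intro!: exI[of _ CY] exI[of _ CX] simp: lookup_single less_coord_def less_eq_coord_def when_def)
  then show "lead_exp ?f = single CZ 1"
    using sub by (intro lead_exp_eqI in_keys) auto
  show "?f \<noteq> 0" using in_keys by auto
qed

lemma card_G: "card G = p ^ 4" "finite G"
  using card_act_group finite_act_group[of M] p_pos by (simp_all add: G_eq)

lemma NZ_props: "NZ \<noteq> 0" "homogeneous (p ^ 4) NZ" "lead_exp NZ = single CZ (p ^ 4)"
  "degree (dehom NZ) = p ^ 4" "lead_coeff (dehom NZ) = 1"
proof -
  show "NZ \<noteq> 0" using lead_act_z card_G by (simp add: NZ_def)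
  have "homogeneous (\<Sum>u\<in>G. 1) NZ"
    unfolding NZ_def by (intro homogeneous_prod homogeneous_act_z)
  then show "homogeneous (p ^ 4) NZ" by (simp add: card_G)
  show "lead_exp NZ = single CZ (p ^ 4)"
    unfolding NZ_def by (rule poly_mapping_eqI)
      (simp add: lead_exp_prod lead_act_z lookup_sum lookup_single card_G when_def)
  have lin: "dehom (act u z_poly) = [:[:(u $ 1)\<^sup>2 + u $ 2, 2 * u $ 1:], 1:]" for u :: "'a ^ 2"
    by (simp add: act_simps dehom_hom dehom_simps)
  have eq: "dehom NZ = (\<Prod>u\<in>G. [:[:(u $ 1)\<^sup>2 + u $ 2, 2 * u $ 1:], 1:])"
    by (simp add: NZ_def ring_map_prod[OF ring_map_dehom] lin)
  show "degree (dehom NZ) = p ^ 4" unfolding eq by (simp add: degree_prod_sum_eq card_G)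
  show "lead_coeff (dehom NZ) = 1" unfolding eq lead_coeff_prod by simp
qed

lemma orbit_prod_G: "u \<in> G \<Longrightarrow> act u (orbit_prod p M f) = orbit_prod p M f"
  using orbit_prod_invariant[of p M f] p p_pos by (auto simp: invariants_normal)

lemma frobenius_mpoly:
  fixes f g :: "(coord, 'a) mpoly"
  shows "(f + g) ^ (p ^ k) = f ^ (p ^ k) + g ^ (p ^ k)" "(f - g) ^ (p ^ k) = f ^ (p ^ k) - g ^ (p ^ k)"
proof -
  have *: "(f + g) ^ (p ^ k) = f ^ (p ^ k) + g ^ (p ^ k)" for f g :: "(coord, 'a) mpoly"
    using p by (intro freshmans_dream') (simp_all add: CHAR_mpoly)
  then show "(f + g) ^ (p ^ k) = f ^ (p ^ k) + g ^ (p ^ k)" .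
  show "(f - g) ^ (p ^ k) = f ^ (p ^ k) - g ^ (p ^ k)" using *[of "f - g" g] by simp
qed

text \<open>
  The shift of \<open>y\<close> cancels in \<open>\<delta>\<close>; this is the reason for using \<open>\<delta>\<close>.
\<close>

lemma act_delta:
  fixes u :: "'a ^ 2"
  shows "act u delta = delta - Const (u $ 2) * x_poly ^ 2"
  by (simp add: delta_def act_hom act_simps Const_add Const_mult power2_eq_square algebra_simps)
    (simp add: Const_def single_numeral flip: mult_single distrib_right)

lemma act_delta_power:
  fixes u :: "'a ^ 2"
  shows "act u (delta ^ (p ^ k)) = delta ^ (p ^ k) - Const (u $ 2 ^ (p ^ k)) * x_poly ^ (2 * p ^ k)"
  by (simp add: act_hom act_delta frobenius_mpoly power_mult_distrib ring_mapD[OF ring_map_Const] flip: power_mult)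

end

section \<open>The invariant with lead monomial \<open>y^(p^3+1)\<close>\<close>

text \<open>
  Among the monomials of a fixed degree those without \<open>x\<close> are the largest.
\<close>

lemma lead_exp_power_add_x_multiple:
  fixes U :: "(coord, 'a::field) mpoly"
  assumes "homogeneous d (y_poly ^ d + x_poly * U)"
  shows "y_poly ^ d + x_poly * U \<noteq> 0" "lead_exp (y_poly ^ d + x_poly * U) = single CY d"
proof -
  let ?f = "y_poly ^ d + x_poly * U"
  have y: "y_poly ^ d = single (single CY d) (1 :: 'a)"
    using power_prod_Var[of "single CY d", where 'a = 'a] by simp
  have x: "lookup m CX > 0" if "m \<in> keys (x_poly * U)" for m
    using that keys_mult[of x_poly U] by (auto simp: Var_def lookup_add split: if_splits)
  have "single CY d \<notin> keys (x_poly * U)" using x[of "single CY d"] by (auto simp: lookup_single)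
  then have in_keys: "single CY d \<in> keys ?f" by (simp add: y in_keys_iff lookup_add)
  then show "?f \<noteq> 0" by auto
  show "lead_exp ?f = single CY d"
  proof (rule lead_exp_eqI[OF in_keys])
    fix n assume n: "n \<in> keys ?f" "n \<noteq> single CY d"
    then have "n \<in> keys (x_poly * U)" using keys_add[of "y_poly ^ d" "x_poly * U"] by (auto simp: y)
    then have "lookup n CX > 0" by (rule x)
    moreover have "total_deg n = d" using assms n(1) by (simp add: homogeneous_def)
    moreover have "\<not> v < CX" for v by (cases v) (simp_all add: less_coord_def less_eq_coord_def)
    ultimately show "grevlex_less n (single CY d)"
      unfolding grevlex_less_def by (intro disjI2 conjI exI[of _ CX]) (auto simp: lookup_single)
  qed
qed

context normal_matrix
begin

abbreviation "g0 \<equiv> gamma p M 1 2 4 6"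
abbreviation "g1 \<equiv> gamma p M 1 2 4 8"
abbreviation "g2 \<equiv> gamma p M 1 2 6 8"
abbreviation "g3 \<equiv> gamma p M 1 4 6 8"

lemma gamma_2468: "gamma p M 2 4 6 8 = 0"
  using M p_pos by (auto simp: gamma_def det_4 Gamma_row_def normal_form_def power_0_left)

definition delta_term :: "nat \<Rightarrow> (coord, 'a) mpoly" where
  "delta_term k = delta ^ (p ^ k) * x_poly ^ (2 * p ^ 3 - 2 * p ^ k)"

lemma f12468_eq: "f12468 p M = - Const g0 * delta_term 3 + Const g1 * delta_term 2
    - Const g2 * delta_term 1 + Const g3 * delta_term 0"
  by (simp add: f12468_def delta_term_def gamma_2468 mult.assoc del: power_0 flip: power_0[of p])
    (simp add: Const_def)

lemma act_delta_term:
  fixes u :: "'a ^ 2"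
  assumes "k \<le> 3"
  shows "act u (delta_term k) = delta_term k - Const (u $ 2 ^ (p ^ k)) * x_poly ^ (2 * p ^ 3)"
proof -
  have "p ^ k \<le> p ^ 3" using assms p_pos by (intro power_increasing) auto
  then have "x_poly ^ (2 * p ^ k) * x_poly ^ (2 * p ^ 3 - 2 * p ^ k) = (x_poly ^ (2 * p ^ 3) :: (coord, 'a) mpoly)"
    by (simp flip: power_add)
  then show ?thesis
    by (simp add: delta_term_def act_hom(3) act_delta_power left_diff_distrib mult.assoc)
      (simp add: act_hom act_simps)
qed

text \<open>
  By \<open>act_delta_term\<close> the group element changes \<open>f12468\<close> by \<open>x^(2p^3)\<close> times the expression in
  \<open>minors_additive\<close>, which vanishes.
\<close>

lemma act_f12468:
  assumes "u \<in> G"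
  shows "act u (f12468 p M) = f12468 p M"
proof -
  have "- g3 * u $ 2 + g2 * u $ 2 ^ p - g1 * u $ 2 ^ p\<^sup>2 + g0 * u $ 2 ^ p ^ 3 = 0"
    using minors_additive[of p u M] p assms by (simp add: G_eq gamma_2468)
  then have "Const (- g3 * u $ 2 + g2 * u $ 2 ^ p - g1 * u $ 2 ^ p\<^sup>2 + g0 * u $ 2 ^ p ^ 3) * x_poly ^ (2 * p ^ 3)
      = (0 :: (coord, 'a) mpoly)" by simp
  moreover have "act u (f12468 p M) = f12468 p M + Const (- g3 * u $ 2 + g2 * u $ 2 ^ p - g1 * u $ 2 ^ p\<^sup>2 + g0 * u $ 2 ^ p ^ 3) * x_poly ^ (2 * p ^ 3)"
    unfolding f12468_eq
    by (simp add: act_hom(2,3,5,6) act_simps act_delta_term ring_mapD(2,3,5,6)[OF ring_map_Const])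
      (simp add: algebra_simps)
  ultimately show ?thesis by simp
qed

lemma act_h1_tilde:
  assumes "u \<in> G"
  shows "act u (h1_tilde p M) = h1_tilde p M"
proof -
  have "act u 2 = 2" using act_hom(2)[of u 1 1] by (simp add: act_hom)
  moreover have "act u (orbit_prod p M y_poly) = orbit_prod p M y_poly" by (rule orbit_prod_G[OF assms])
  ultimately show ?thesis
    by (simp add: h1_tilde_def Let_def act_hom act_simps act_f12468[OF assms])
qed

text \<open>
  The powers of \<open>x\<close> in \<open>NY\<close>, \<open>NY^p\<close> and \<open>NY^(p^2)\<close> are called \<open>xE\<close>, \<open>xB\<close> and \<open>xA\<close>.  Apart from the
  term of \<open>f12468\<close> whose coefficient is zero, all powers of \<open>x\<close> in \<open>h1_tilde\<close> are products of them, and \<open>xR\<close> measures by how much \<open>xA\<close> exceeds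
  \<open>x xB xE\<close>; with these names the computation of \<open>h1\<close> is an identity of polynomials without
  exponents that depend on \<open>p\<close>.
\<close>

definition "xE = (x_poly :: (coord, 'a) mpoly) ^ (p - 1)"
definition "xB = (x_poly :: (coord, 'a) mpoly) ^ (p\<^sup>2 - p)"
definition "xA = (x_poly :: (coord, 'a) mpoly) ^ (p ^ 3 - p\<^sup>2)"
definition "xR = (x_poly :: (coord, 'a) mpoly) ^ (p ^ 3 - 2 * p\<^sup>2)"

lemma p_powers: "2 \<le> p" "p \<le> p\<^sup>2" "2 * p\<^sup>2 \<le> p ^ 3"
proof -
  show "2 \<le> p" using p by simp
  then have "2 * p\<^sup>2 \<le> p * p\<^sup>2" by (rule mult_le_mono1)
  then show "2 * p\<^sup>2 \<le> p ^ 3" by (simp add: power_numeral_reduce)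
  show "p \<le> p\<^sup>2" by (simp add: power2_eq_square)
qed

text \<open>
  The quotient that defines \<open>h1\<close> is \<open>y^(p^3+1)\<close> plus \<open>x\<close> times this polynomial.
\<close>

definition H_tail :: "(coord, 'a) mpoly" where
  "H_tail = Const (- (1 / 2)) * z_poly ^ (p ^ 3) + Const (- g1 / (2 * g0)) * (xR * delta ^ (p\<^sup>2))
    + Const (g2 / (2 * g0)) * (xR * xB\<^sup>2 * delta ^ p) + Const (- g3 / (2 * g0)) * (xR * xB\<^sup>2 * xE\<^sup>2 * delta)
    + Const (1 / 2) * (xR * (y_poly ^ p\<^sup>2)\<^sup>2) - y_poly * y_poly ^ p\<^sup>2 * (xR * xB * xE)"

definition H :: "(coord, 'a) mpoly" where
  "H = y_poly ^ (p ^ 3 + 1) + x_poly * H_tail"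

lemma xA_eq: "xA = xB * xE * x_poly * xR"
proof -
  have "p ^ 3 - p\<^sup>2 = (p\<^sup>2 - p) + (p - 1) + 1 + (p ^ 3 - 2 * p\<^sup>2)" using p_powers by linarith
  then show ?thesis by (simp only: xA_def xB_def xE_def xR_def power_add power_one_right)
qed

lemma x_power_eqs:
  "x_poly ^ (2 * p ^ 3 - 2 * p ^ 2) = xA\<^sup>2" "x_poly ^ (2 * p ^ 3 - 2 * p) = (xA * xB)\<^sup>2"
  "x_poly ^ (2 * p ^ 3 - 2) = (xA * xB * xE)\<^sup>2" "x_poly ^ (p ^ 3 - p ^ 2) = xA"
  "x_poly ^ (p ^ 3 - p) = xA * xB" "x_poly ^ (p ^ 3 - 1) = xA * xB * xE"
  "x_poly ^ (p ^ 3) = x_poly * (xA * xB * xE)"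
proof -
  show a: "x_poly ^ (p ^ 3 - p ^ 2) = xA" by (simp add: xA_def)
  have "p ^ 3 - p = (p ^ 3 - p ^ 2) + (p ^ 2 - p)" using p_powers by linarith
  then show b: "x_poly ^ (p ^ 3 - p) = xA * xB" by (simp only: xA_def xB_def power_add)
  have "p ^ 3 - 1 = (p ^ 3 - p ^ 2) + (p ^ 2 - p) + (p - 1)" using p_powers by linarith
  then show c: "x_poly ^ (p ^ 3 - 1) = xA * xB * xE" by (simp only: xA_def xB_def xE_def power_add)
  have "p ^ 3 = 1 + (p ^ 3 - 1)" using p_powers by linarith
  then show "x_poly ^ (p ^ 3) = x_poly * (xA * xB * xE)" by (metis c power_add power_one_right)
  have "2 * p ^ 3 - 2 * p ^ 2 = (p ^ 3 - p ^ 2) * 2" "2 * p ^ 3 - 2 * p = (p ^ 3 - p) * 2"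
    "2 * p ^ 3 - 2 = (p ^ 3 - 1) * 2" by simp_all
  then show "x_poly ^ (2 * p ^ 3 - 2 * p ^ 2) = xA\<^sup>2" "x_poly ^ (2 * p ^ 3 - 2 * p) = (xA * xB)\<^sup>2"
    "x_poly ^ (2 * p ^ 3 - 2) = (xA * xB * xE)\<^sup>2"
    by (simp_all only: power_mult a b c)
qed

lemma NY_powers:
  "NY = y_poly ^ p - y_poly * xE"
  "NY ^ p = y_poly ^ p\<^sup>2 - y_poly ^ p * xB"
  "NY ^ p\<^sup>2 = y_poly ^ p ^ 3 - y_poly ^ p\<^sup>2 * xA"
proof -
  show "NY = y_poly ^ p - y_poly * xE" by (simp add: NY_def xE_def)
  have "(p - 1) * p = p\<^sup>2 - p" by (simp add: power2_eq_square diff_mult_distrib)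
  then show "NY ^ p = y_poly ^ p\<^sup>2 - y_poly ^ p * xB"
    using frobenius_mpoly(2)[of "y_poly ^ p" "y_poly * x_poly ^ (p - 1)" 1]
    by (simp add: NY_def xB_def power_mult_distrib power2_eq_square flip: power_mult)
  have "p * p\<^sup>2 = p ^ 3" "(p - 1) * p\<^sup>2 = p ^ 3 - p\<^sup>2"
    by (simp_all add: power_numeral_reduce diff_mult_distrib)
  then show "NY ^ p\<^sup>2 = y_poly ^ p ^ 3 - y_poly ^ p\<^sup>2 * xA"
    using frobenius_mpoly(2)[of "y_poly ^ p" "y_poly * x_poly ^ (p - 1)" 2]
    by (simp add: NY_def xA_def power_mult_distrib flip: power_mult)
qed

text \<open>
  The correction terms in \<open>h1_tilde\<close> are chosen such that the powers of \<open>y\<close> that are not divisible by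
  \<open>x^(p^3-1)\<close> cancel; \<open>xA = xB xE x xR\<close> makes the remaining terms divisible.
\<close>

lemma H_eq: "Const (2 * g0) * x_poly ^ (p ^ 3 - 1) * H = - h1_tilde p M"
proof -
  have C: "Const (2 * g0) * Const (- (1 / 2)) = (- Const g0 :: (coord, 'a) mpoly)"
    "Const (2 * g0) * Const (- g1 / (2 * g0)) = (- Const g1 :: (coord, 'a) mpoly)"
    "Const (2 * g0) * Const (g2 / (2 * g0)) = (Const g2 :: (coord, 'a) mpoly)"
    "Const (2 * g0) * Const (- g3 / (2 * g0)) = (- Const g3 :: (coord, 'a) mpoly)"
    "Const (2 * g0) * Const (1 / 2) = (Const g0 :: (coord, 'a) mpoly)"
    using two_neq_0 gamma by (simp_all flip: Const_mult ring_mapD(5)[OF ring_map_Const])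
  have C2: "Const (2 * g0) = (2 * Const g0 :: (coord, 'a) mpoly)"
    by (metis Const_add mult_2)
  have D: "delta ^ (p ^ 3) = (y_poly ^ p ^ 3)\<^sup>2 - x_poly * (xA * xB * xE) * z_poly ^ p ^ 3"
    by (simp add: delta_def frobenius_mpoly power_mult_distrib x_power_eqs flip: power_mult)
      (simp add: mult.commute)
  have tail: "Const (2 * g0) * H_tail = - Const g0 * z_poly ^ (p ^ 3) - Const g1 * (xR * delta ^ (p\<^sup>2))
    + Const g2 * (xR * xB\<^sup>2 * delta ^ p) - Const g3 * (xR * xB\<^sup>2 * xE\<^sup>2 * delta)
    + Const g0 * (xR * (y_poly ^ p\<^sup>2)\<^sup>2) - 2 * Const g0 * (y_poly * y_poly ^ p\<^sup>2 * (xR * xB * xE))"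
    unfolding H_tail_def by (simp only: distrib_left right_diff_distrib mult.assoc[symmetric] C) (simp add: C2 del: One_nat_def)
  have N: "NY ^ (2 * p ^ 2) = (NY ^ p\<^sup>2)\<^sup>2" "NY ^ (p ^ 2 + p) = NY ^ p\<^sup>2 * NY ^ p" "NY ^ (p ^ 2 + 1) = NY ^ p\<^sup>2 * NY"
    by (simp_all add: power_add mult.commute flip: power_mult)
  have ht: "h1_tilde p M = - Const g0 * ((y_poly ^ p ^ 3)\<^sup>2 - x_poly * (xA * xB * xE) * z_poly ^ p ^ 3)
      + Const g1 * delta ^ p\<^sup>2 * xA\<^sup>2 - Const g2 * delta ^ p * (xA * xB)\<^sup>2 + Const g3 * delta * (xA * xB * xE)\<^sup>2
      + Const g0 * ((NY ^ p\<^sup>2)\<^sup>2 + 2 * (NY ^ p\<^sup>2 * NY ^ p) * xA + 2 * (NY ^ p\<^sup>2 * NY) * (xA * xB))"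
    unfolding h1_tilde_def Let_def f12468_def orbit_prod_y gamma_2468 x_power_eqs D N
    by (simp add: Const_def)
  have "Const (2 * g0) * x_poly ^ (p ^ 3 - 1) * H =
      xA * xB * xE * (2 * Const g0 * (y_poly * y_poly ^ p ^ 3) + x_poly * (Const (2 * g0) * H_tail))"
    unfolding H_def x_power_eqs by (simp add: algebra_simps C2 power_add del: One_nat_def)
  also have "\<dots> = - h1_tilde p M"
    unfolding tail ht NY_powers(2,3) unfolding NY_powers(1) unfolding xA_eq by (simp add: algebra_simps power2_eq_square)
  finally show ?thesis .
qed

lemma h1_eq: "h1 p M = H"
  using two_neq_0 gamma H_eq by (rule h1_eqI)

lemma act_H:
  assumes "u \<in> G"
  shows "act u H = H"
proof -
  let ?c = "Const (2 * g0) * x_poly ^ (p ^ 3 - 1) :: (coord, 'a) mpoly"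
  have "?c * act u H = act u (?c * H)" by (simp add: act_hom act_simps)
  also have "\<dots> = - h1_tilde p M" unfolding H_eq by (simp add: act_hom act_h1_tilde[OF assms])
  also have "\<dots> = ?c * H" by (simp only: H_eq)
  finally have eq: "?c * act u H = ?c * H" .
  have "dehom ?c \<noteq> dehom 0" using two_neq_0 gamma by (simp add: dehom_hom dehom_simps)
  then have "?c \<noteq> 0" by metis
  then show ?thesis by (rule iffD1[OF mult_left_cancel eq])
qed

lemma homogeneous_delta_power: "homogeneous (2 * n) ((delta :: (coord, 'a) mpoly) ^ n)"
proof -
  have "homogeneous 2 (delta :: (coord, 'a) mpoly)"
    unfolding delta_def
    by (intro homogeneous_diff homogeneous_Var_power homogeneous_mult_eq[OF homogeneous_Var homogeneous_Var]) simp
  then show ?thesis by (rule homogeneous_power)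
qed

lemma homogeneous_H: "homogeneous (p ^ 3 + 1) H"
proof -
  have hx: "homogeneous (p ^ 3 - 2 * p\<^sup>2) xR" "homogeneous (p\<^sup>2 - p) xB" "homogeneous (p - 1) xE"
    unfolding xR_def xB_def xE_def by (rule homogeneous_Var_power)+
  have hx2: "homogeneous (2 * (p\<^sup>2 - p)) (xB\<^sup>2)" "homogeneous (2 * (p - 1)) (xE\<^sup>2)"
    using homogeneous_power[OF hx(2), of 2] homogeneous_power[OF hx(3), of 2] by (simp_all add: mult.commute)
  have hy: "homogeneous (2 * p\<^sup>2) ((y_poly ^ p\<^sup>2 :: (coord, 'a) mpoly)\<^sup>2)"
    using homogeneous_power[OF homogeneous_Var_power[of "p\<^sup>2" CY], of 2] by (simp add: mult.commute)
  note hd = homogeneous_delta_power[of "p\<^sup>2"] homogeneous_delta_power[of p] homogeneous_delta_power[of 1, simplified]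
  note hv = homogeneous_Var[where ?'b = 'a] homogeneous_Var_power
  have 2: "homogeneous (p ^ 3) (xR * delta ^ (p\<^sup>2))"
    by (rule homogeneous_mult_eq[OF hx(1) hd(1)]) (use p_powers in linarith)
  have 3: "homogeneous (p ^ 3) (xR * xB\<^sup>2 * delta ^ p)"
    by (rule homogeneous_mult_eq[OF homogeneous_mult[OF hx(1) hx2(1)] hd(2)]) (use p_powers in linarith)
  have 4: "homogeneous (p ^ 3) (xR * xB\<^sup>2 * xE\<^sup>2 * delta)"
    by (rule homogeneous_mult_eq[OF homogeneous_mult[OF homogeneous_mult[OF hx(1) hx2(1)] hx2(2)] hd(3)])
      (use p_powers in linarith)
  have 5: "homogeneous (p ^ 3) (xR * (y_poly ^ p\<^sup>2)\<^sup>2)"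
    by (rule homogeneous_mult_eq[OF hx(1) hy]) (use p_powers in linarith)
  have 6: "homogeneous (p ^ 3) (y_poly * y_poly ^ p\<^sup>2 * (xR * xB * xE))"
    by (rule homogeneous_mult_eq[OF homogeneous_mult[OF hv(1) hv(2)] homogeneous_mult[OF homogeneous_mult[OF hx(1,2)] hx(3)]])
      (use p_powers in linarith)
  have "homogeneous (p ^ 3) H_tail"
    unfolding H_tail_def
    by (intro homogeneous_diff homogeneous_add homogeneous_Const_mult 2 3 4 5 6 hv(2))
  then have "homogeneous (p ^ 3 + 1) (x_poly * H_tail)"
    by (intro homogeneous_mult_eq[OF homogeneous_Var]) auto
  then show ?thesis unfolding H_def by (intro homogeneous_add homogeneous_Var_power)
qed

text \<open>
  The only term of degree \<open>p^3\<close> in \<open>Z\<close> is \<open>- (1/2) x z^(p^3)\<close>, as \<open>\<delta>\<close> occurs with exponent at most \<open>p\<^sup>2\<close>.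
\<close>

lemma degree_dehom_H: "degree (dehom H) = p ^ 3" "lead_coeff (dehom H) = [:- (1 / 2):]"
proof -
  let ?Y = "[:[:0, 1:]:] :: 'a poly poly" and ?\<Delta> = "[:[:0, 0, 1:], - 1:] :: 'a poly poly"
  have dd: "dehom (delta :: (coord, 'a) mpoly) = ?\<Delta>"
    by (simp add: delta_def dehom_hom dehom_simps power2_eq_square)
  have dx: "dehom xR = 1" "dehom xB = 1" "dehom xE = 1"
    by (simp_all add: xR_def xB_def xE_def dehom_hom dehom_simps)
  define T where "T = ?Y ^ (p ^ 3 + 1) + ([:[:- g1 / (2 * g0):]:] * ?\<Delta> ^ p\<^sup>2 + [:[:g2 / (2 * g0):]:] * ?\<Delta> ^ p
    + [:[:- g3 / (2 * g0):]:] * ?\<Delta> + [:[:1 / 2:]:] * (?Y ^ p\<^sup>2)\<^sup>2 - ?Y * ?Y ^ p\<^sup>2)"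
  have eq: "dehom H = monom [:- (1 / 2):] (p ^ 3) + T"
    by (simp add: H_def H_tail_def T_def dehom_hom dehom_simps dd dx monom_altdef)
  have less: "0 < p ^ 3" "p\<^sup>2 < p ^ 3" "p < p ^ 3" "1 < p ^ 3"
    using p_powers by auto
  have \<Delta>: "degree (?\<Delta> ^ n) \<le> n" for n
    using degree_power_le[of ?\<Delta> n] by simp
  have Y: "degree (?Y ^ n) = 0" for n by (simp add: poly_const_pow)
  have cl: "degree ([:[:a:]:] * f) < p ^ 3" if "degree f < p ^ 3" for a :: 'a and f :: "'a poly poly"
    using that degree_smult_le[of "[:a:]" f] by simp
  have "degree T < p ^ 3"
    unfolding T_def
    by (intro degree_add_less degree_diff_less cl)
      (use less \<Delta>[of "p\<^sup>2"] \<Delta>[of p] in \<open>auto simp: Y poly_const_pow simp flip: power_mult\<close>)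
  moreover have "degree (monom [:- (1 / 2) :: 'a:] (p ^ 3)) = p ^ 3"
    using two_neq_0 by (simp add: degree_monom_eq)
  ultimately show deg: "degree (dehom H) = p ^ 3"
    unfolding eq by (subst degree_add_eq_left) simp_all
  show "lead_coeff (dehom H) = [:- (1 / 2):]"
    unfolding deg unfolding eq using \<open>degree T < p ^ 3\<close> by (simp add: coeff_eq_0)
qed

definition gens :: "4 \<Rightarrow> (coord, 'a) mpoly" where
  "gens = ($) (vector [x_poly, NY, H, NZ] :: (coord, 'a) mpoly ^ 4)"

lemma gens_simps: "gens 1 = x_poly" "gens 2 = NY" "gens 3 = H" "gens 4 = NZ"
  by (simp_all add: gens_def)

sublocale product_translations_generators p W H NZ gens "- (1 / 2)"
proof unfold_locales
  show "gens 1 = x_poly" "gens 2 = y_poly ^ p - y_poly * x_poly ^ (p - 1)" "gens 3 = H" "gens 4 = NZ"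
    by (simp_all add: gens_simps NY_def)
  show "act u (gens i) = gens i" if "u \<in> G" for u i
    using exhaust_4[of i] orbit_prod_G[OF that, of y_poly] orbit_prod_G[OF that, of z_poly]
    by (auto simp: gens_simps act_simps act_H[OF that] orbit_prod_y orbit_prod_z)
  show "homogeneous (p ^ 3 + 1) H" by (rule homogeneous_H)
  show "H \<noteq> 0" "lead_exp H = single CY (p ^ 3 + 1)"
    using lead_exp_power_add_x_multiple[of "p ^ 3 + 1" H_tail] homogeneous_H unfolding H_def by blast+
  show "lead_coeff (dehom H) = [:- (1 / 2):]" "degree (dehom H) = p ^ 3" by (rule degree_dehom_H)+
  show "- (1 / 2) \<noteq> (0 :: 'a)" using two_neq_0 by simp
qed (rule NZ_props)+

theorem normal_form_hypersurface:
  "sagbi_basis {x_poly, orbit_prod p M y_poly, h1 p M, orbit_prod p M z_poly} (invariants p M) \<and>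
   hypersurface_from_tete_a_tete
     (($) (vector [x_poly, orbit_prod p M y_poly, h1 p M, orbit_prod p M z_poly] :: (coord, 'a) mpoly ^ 4))
     (Poly_Mapping.single 3 p) (Poly_Mapping.single 2 (p ^ 3 + 1)) (invariants p M)"
proof -
  have "range gens = {x_poly, NY, H, NZ}"
    unfolding UNIV_4 by (auto simp: gens_simps)
  moreover have "invariants p M = ring" by (simp add: invariants_normal ring_def)
  ultimately show ?thesis
    using sagbi hypersurface by (simp add: orbit_prod_y orbit_prod_z h1_eq gens_def)
qed

end

section \<open>Reduction to the normal form\<close>

text \<open>
  The polynomial with coefficient \<open>ds ! k\<close> at \<open>p^k\<close> does not vanish and has degree at most \<open>p^(length ds - 1)\<close>.
\<close>

lemma additive_polynomial_roots:
  fixes S :: "'a::field set"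
  assumes p: "p > 1" and d: "k < length ds" "ds ! k \<noteq> 0"
    and S: "\<And>t. t \<in> S \<Longrightarrow> (\<Sum>k<length ds. ds ! k * t ^ (p ^ k)) = 0"
  shows "card S \<le> p ^ (length ds - 1)"
proof -
  define Q where "Q = (\<Sum>k<length ds. monom (ds ! k) (p ^ k))"
  have "coeff Q (p ^ k) = (\<Sum>i<length ds. if i = k then ds ! i else 0)"
    unfolding Q_def coeff_sum using p by (intro sum.cong refl) auto
  then have "coeff Q (p ^ k) \<noteq> 0" using d by simp
  then have "Q \<noteq> 0" by auto
  moreover have "degree Q \<le> p ^ (length ds - 1)"
    unfolding Q_def
  proof (rule degree_sum_le)
    fix i assume "i \<in> {..<length ds}"
    then have "p ^ i \<le> p ^ (length ds - 1)" using p by (intro power_increasing) auto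
    then show "degree (monom (ds ! i) (p ^ i)) \<le> p ^ (length ds - 1)"
      using degree_monom_le order_trans by blast
  qed simp
  moreover have "S \<subseteq> {t. poly Q t = 0}"
    using S by (auto simp: Q_def poly_sum poly_monom)
  ultimately show ?thesis
    using card_poly_roots_bound[of Q] poly_roots_finite[of Q] card_mono[of "{t. poly Q t = 0}" S] by linarith
qed

lemma singular_left_kernel:
  fixes a b c d :: "'a::field ^ 4"
  assumes "det (vector [a, b, c, d] :: 'a ^ 4 ^ 4) = 0"
  obtains \<alpha> \<beta> \<gamma> \<epsilon> where "\<alpha> \<noteq> 0 \<or> \<beta> \<noteq> 0 \<or> \<gamma> \<noteq> 0 \<or> \<epsilon> \<noteq> 0"
    "\<And>j. \<alpha> * a $ j + \<beta> * b $ j + \<gamma> * c $ j + \<epsilon> * d $ j = 0"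
proof -
  let ?A = "vector [a, b, c, d] :: 'a ^ 4 ^ 4"
  have "\<not> invertible ?A" using assms by (simp add: invertible_det_nz)
  then have "\<nexists>B. ?A ** B = mat 1" by (simp add: invertible_right_inverse)
  then obtain f where f: "(\<Sum>i\<in>UNIV. f i *s row i ?A) = 0" "\<exists>i. f i \<noteq> 0"
    unfolding matrix_right_invertible_independent_rows by blast
  have "f 1 * a $ j + f 2 * b $ j + f 3 * c $ j + f 4 * d $ j = 0" for j
    using arg_cong[OF f(1), of "\<lambda>v. v $ j"] by (simp add: sum_4 row_def)
  moreover have "f 1 \<noteq> 0 \<or> f 2 \<noteq> 0 \<or> f 3 \<noteq> 0 \<or> f 4 \<noteq> 0" using f(2) by (metis exhaust_4)
  ultimately show ?thesis using that by blast
qed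

text \<open>
  All fibres of an additive map have at most as many elements as its kernel.
\<close>

lemma card_prime_vectors_le:
  fixes L :: "'a::field ^ 4 \<Rightarrow> 'b::ab_group_add"
  assumes "CHAR('a) > 0" and L: "\<And>c d. L (c - d) = L c - L d"
  shows "CHAR('a) ^ 4 \<le> card (L ` prime_vectors) * card {c \<in> prime_vectors. L c = 0}"
proof -
  let ?V = "prime_vectors :: ('a ^ 4) set"
  note fin = finite_prime_vectors[OF assms(1), where 'n = 4]
  have "card {c \<in> ?V. L c = t} \<le> card {c \<in> ?V. L c = 0}" for t
  proof (cases "\<exists>d\<in>?V. L d = t")
    case True
    then obtain d where d: "d \<in> ?V" "L d = t" by blast
    show ?thesis
      by (rule card_inj_on_le[of "\<lambda>c. c - d"]) (use d fin in \<open>auto simp: L intro!: inj_onI prime_field_closed(4)\<close>)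
  next
    case False
    then have "{c \<in> ?V. L c = t} = {}" by blast
    then show ?thesis by (simp only: card.empty)
  qed
  then have "(\<Sum>t\<in>L ` ?V. card {c \<in> ?V. L c = t}) \<le> card (L ` ?V) * card {c \<in> ?V. L c = 0}"
    using sum_bounded_above[of "L ` ?V" "\<lambda>t. card {c \<in> ?V. L c = t}"] by simp
  moreover have "?V = (\<Union>t\<in>L ` ?V. {c \<in> ?V. L c = t})" by auto
  then have "card ?V \<le> (\<Sum>t\<in>L ` ?V. card {c \<in> ?V. L c = t})"
    using card_UN_le[of "L ` ?V" "\<lambda>t. {c \<in> ?V. L c = t}"] fin by simp
  ultimately show ?thesis using card_prime_vectors[OF assms(1), where 'n = 4] by simp
qed

locale minors_of_matrix =
  fixes p :: nat and M :: "'a::field ^ 4 ^ 2"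
  assumes p: "prime p" "CHAR('a) = p"
begin

lemma p_gt: "p > 1" "p > 0"
  using p prime_gt_1_nat prime_gt_0_nat by blast+

lemma additive_root_bounds:
  fixes a b c d :: 'a
  shows bound2: "(\<And>t. t \<in> S \<Longrightarrow> a * t + b * t ^ p = 0) \<Longrightarrow> a \<noteq> 0 \<or> b \<noteq> 0 \<Longrightarrow> card S \<le> p"
    and bound3: "(\<And>t. t \<in> S \<Longrightarrow> a * t + b * t ^ p + c * t ^ p\<^sup>2 = 0) \<Longrightarrow>
      a \<noteq> 0 \<or> b \<noteq> 0 \<or> c \<noteq> 0 \<Longrightarrow> card S \<le> p\<^sup>2"
    and bound4: "(\<And>t. t \<in> S \<Longrightarrow> a * t + b * t ^ p + c * t ^ p\<^sup>2 + d * t ^ p ^ 3 = 0) \<Longrightarrow>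
      a \<noteq> 0 \<or> b \<noteq> 0 \<or> c \<noteq> 0 \<or> d \<noteq> 0 \<Longrightarrow> card S \<le> p ^ 3"
proof -
  note roots = additive_polynomial_roots[OF p_gt(1), where S = S]
  have sums: "(\<Sum>k<length [a, b]. [a, b] ! k * t ^ (p ^ k)) = a * t + b * t ^ p"
    "(\<Sum>k<length [a, b, c]. [a, b, c] ! k * t ^ (p ^ k)) = a * t + b * t ^ p + c * t ^ p\<^sup>2"
    "(\<Sum>k<length [a, b, c, d]. [a, b, c, d] ! k * t ^ (p ^ k)) = a * t + b * t ^ p + c * t ^ p\<^sup>2 + d * t ^ p ^ 3"
    for t
    by (simp_all add: numeral_eq_Suc)
  show "card S \<le> p" if "\<And>t. t \<in> S \<Longrightarrow> a * t + b * t ^ p = 0" "a \<noteq> 0 \<or> b \<noteq> 0"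
    using roots[of 0 "[a, b]"] roots[of 1 "[a, b]"] that unfolding sums by auto
  show "card S \<le> p\<^sup>2" if "\<And>t. t \<in> S \<Longrightarrow> a * t + b * t ^ p + c * t ^ p\<^sup>2 = 0" "a \<noteq> 0 \<or> b \<noteq> 0 \<or> c \<noteq> 0"
    using roots[of 0 "[a, b, c]"] roots[of 1 "[a, b, c]"] roots[of 2 "[a, b, c]"] that
    unfolding sums by (auto simp: numeral_2_eq_2)
  show "card S \<le> p ^ 3" if "\<And>t. t \<in> S \<Longrightarrow> a * t + b * t ^ p + c * t ^ p\<^sup>2 + d * t ^ p ^ 3 = 0"
    "a \<noteq> 0 \<or> b \<noteq> 0 \<or> c \<noteq> 0 \<or> d \<noteq> 0"
    using roots[of 0 "[a, b, c, d]"] roots[of 1 "[a, b, c, d]"] roots[of 2 "[a, b, c, d]"] roots[of 3 "[a, b, c, d]"] that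
    unfolding sums by (auto simp: numeral_2_eq_2 numeral_3_eq_3)
qed

lemma minor_relation:
  assumes "gamma p M i j k l = 0"
  obtains \<alpha> \<beta> \<gamma> \<epsilon> where "\<alpha> \<noteq> 0 \<or> \<beta> \<noteq> 0 \<or> \<gamma> \<noteq> 0 \<or> \<epsilon> \<noteq> 0"
    "\<And>c. c \<in> prime_vectors \<Longrightarrow>
      \<alpha> * (M *v c) $ (if odd i then 1 else 2) ^ (p ^ row_frob i) + \<beta> * (M *v c) $ (if odd j then 1 else 2) ^ (p ^ row_frob j)
      + \<gamma> * (M *v c) $ (if odd k then 1 else 2) ^ (p ^ row_frob k) + \<epsilon> * (M *v c) $ (if odd l then 1 else 2) ^ (p ^ row_frob l) = 0"
proof -
  let ?r = "Gamma_row p M"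
  from singular_left_kernel[OF assms[unfolded gamma_def]] obtain \<alpha> \<beta> \<gamma> \<epsilon> where
    nz: "\<alpha> \<noteq> 0 \<or> \<beta> \<noteq> 0 \<or> \<gamma> \<noteq> 0 \<or> \<epsilon> \<noteq> 0" and
    rel: "\<And>m. \<alpha> * ?r i $ m + \<beta> * ?r j $ m + \<gamma> * ?r k $ m + \<epsilon> * ?r l $ m = 0" by metis
  show ?thesis
  proof (rule that[OF nz])
    fix c :: "'a ^ 4" assume c: "c \<in> prime_vectors"
    have "(\<Sum>m\<in>UNIV. (\<alpha> * ?r i $ m + \<beta> * ?r j $ m + \<gamma> * ?r k $ m + \<epsilon> * ?r l $ m) * c $ m) = 0"
      by (simp add: rel)
    then show "\<alpha> * (M *v c) $ (if odd i then 1 else 2) ^ (p ^ row_frob i) + \<beta> * (M *v c) $ (if odd j then 1 else 2) ^ (p ^ row_frob j)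
      + \<gamma> * (M *v c) $ (if odd k then 1 else 2) ^ (p ^ row_frob k) + \<epsilon> * (M *v c) $ (if odd l then 1 else 2) ^ (p ^ row_frob l) = 0"
      unfolding Gamma_row_dot[OF p c, symmetric]
      by (simp add: sum.distrib sum_distrib_left distrib_right mult.assoc)
  qed
qed

lemma faithful:
  assumes "gamma p M 1 2 4 6 \<noteq> 0" "c \<in> prime_vectors" "M *v c = 0"
  shows "c = 0"
  using act_vector_eq_0[OF p _ assms(1,3)] assms(2) by simp

text \<open>
  Each step shrinks the image of \<open>L\<close> and thereby enlarges its kernel, on which \<open>K\<close> is injective; the larger
  kernel makes the terms with \<open>K\<close> disappear from the next relation.
\<close>

lemma first_row_rank_one:
  assumes g: "gamma p M 1 2 3 4 = 0" "gamma p M 1 2 3 5 = 0" "gamma p M 1 3 5 7 = 0" "gamma p M 1 2 4 6 \<noteq> 0"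
  shows "card ((\<lambda>c. (M *v c) $ 1) ` prime_vectors) \<le> p"
proof -
  let ?V = "prime_vectors :: ('a ^ 4) set"
  define L where "L c = (M *v c) $ 1" for c
  define K where "K c = (M *v c) $ 2" for c
  define ker where "ker = {c \<in> ?V. L c = 0}"
  have add: "L (c - d) = L c - L d" "K (c - d) = K c - K d" for c d
    by (simp_all add: L_def K_def matrix_vector_mult_diff_distrib)
  have le: "p ^ 4 \<le> card (L ` ?V) * card ker"
    unfolding ker_def using card_prime_vectors_le[of L] add(1) p p_gt by simp
  have fin: "finite ker" using finite_prime_vectors[where 'a = 'a and 'n = 4] p p_gt by (simp add: ker_def)
  have inj: "inj_on K ker"
  proof (rule inj_onI)
    fix c d assume "c \<in> ker" "d \<in> ker" "K c = K d"
    then have "M *v (c - d) = 0" "c - d \<in> ?V"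
      by (auto simp: ker_def vec_eq_iff forall_2 add[unfolded L_def K_def] L_def K_def intro!: prime_field_closed(4))
    then show "c = d" using faithful[OF g(4)] by fastforce
  qed
  obtain \<alpha> \<beta> \<gamma> \<epsilon> where
    nz: "\<alpha> \<noteq> 0 \<or> \<beta> \<noteq> 0 \<or> \<gamma> \<noteq> 0 \<or> \<epsilon> \<noteq> 0" and
    rel: "\<And>c. c \<in> ?V \<Longrightarrow> \<alpha> * L c + \<beta> * L c ^ p + \<gamma> * L c ^ p\<^sup>2 + \<epsilon> * L c ^ p ^ 3 = 0"
    by (rule minor_relation[OF g(3)], intro that) (auto simp: row_frob_def L_def)
  have "card (L ` ?V) \<le> p ^ 3" using rel nz by (intro bound4) auto
  from order_trans[OF le mult_le_mono1[OF this]] have "p ^ 4 \<le> p ^ 3 * card ker" .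
  moreover have "p ^ 4 = p ^ 3 * p" by (simp add: power_numeral_reduce)
  ultimately have "p \<le> card ker" using p_gt by simp
  then have "\<not> ker \<subseteq> {0}" using p_gt card_mono[of "{0 :: 'a ^ 4}" ker] by auto
  then obtain n where n: "n \<in> ?V" "L n = 0" "n \<noteq> 0" by (auto simp: ker_def)
  have Kn: "K n \<noteq> 0"
    using faithful[OF g(4) n(1)] n by (auto simp: L_def K_def vec_eq_iff[of "M *v n"] forall_2)
  obtain \<alpha> \<beta> \<gamma> \<epsilon> where
    nz: "\<alpha> \<noteq> 0 \<or> \<beta> \<noteq> 0 \<or> \<gamma> \<noteq> 0 \<or> \<epsilon> \<noteq> 0" and
    rel: "\<And>c. c \<in> ?V \<Longrightarrow> \<alpha> * L c + \<beta> * K c + \<gamma> * L c ^ p + \<epsilon> * L c ^ p\<^sup>2 = 0"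
    by (rule minor_relation[OF g(2)], intro that) (auto simp: row_frob_def L_def K_def)
  \<comment> \<open>evaluate at a vector in the kernel of \<open>L\<close> at which \<open>K\<close> does not vanish\<close>
  have "\<beta> = 0" using rel[OF n(1)] n(2) Kn p_gt by (simp add: power_0_left)
  then have "card (L ` ?V) \<le> p\<^sup>2" using rel nz by (intro bound3[of _ \<alpha> \<gamma> \<epsilon>]) auto
  from order_trans[OF le mult_le_mono1[OF this]] have "p ^ 4 \<le> p\<^sup>2 * card ker" .
  moreover have "p ^ 4 = p\<^sup>2 * p\<^sup>2" by (simp add: power_numeral_reduce)
  ultimately have "p\<^sup>2 * p\<^sup>2 \<le> p\<^sup>2 * card ker" by (simp only:)
  then have "p\<^sup>2 \<le> card ker" using p_gt by (subst (asm) nat_mult_le_cancel1) auto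
  then have ker2: "p\<^sup>2 \<le> card (K ` ker)" by (simp only: card_image[OF inj])
  obtain \<alpha> \<beta> \<gamma> \<epsilon> where
    nz: "\<alpha> \<noteq> 0 \<or> \<beta> \<noteq> 0 \<or> \<gamma> \<noteq> 0 \<or> \<epsilon> \<noteq> 0" and
    rel: "\<And>c. c \<in> ?V \<Longrightarrow> \<alpha> * L c + \<beta> * K c + \<gamma> * L c ^ p + \<epsilon> * K c ^ p = 0"
    by (rule minor_relation[OF g(1)], intro that) (auto simp: row_frob_def L_def K_def)
  have rel_ker: "\<beta> * K x + \<epsilon> * K x ^ p = 0" if "x \<in> ker" for x
    using rel[of x] that p_gt by (simp add: ker_def power_0_left)
  have "\<beta> = 0 \<and> \<epsilon> = 0"
  proof (rule ccontr)
    assume "\<not> (\<beta> = 0 \<and> \<epsilon> = 0)"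
    then have "card (K ` ker) \<le> p"
      using rel_ker by (intro bound2[of _ \<beta> \<epsilon>]) auto
    moreover have "p < p\<^sup>2" using p_gt power_strict_increasing[of 1 2 p] by simp
    ultimately show False using ker2 by linarith
  qed
  then show ?thesis
    using rel nz by (fold L_def, intro bound2[of _ \<alpha> \<gamma>]) auto
qed

lemma first_row_multiples:
  assumes g: "gamma p M 1 2 3 4 = 0" "gamma p M 1 2 3 5 = 0" "gamma p M 1 3 5 7 = 0" "gamma p M 1 2 4 6 \<noteq> 0"
  obtains s m where "M $ 1 $ s \<noteq> 0" "\<And>j. m j \<in> prime_field" "\<And>j. M $ 1 $ j = m j * M $ 1 $ s"
proof -
  have "\<exists>s. M $ 1 $ s \<noteq> 0"
  proof (rule ccontr)
    assume "\<nexists>s. M $ 1 $ s \<noteq> 0"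
    then show False using g(4) by (simp add: gamma_def det_4 Gamma_row_def)
  qed
  then obtain s where s: "M $ 1 $ s \<noteq> 0" by blast
  let ?im = "(\<lambda>c. (M *v c) $ 1) ` prime_vectors"
  let ?S = "(\<lambda>a. a * M $ 1 $ s) ` prime_field"
  have ax: "(M *v axis j a) $ 1 = a * M $ 1 $ j" for j a
    by (simp add: matrix_vector_mult_def axis_def if_distrib[of "\<lambda>x. _ * x"] mult.commute cong: if_cong)
  have axV: "axis j a \<in> prime_vectors" if "a \<in> prime_field" for j :: 4 and a :: 'a
    using that by (auto simp: axis_def prime_field_closed)
  have im: "a * M $ 1 $ j \<in> ?im" if "a \<in> prime_field" for j a
    using axV[OF that, of j] ax[of j a] by (intro image_eqI[of _ _ "axis j a"]) auto
  have fin: "finite ?im" using finite_prime_vectors[where 'a = 'a and 'n = 4] p p_gt by auto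
  have "card ?S = p"
    using s card_prime_field[where 'a = 'a] p p_gt by (subst card_image) (auto intro: inj_onI)
  then have "?S = ?im"
    using first_row_rank_one[OF g] im fin by (intro card_subset_eq card_seteq) auto
  then have "M $ 1 $ j \<in> ?S" for j
    using im[of 1 j] by (simp add: prime_field_closed)
  then have "\<forall>j. \<exists>a\<in>prime_field. M $ 1 $ j = a * M $ 1 $ s" by blast
  then obtain m where "\<And>j. m j \<in> prime_field \<and> M $ 1 $ j = m j * M $ 1 $ s" by metis
  then show ?thesis using that s by blast
qed

end

text \<open>
  The first three minors vanish because two rows are equal.  If the fourth one vanished, the values of the
  second row on the \<open>p^3\<close> vectors with first component \<open>0\<close> would be roots of an additive polynomial
  of degree at most \<open>p\<^sup>2\<close>.
\<close>

lemma normal_form_minors: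
  fixes M :: "'a::field ^ 4 ^ 2"
  assumes p: "prime p" "CHAR('a) = p" and M: "normal_form M"
    and inj: "\<And>c. c \<in> prime_vectors \<Longrightarrow> M *v c = 0 \<Longrightarrow> c = 0"
  shows "minor_conditions p M"
proof -
  interpret minors_of_matrix p M using p by unfold_locales
  from M obtain c2 c3 c4 where M': "M = vector [vector [1, 0, 0, 0], vector [0, c2, c3, c4]]"
    by (auto simp: normal_form_def)
  have row: "Gamma_row p M 1 = vector [1, 0, 0, 0]" "Gamma_row p M 3 = vector [1, 0, 0, 0]"
    using p_gt by (auto simp: Gamma_row_def M' vec_eq_iff forall_4 power_0_left)
  have "gamma p M 1 2 4 6 \<noteq> 0"
  proof
    assume "gamma p M 1 2 4 6 = 0"
    then obtain \<alpha> \<beta> \<gamma> \<epsilon> where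
      nz: "\<alpha> \<noteq> 0 \<or> \<beta> \<noteq> 0 \<or> \<gamma> \<noteq> 0 \<or> \<epsilon> \<noteq> 0" and
      rel: "\<And>c. c \<in> prime_vectors \<Longrightarrow>
        \<alpha> * (M *v c) $ 1 + \<beta> * (M *v c) $ 2 + \<gamma> * (M *v c) $ 2 ^ p + \<epsilon> * (M *v c) $ 2 ^ p\<^sup>2 = 0"
      by (rule minor_relation, intro that) (auto simp: row_frob_def)
    have Mc: "(M *v c) $ 1 = c $ 1" "(M *v c) $ 2 = c2 * c $ 2 + c3 * c $ 3 + c4 * c $ 4" for c
      by (simp_all add: M' matrix_vector_mult_def sum_4)
    have "axis 1 1 \<in> (prime_vectors :: ('a ^ 4) set)" by (auto simp: axis_def prime_field_closed)
    \<comment> \<open>the second row of \<open>M\<close> vanishes at the first unit vector\<close>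
    from rel[OF this] have "\<alpha> = 0" using p_gt by (simp add: Mc axis_def power_0_left)
    let ?V0 = "{c \<in> prime_vectors. c $ 1 = 0} :: ('a ^ 4) set"
    have "inj_on (\<lambda>c. (M *v c) $ 2) ?V0"
    proof (rule inj_onI)
      fix c d assume "c \<in> ?V0" "d \<in> ?V0" "(M *v c) $ 2 = (M *v d) $ 2"
      then have "c - d \<in> prime_vectors" "M *v (c - d) = 0"
        by (auto simp: matrix_vector_mult_diff_distrib vec_eq_iff forall_2 Mc(1) intro: prime_field_closed)
      then show "c = d" using inj[of "c - d"] by simp
    qed
    then have "card ?V0 = card ((\<lambda>c. (M *v c) $ 2) ` ?V0)" by (simp add: card_image)
    also have "\<dots> \<le> p\<^sup>2"
      using rel nz \<open>\<alpha> = 0\<close> by (intro bound3[of _ \<beta> \<gamma> \<epsilon>]) auto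
    finally have "card ?V0 \<le> p\<^sup>2" .
    moreover have "card ((\<lambda>c. c $ 1) ` (prime_vectors :: ('a ^ 4) set)) \<le> card (prime_field :: 'a set)"
      using p p_gt by (intro card_mono finite_prime_field) auto
    then have "card ((\<lambda>c. c $ 1) ` (prime_vectors :: ('a ^ 4) set)) \<le> p"
      using p p_gt by (simp add: card_prime_field)
    ultimately have "card ((\<lambda>c. c $ 1) ` (prime_vectors :: ('a ^ 4) set)) * card ?V0 \<le> p * p\<^sup>2"
      by (intro mult_le_mono) auto
    moreover have "p ^ 4 \<le> card ((\<lambda>c. c $ 1) ` (prime_vectors :: ('a ^ 4) set)) * card ?V0"
      using card_prime_vectors_le[of "\<lambda>c :: 'a ^ 4. c $ 1"] p p_gt by simp
    ultimately have "p ^ 4 \<le> p * p\<^sup>2" by linarith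
    also have "p * p\<^sup>2 = p ^ 3" by (simp add: power_numeral_reduce)
    finally show False using p_gt power_strict_increasing[of 3 4 p] by simp
  qed
  moreover have "det (vector [u, v, u, w] :: 'a ^ 4 ^ 4) = 0" "det (vector [u, u, v, w] :: 'a ^ 4 ^ 4) = 0"
    for u v w :: "'a ^ 4"
    by (simp_all add: det_4 algebra_simps)
  ultimately show ?thesis
    unfolding minor_conditions_def by (simp only: gamma_def row) simp
qed

text \<open>
  Column operations over the prime field clear the first row except for one entry, which is then scaled to
  \<open>1\<close> and used to clear the entry below it.
\<close>

lemma normal_form_exists:
  fixes M :: "'a::field ^ 4 ^ 2"
  assumes p: "prime p" "CHAR('a) = p"
    and g: "gamma p M 1 2 3 4 = 0" "gamma p M 1 2 3 5 = 0" "gamma p M 1 3 5 7 = 0" "gamma p M 1 2 4 6 \<noteq> 0"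
  shows "\<exists>M'. admissible_change M M' \<and> normal_form M' \<and> minor_conditions p M'"
proof -
  interpret minors_of_matrix p M using p by unfold_locales
  obtain s m where s: "M $ 1 $ s \<noteq> 0" and m: "\<And>j. m j \<in> prime_field" "\<And>j. M $ 1 $ j = m j * M $ 1 $ s"
    using first_row_multiples[OF g] by metis
  \<comment> \<open>\<open>g\<close> moves column \<open>s\<close> to the front and subtracts \<open>\<mu> j\<close> times it from column \<open>j\<close>\<close>
  define \<tau> where "\<tau> = Transposition.transpose (1 :: 4) s"
  define \<mu> where "\<mu> j = (if j = 1 then 0 else m (\<tau> j))" for j :: 4
  define g where "g = (\<chi> i j. (if i = \<tau> j then 1 else 0) - (if i = s then \<mu> j else 0) :: 'a ^ 4 ^ 4)"
  define g' where "g' = (\<chi> i j. (if i = \<tau> j then 1 else 0) + (if i = 1 then \<mu> (\<tau> j) else 0) :: 'a ^ 4 ^ 4)"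
  have prime: "\<And>i j. g $ i $ j \<in> prime_field" "\<And>i j. g' $ i $ j \<in> prime_field"
    using m(1) by (auto simp: g_def g'_def \<mu>_def prime_field_closed)
  have inv: "g ** g' = mat 1" "g' ** g = mat 1"
    using exhaust_4[of s]
    by (auto simp: g_def g'_def \<mu>_def \<tau>_def vec_eq_iff forall_4 matrix_matrix_mult_def sum_4 mat_def Transposition.transpose_def)
  have GL: "g \<in> GL4_prime_field"
    using prime inv by (auto simp: GL4_prime_field_def prime_field_def)
  have row1: "(M ** g) $ 1 $ j = (if j = 1 then M $ 1 $ s else 0)" for j
  proof -
    have "(M ** g) $ 1 $ j = M $ 1 $ \<tau> j - \<mu> j * M $ 1 $ s"
      by (simp add: matrix_matrix_mult_def g_def right_diff_distrib sum_subtractf if_distrib[of "\<lambda>x. _ * x"] cong: if_cong)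
    then show ?thesis using m(2)[of "\<tau> j"] by (cases "j = 1") (simp_all add: \<mu>_def \<tau>_def)
  qed
  define c where "c = M $ 1 $ s"
  define a where "a = - (M ** g) $ 2 $ 1 / c"
  define M' where "M' = basis_change c a (M ** g)"
  have c: "c \<noteq> 0" using s by (simp add: c_def)
  have M'_eq: "M' $ 1 $ j = inverse c * (M ** g) $ 1 $ j" "M' $ 2 $ j = (inverse c)\<^sup>2 * ((M ** g) $ 2 $ j + a * (M ** g) $ 1 $ j)" for j
    by (simp_all add: M'_def basis_change_def)
  have "admissible_change M M'"
    unfolding admissible_change_def M'_def using GL c by blast
  moreover have nf: "normal_form M'"
    unfolding normal_form_def
  proof (intro exI)
    show "M' = vector [vector [1, 0, 0, 0], vector [0, M' $ 2 $ 2, M' $ 2 $ 3, M' $ 2 $ 4]]"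
      using c by (simp add: vec_eq_iff forall_2 forall_4) (simp add: M'_eq row1 a_def flip: c_def)
  qed
  moreover have "minor_conditions p M'"
  proof (rule normal_form_minors[OF p nf])
    fix d :: "'a ^ 4" assume d: "d \<in> prime_vectors" "M' *v d = 0"
    have 1: "(M' *v d) $ 1 = inverse c * ((M ** g) *v d) $ 1"
      and 2: "(M' *v d) $ 2 = (inverse c)\<^sup>2 * (((M ** g) *v d) $ 2 + a * ((M ** g) *v d) $ 1)"
      unfolding matrix_vector_mult_def
      by (simp_all add: M'_eq sum_distrib_left sum.distrib distrib_left distrib_right mult_ac)
    have "((M ** g) *v d) $ 1 = 0" using 1 d(2) c by simp
    moreover from this have "((M ** g) *v d) $ 2 = 0" using 2 d(2) c by simp
    ultimately have "M *v (g *v d) = 0" by (simp add: vec_eq_iff forall_2 matrix_vector_mul_assoc)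
    moreover have "g *v d \<in> prime_vectors"
      using d(1) prime(1) by (auto simp: matrix_vector_mult_def sum_4 intro!: prime_field_closed)
    ultimately have "g *v d = 0" using faithful \<open>gamma p M 1 2 4 6 \<noteq> 0\<close> by blast
    then have "(g' ** g) *v d = 0" by (simp flip: matrix_vector_mul_assoc)
    then show "d = 0" by (simp add: inv)
  qed
  ultimately show ?thesis by blast
qed

section \<open>The structure theorem\<close>

theorem theorem10p4:
  fixes p :: nat and M :: "'a::field ^ 4 ^ 2"
  assumes "prime p" and "p > 2" and "CHAR('a) = p"
    and "gamma p M 1 2 3 4 = 0" and "gamma p M 1 2 3 5 = 0"
    and "gamma p M 1 3 5 7 = 0" and "gamma p M 1 2 4 6 \<noteq> 0"
  shows "(\<exists>M'. admissible_change M M' \<and> normal_form M' \<and> minor_conditions p M') \<and>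
    (\<forall>M' :: 'a ^ 4 ^ 2. normal_form M' \<and> minor_conditions p M' \<longrightarrow>
       sagbi_basis {x_poly, orbit_prod p M' y_poly, h1 p M', orbit_prod p M' z_poly}
         (invariants p M') \<and>
       hypersurface_from_tete_a_tete
         (($) (vector [x_poly, orbit_prod p M' y_poly, h1 p M', orbit_prod p M' z_poly]
            :: (coord, 'a) mpoly ^ 4))
         (Poly_Mapping.single 3 p) (Poly_Mapping.single 2 (p ^ 3 + 1))
         (invariants p M'))"
proof (intro conjI allI impI)
  show "\<exists>M'. admissible_change M M' \<and> normal_form M' \<and> minor_conditions p M'"
    using assms by (intro normal_form_exists) auto
next
  fix M' :: "'a ^ 4 ^ 2" assume M': "normal_form M' \<and> minor_conditions p M'"
  interpret normal_matrix p M'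
    using assms M' by unfold_locales (auto simp: minor_conditions_def)
  show "sagbi_basis {x_poly, orbit_prod p M' y_poly, h1 p M', orbit_prod p M' z_poly} (invariants p M')"
    using normal_form_hypersurface by blast
  show "hypersurface_from_tete_a_tete
      (($) (vector [x_poly, orbit_prod p M' y_poly, h1 p M', orbit_prod p M' z_poly] :: (coord, 'a) mpoly ^ 4))
      (Poly_Mapping.single 3 p) (Poly_Mapping.single 2 (p ^ 3 + 1)) (invariants p M')"
    using normal_form_hypersurface by blast
qed

end
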